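(* Let $j<0$ be an integer and let $$F(z)= z^{2j+1}e^{Az^2}\,\frac{\prod_{\nu=1}^{\omega_1}\left(1+\frac{z^2}{a_\nu}\right)}{\prod_{\mu=1}^{\omega_2}\left(1-\frac{z^2}{b_\mu}\right)},\qquad F(z)\not\equiv z^{2j+1},$$ where $0<\omega_1,\omega_2\le+\infty$, $A\ge0$ and $a_\nu,b_\mu>0$ for all $\nu,\mu$. Let $\alpha\in\mathbb{C}\setminus\{0\}$, and let $(z_n)_{n=1}^{\omega}$ be all $\alpha$-points of $F$ (zeros of $F-\alpha$), ordered so that $|z_{n-1}|\le|z_n|$ and each repeated according to multiplicity. Then: (i) If $\Im\alpha^2\ne0$, then all $\alpha$-points are simple and satisfy $0<|z_1|<|z_2|<\cdots$; $\Im z_n^2\ne0$ for every $n$, and $z_n\in Q_l\implies z_{n+1}\in Q_{l+\operatorname{sign}(\Im\alpha^2)}$. Moreover, $(-1)^j\,\Im\alpha\,\Im z_1>0$ and $\Im\alpha^2\,\Re z_1\,\Im z_1<0$. (ii) If $\Im\alpha=0$, then $0<|z_1|\le|z_2|<|z_3|\le|z_4|<|z_5|\le\cdots$, there are no purely imaginary $\alpha$-points, real $\alpha$-points can be simple or double, and the other $\alpha$-points are simple. Moreover, for each natural $n$: $|z_{2n-1}|=|z_{2n}|\implies z_{2n-1}=\overline{z}_{2n}$; $|z_{2n-1}|<|z_{2n}|\implies\operatorname{Arg}z_{2n-1}=\operatorname{Arg}z_{2n}\in\{0,\pi\}$; $\Re z_{2n}\,\Re z_{2n+1}<0$; $(-1)^j\alpha\,\Re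 z_1<0$; and $|z_1|<|z_2|\implies j=-1$. (iii) If $\Re\alpha=0$, then $0<|z_1|<|z_2|\le|z_3|<|z_4|\le|z_5|<\cdots$, there are no real $\alpha$-points, purely imaginary $\alpha$-points can be simple or double, and the other $\alpha$-points are simple. Moreover, for each natural $n$: $|z_{2n}|=|z_{2n+1}|\implies z_{2n}=-\overline{z}_{2n+1}$; $|z_{2n}|<|z_{2n+1}|\implies\operatorname{Arg}z_{2n}=\operatorname{Arg}z_{2n+1}\in\{-\frac\pi2,\frac\pi2\}$; $\Im z_{2n-1}\,\Im z_{2n}<0$; $(-1)^j\,\Im\alpha\,\Im z_1>0$; and $\Re z_1=0$.
   Context: For $l\in\mathbb{Z}$, $Q_l:=\{z\ne0:0<\operatorname{Arg}(z\,i^{-l})<\frac\pi2\}$ are the open quadrants ($Q_{l+4}=Q_l$; $\operatorname{Arg}$ is the principal argument). The products are absolutely convergent. An $\alpha$-point is a $z$ with $F(z)=\alpha$; its multiplicity is the order of the zero of $F-\alpha$ there. Each assertion involving particular $z_n$ is made for those indices for which the $\alpha$-points involved exist. *)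

theory Defs
  imports "HOL-Complex_Analysis.Complex_Analysis"
begin

definition idx :: "enat \<Rightarrow> nat set" where
  "idx \<omega> = {n. 1 \<le> n \<and> enat n \<le> \<omega>}"

(* Factors are indexed from 1; prodinf runs over 0, 1, 2, ..., hence the shift.
   Missing factors of a finite product are filled up with 1. *)
definition ext_factor :: "enat \<Rightarrow> (nat \<Rightarrow> complex) \<Rightarrow> nat \<Rightarrow> complex" where
  "ext_factor \<omega> f k = (if Suc k \<in> idx \<omega> then f (Suc k) else 1)"

definition ext_prod :: "enat \<Rightarrow> (nat \<Rightarrow> complex) \<Rightarrow> complex" where
  "ext_prod \<omega> f = prodinf (ext_factor \<omega> f)"

definition abs_conv_ext_prod :: "enat \<Rightarrow> (nat \<Rightarrow> complex) \<Rightarrow> bool" where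
  "abs_conv_ext_prod \<omega> f \<longleftrightarrow> abs_convergent_prod (ext_factor \<omega> f)"

definition quadrant :: "int \<Rightarrow> complex set" where
  "quadrant l = {z. z \<noteq> 0 \<and> 0 < Arg (z * \<i> powi (- l)) \<and> Arg (z * \<i> powi (- l)) < pi / 2}"

(* Requiring analyticity excludes the poles of a meromorphic F, where division by zero
   would otherwise assign F a spurious value. *)
definition alpha_points :: "(complex \<Rightarrow> complex) \<Rightarrow> complex \<Rightarrow> complex set" where
  "alpha_points F \<alpha> = {z. F analytic_on {z} \<and> F z = \<alpha>}"

definition alpha_mult :: "(complex \<Rightarrow> complex) \<Rightarrow> complex \<Rightarrow> complex \<Rightarrow> nat" where
  "alpha_mult F \<alpha> p = nat (zorder (\<lambda>z. F z - \<alpha>) p)"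

(* z 1, z 2, ... (\<omega> terms; values outside idx \<omega> are irrelevant) lists all \<alpha>-points of F by
   nondecreasing modulus, each as often as its multiplicity. *)
definition enumerates_alpha_points ::
  "(complex \<Rightarrow> complex) \<Rightarrow> complex \<Rightarrow> enat \<Rightarrow> (nat \<Rightarrow> complex) \<Rightarrow> bool" where
  "enumerates_alpha_points F \<alpha> \<omega> z \<longleftrightarrow>
     (\<forall>n\<in>idx \<omega>. z n \<in> alpha_points F \<alpha>) \<and>
     (\<forall>p\<in>alpha_points F \<alpha>. finite {n \<in> idx \<omega>. z n = p} \<and>
        card {n \<in> idx \<omega>. z n = p} = alpha_mult F \<alpha> p) \<and>
     (\<forall>n\<ge>1. Suc n \<in> idx \<omega> \<longrightarrow> cmod (z n) \<le> cmod (z (Suc n)))"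

end

theory Submission
  imports Defs
begin

text \<open>Put \<open>F z = z powi (2 j + 1) * G (z\<^sup>2)\<close> with \<open>G = E / D\<close>. The logarithmic derivative \<open>q z = z G' z / G z\<close> has
  positive imaginary part in the upper half-plane, and \<open>\<bar>G z\<bar>\<close> decreases strictly in \<open>Arg z\<close> there. Hence
  \<open>f w = log F (exp w)\<close> satisfies \<open>Im f' > 0\<close> in the strip \<open>0 < Im w < pi / 2\<close>, and every circle of radius
  \<open>exp s\<close> meets the closed first quadrant in at most one point with \<open>\<bar>F\<bar> = \<bar>\<alpha>\<bar>\<close>, at an argument \<open>\<phi> s\<close> that depends
  continuously on \<open>s\<close>. Along this curve \<open>V = Im f\<close> is nondecreasing, and strictly increasing off the axes,
  because the divided difference of \<open>f\<close> between two points with equal \<open>Re f\<close> has positive imaginary part. It starts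
  from \<open>(2 j + 1) pi / 2\<close>. Since \<open>F\<close> is odd and real on the real axis, the \<open>\<alpha>\<close>-points are the reflections in the
  axes of the points of the curve at which \<open>V\<close> is an argument of one of \<open>\<plusminus>\<alpha>\<close>, \<open>\<plusminus>cnj \<alpha>\<close>, so the monotonicity of \<open>V\<close> orders
  them. If \<open>V\<close> is constant on an interval, the curve lies on an axis there, where \<open>ln \<bar>F\<bar>\<close> is strictly convex or
  concave in \<open>s\<close>; this confines the \<open>\<alpha>\<close>-points to the ends of the interval, double if the ends coincide and simple
  otherwise.\<close>

section \<open>Products over negative zeros\<close>

definition canon_prod :: "(nat \<Rightarrow> real) \<Rightarrow> complex \<Rightarrow> complex" where
  "canon_prod c z = (\<Prod>k. 1 + of_real (c k) * z)"

context
  fixes c :: "nat \<Rightarrow> real"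
  assumes c: "summable c" "\<And>k. c k \<ge> 0"
begin

lemma canon_prod_convergent: "convergent_prod (\<lambda>k. 1 + of_real (c k) * (z::complex))"
proof (rule abs_convergent_prod_imp_convergent_prod)
  have "summable (\<lambda>k. norm ((1 + of_real (c k) * z) - 1))"
    using c by (simp add: norm_mult summable_mult2)
  then show "abs_convergent_prod (\<lambda>k. 1 + of_real (c k) * z)"
    by (simp only: abs_convergent_prod_conv_summable)
qed

lemma canon_prod_tendsto: "(\<lambda>n. \<Prod>k<n. 1 + of_real (c k) * z) \<longlonglongrightarrow> canon_prod c z"
  using convergent_prod_LIMSEQ[OF canon_prod_convergent, of z]
  unfolding canon_prod_def
  by (subst (asm) lessThan_Suc_atMost [symmetric])
    (rule LIMSEQ_imp_Suc[where f = "\<lambda>n. \<Prod>k<n. 1 + of_real (c k) * z"])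

lemma canon_prod_uniform_limit:
  "uniform_limit (cball x 1) (\<lambda>N z. \<Prod>k<N. 1 + of_real (c k) * z) (canon_prod c) sequentially"
proof -
  let ?K = "cball x 1"
  have bd: "norm z \<le> norm x + 1" if "z \<in> ?K" for z
    using that norm_triangle_ineq[of "z - x" x] by (simp add: dist_norm norm_minus_commute)
  have "uniformly_convergent_on ?K (\<lambda>N z. \<Sum>k<N. norm (of_real (c k) * z))"
    by (rule Weierstrass_m_test'_ev[where M = "\<lambda>k. c k * (norm x + 1)"])
      (use c bd in \<open>auto simp: norm_mult summable_mult2 intro!: mult_left_mono always_eventually\<close>)
  then have "uniformly_convergent_on ?K (\<lambda>N z. \<Prod>k<N. 1 + of_real (c k) * z)"
    by (intro uniformly_convergent_on_prod) (auto intro!: continuous_intros)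
  then obtain l where l: "uniform_limit ?K (\<lambda>N z. \<Prod>k<N. 1 + of_real (c k) * z) l sequentially"
    by (auto simp: uniformly_convergent_on_def)
  have "l z = canon_prod c z" if "z \<in> ?K" for z
    using tendsto_uniform_limitI[OF l that] canon_prod_tendsto LIMSEQ_unique by blast
  with l show ?thesis
    by (subst uniform_limit_cong'[where g = "\<lambda>N z. \<Prod>k<N. 1 + of_real (c k) * z" and i = l]) auto
qed

lemma canon_prod_holomorphic: "canon_prod c holomorphic_on S"
proof -
  have "canon_prod c holomorphic_on UNIV"
    by (rule holomorphic_uniform_sequence[where f = "\<lambda>n z. \<Prod>k<n. 1 + of_real (c k) * z"])
      (auto intro!: holomorphic_intros canon_prod_uniform_limit exI[of _ "1::real"])
  then show ?thesis by (rule holomorphic_on_subset) auto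
qed

lemma canon_prod_eq_0_imp: "canon_prod c z = 0 \<Longrightarrow> Im z = 0 \<and> Re z < 0"
proof -
  assume "canon_prod c z = 0"
  then obtain k where k: "1 + of_real (c k) * z = 0"
    using prodinf_nonzero[OF canon_prod_convergent] unfolding canon_prod_def by blast
  then have *: "1 + c k * Re z = 0" "c k * Im z = 0"
    by (auto simp: complex_eq_iff)
  then have "c k > 0" using c(2)[of k] by (cases "c k = 0") auto
  moreover have "c k * Re z < 0" using * by linarith
  ultimately show ?thesis using * by (auto simp: mult_less_0_iff)
qed

lemma canon_prod_nonzero: "Im z \<noteq> 0 \<or> Re z \<ge> 0 \<Longrightarrow> canon_prod c z \<noteq> 0"
  using canon_prod_eq_0_imp[of z] by auto

lemma canon_prod_logderiv_sums:
  assumes nz: "canon_prod c z \<noteq> 0"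
  shows "(\<lambda>k. Im z * (c k / (norm (1 + of_real (c k) * z))\<^sup>2)) sums Im (z * deriv (canon_prod c) z / canon_prod c z)"
proof -
  obtain r where r: "r > 0" "uniform_limit (ball z r) (\<lambda>N z. \<Prod>k<N. 1 + of_real (c k) * z) (canon_prod c) sequentially"
    using uniform_limit_on_subset[OF canon_prod_uniform_limit[of z] ball_subset_cball] zero_less_one
    by metis
  have "(\<lambda>k. deriv (\<lambda>z. 1 + of_real (c k) * z) z / (1 + of_real (c k) * z)) sums
      (deriv (canon_prod c) z / canon_prod c z)"
    using r nz by (intro logderiv_prodinf_complex_uniform_limit[OF r(2)]) (auto intro!: holomorphic_intros)
  moreover have "deriv (\<lambda>z. 1 + of_real (c k) * z) z = of_real (c k)" for k
    by (rule DERIV_imp_deriv) (auto intro!: derivative_eq_intros)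
  ultimately have "(\<lambda>k. z * (of_real (c k) / (1 + of_real (c k) * z))) sums
      (z * (deriv (canon_prod c) z / canon_prod c z))"
    by (intro sums_mult) auto
  then have "(\<lambda>k. Im (z * (of_real (c k) / (1 + of_real (c k) * z)))) sums
      Im (z * (deriv (canon_prod c) z / canon_prod c z))"
    by (rule sums_Im)
  moreover have "Im (z * (of_real (c k) / (1 + of_real (c k) * z)))
      = Im z * (c k / (norm (1 + of_real (c k) * z))\<^sup>2)" for k
    unfolding cmod_power2
    by (simp add: Im_divide Re_divide algebra_simps power2_eq_square)
  ultimately show ?thesis by simp
qed

lemma canon_prod_cnj: "canon_prod c (cnj z) = cnj (canon_prod c z)"
proof -
  have "(\<lambda>n. cnj (\<Prod>k<n. 1 + of_real (c k) * z)) \<longlonglongrightarrow> cnj (canon_prod c z)"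
    by (intro tendsto_intros canon_prod_tendsto)
  then have "(\<lambda>n. \<Prod>k<n. 1 + of_real (c k) * cnj z) \<longlonglongrightarrow> cnj (canon_prod c z)"
    by simp
  then show ?thesis using canon_prod_tendsto LIMSEQ_unique by blast
qed

lemma canon_prod_norm_mono:
  assumes "norm u = norm v" "Re u \<le> Re v"
  shows "norm (canon_prod c u) \<le> norm (canon_prod c v)"
proof (rule tendsto_le[OF _ tendsto_norm[OF canon_prod_tendsto] tendsto_norm[OF canon_prod_tendsto]])
  have "norm (1 + of_real (c k) * u) \<le> norm (1 + of_real (c k) * v)" for k
  proof (rule power2_le_imp_le)
    have *: "(norm (1 + of_real (c k) * w))\<^sup>2 = 1 + 2 * c k * Re w + (c k)\<^sup>2 * (norm w)\<^sup>2" for w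
      unfolding cmod_power2 by (simp add: algebra_simps power2_eq_square)
    have "c k * Re u \<le> c k * Re v" using assms c by (simp add: mult_left_mono)
    then show "(norm (1 + of_real (c k) * u))\<^sup>2 \<le> (norm (1 + of_real (c k) * v))\<^sup>2"
      unfolding * using assms by simp
  qed auto
  then show "\<forall>\<^sub>F n in sequentially. norm (\<Prod>k<n. 1 + of_real (c k) * u) \<le> norm (\<Prod>k<n. 1 + of_real (c k) * v)"
    by (intro always_eventually allI) (auto simp flip: prod_norm intro!: prod_mono)
qed auto

end

lemma canon_prod_0 [simp]: "canon_prod c 0 = 1"
  by (simp add: canon_prod_def)

lemma canon_prod_split_head:
  assumes "summable c" "\<And>k. c k \<ge> 0"
  shows "canon_prod c z = (1 + of_real (c 0) * z) * canon_prod (\<lambda>k. c (Suc k)) z"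
  using has_prod_unique[OF has_prod_ignore_initial_segment'[OF canon_prod_convergent[OF assms, of z], of 1]]
  by (simp add: canon_prod_def)

lemma canon_prod_norm_strict_mono:
  assumes c: "summable c" "\<And>k. c k \<ge> 0" "c 0 > 0"
    and uv: "norm u = norm v" "Re u < Re v"
  shows "norm (canon_prod c u) < norm (canon_prod c v)"
proof -
  have c': "summable (\<lambda>k. c (Suc k))" using c(1) by (simp add: summable_Suc_iff)
  have "norm (1 + of_real (c 0) * u) < norm (1 + of_real (c 0) * v)"
  proof (rule power2_less_imp_less)
    have *: "(norm (1 + of_real (c 0) * w))\<^sup>2 = 1 + 2 * c 0 * Re w + (c 0)\<^sup>2 * (norm w)\<^sup>2" for w
      unfolding cmod_power2 by (simp add: algebra_simps power2_eq_square)
    show "(norm (1 + of_real (c 0) * u))\<^sup>2 < (norm (1 + of_real (c 0) * v))\<^sup>2"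
      unfolding * using uv c by simp
  qed auto
  moreover have "canon_prod (\<lambda>k. c (Suc k)) v \<noteq> 0"
  proof
    assume "canon_prod (\<lambda>k. c (Suc k)) v = 0"
    then have "Im v = 0" "Re v < 0" using canon_prod_eq_0_imp[OF c'] c by blast+
    then have "norm v = - Re v" by (simp add: cmod_def)
    then show False using uv abs_Re_le_cmod[of u] by linarith
  qed
  moreover have "norm (canon_prod (\<lambda>k. c (Suc k)) u) \<le> norm (canon_prod (\<lambda>k. c (Suc k)) v)"
    by (rule canon_prod_norm_mono) (use c' c uv in auto)
  ultimately show ?thesis
    unfolding canon_prod_split_head[OF c(1,2)] norm_mult
    by (metis (no_types, lifting) mult_le_less_imp_less mult_left_mono norm_ge_zero mult_strict_right_mono order_le_less_trans zero_less_norm_iff)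
qed

section \<open>The logarithmic derivative\<close>

locale laguerre_quotient =
  fixes j :: int and A :: real and c d :: "nat \<Rightarrow> real"
  assumes j: "j < 0" and A: "A \<ge> 0"
    and c: "summable c" "\<And>k. c k \<ge> 0" "c 0 > 0"
    and d: "summable d" "\<And>k. d k \<ge> 0"
begin

definition E :: "complex \<Rightarrow> complex" where "E z = exp (of_real A * z) * canon_prod c z"
definition D :: "complex \<Rightarrow> complex" where "D z = canon_prod d (- z)"

definition q :: "complex \<Rightarrow> complex" where
  "q z = of_real A * z + z * deriv (canon_prod c) z / canon_prod c z
           - (- z) * deriv (canon_prod d) (- z) / canon_prod d (- z)"

lemma E_holomorphic: "E holomorphic_on S"
  unfolding E_def by (intro holomorphic_intros canon_prod_holomorphic[OF c(1,2)])

lemma D_holomorphic: "D holomorphic_on S"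
  unfolding D_def
  using holomorphic_on_compose[OF _ canon_prod_holomorphic[OF d], of uminus S]
  by (simp add: o_def holomorphic_on_minus)

lemma E_continuous [continuous_intros]: "continuous_on S h \<Longrightarrow> continuous_on S (\<lambda>x. E (h x))"
  using continuous_on_compose2[OF holomorphic_on_imp_continuous_on[OF E_holomorphic[of UNIV]], of S h] by simp

lemma D_continuous [continuous_intros]: "continuous_on S h \<Longrightarrow> continuous_on S (\<lambda>x. D (h x))"
  using continuous_on_compose2[OF holomorphic_on_imp_continuous_on[OF D_holomorphic[of UNIV]], of S h] by simp

lemma E_nonzero: "Im z \<noteq> 0 \<or> Re z \<ge> 0 \<Longrightarrow> E z \<noteq> 0"
  using canon_prod_nonzero[OF c(1,2)] by (auto simp: E_def)

lemma D_nonzero: "Im z \<noteq> 0 \<or> Re z \<le> 0 \<Longrightarrow> D z \<noteq> 0"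
  using canon_prod_nonzero[OF d, of "- z"] by (auto simp: D_def)

lemma E_0 [simp]: "E 0 = 1" and D_0 [simp]: "D 0 = 1"
  by (simp_all add: E_def D_def)

lemma E_cnj: "E (cnj z) = cnj (E z)"
  by (simp add: E_def canon_prod_cnj[OF c(1,2)] exp_cnj)

lemma D_cnj: "D (cnj z) = cnj (D z)"
  unfolding D_def by (simp flip: canon_prod_cnj[OF d])

lemma E_norm_strict_mono:
  assumes "norm u = norm v" "Re u < Re v"
  shows "norm (E u) < norm (E v)"
proof -
  have "exp (A * Re u) * norm (canon_prod c u) < exp (A * Re v) * norm (canon_prod c v)"
    by (rule mult_le_less_imp_less)
      (use assms A canon_prod_norm_strict_mono[OF c assms] in \<open>auto intro: mult_left_mono\<close>)
  then show ?thesis by (simp add: E_def norm_mult)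
qed

lemma D_norm_mono:
  assumes "norm u = norm v" "Re u \<le> Re v"
  shows "norm (D v) \<le> norm (D u)"
  unfolding D_def by (rule canon_prod_norm_mono[OF d]) (use assms in auto)

lemma quotient_has_field_derivative:
  assumes "E z \<noteq> 0" "D z \<noteq> 0"
  obtains G' where "((\<lambda>z. E z / D z) has_field_derivative G') (at z)" "z * G' = E z / D z * q z"
proof -
  have c0: "canon_prod c z \<noteq> 0" and d0: "canon_prod d (- z) \<noteq> 0"
    using assms by (auto simp: E_def D_def)
  have [derivative_intros]: "(canon_prod c has_field_derivative deriv (canon_prod c) z) (at z)"
    "(canon_prod d has_field_derivative deriv (canon_prod d) (- z)) (at (- z))"
    by (auto intro!: holomorphic_derivI[OF canon_prod_holomorphic[of _ UNIV]] c d)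
  have "((\<lambda>z. canon_prod d (- z)) has_field_derivative deriv (canon_prod d) (- z) * (- 1)) (at z)"
    by (rule DERIV_chain2[of "canon_prod d"]) (auto intro!: derivative_eq_intros)
  note [derivative_intros] = this
  have "((\<lambda>z. E z / D z) has_field_derivative
      (exp (of_real A * z) * of_real A * canon_prod c z + exp (of_real A * z) * deriv (canon_prod c) z) / D z
      + E z * deriv (canon_prod d) (- z) / (D z)\<^sup>2) (at z)"
    unfolding E_def D_def
    by (auto intro!: derivative_eq_intros simp: d0 power2_eq_square field_simps)
  then show thesis
    by (rule that) (use c0 d0 in \<open>simp add: q_def E_def D_def power2_eq_square field_simps\<close>)
qed

lemma Im_q_real: "Im z = 0 \<Longrightarrow> E z \<noteq> 0 \<Longrightarrow> D z \<noteq> 0 \<Longrightarrow> Im (q z) = 0"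
  using sums_unique[OF canon_prod_logderiv_sums[OF c(1,2), of z]]
    sums_unique[OF canon_prod_logderiv_sums[OF d, of "- z"]]
  by (simp add: q_def E_def D_def)

lemma Im_q_ge:
  assumes "Im z \<ge> 0" "E z \<noteq> 0" "D z \<noteq> 0"
  shows "Im z * (c 0 / (norm (1 + of_real (c 0) * z))\<^sup>2) \<le> Im (q z)"
proof -
  have 1: "(\<lambda>k. Im z * (c k / (norm (1 + of_real (c k) * z))\<^sup>2)) sums Im (z * deriv (canon_prod c) z / canon_prod c z)"
    by (rule canon_prod_logderiv_sums[OF c(1,2)]) (use assms in \<open>auto simp: E_def\<close>)
  have 2: "(\<lambda>k. Im (- z) * (d k / (norm (1 + of_real (d k) * (- z)))\<^sup>2)) sums
      Im ((- z) * deriv (canon_prod d) (- z) / canon_prod d (- z))"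
    by (rule canon_prod_logderiv_sums[OF d]) (use assms in \<open>auto simp: D_def\<close>)
  have "Im z * (c 0 / (norm (1 + of_real (c 0) * z))\<^sup>2) = (\<Sum>k\<in>{0}. Im z * (c k / (norm (1 + of_real (c k) * z))\<^sup>2))"
    by simp
  also have "\<dots> \<le> (\<Sum>k. Im z * (c k / (norm (1 + of_real (c k) * z))\<^sup>2))"
    by (rule sum_le_suminf) (use 1 c assms in \<open>auto simp: sums_iff\<close>)
  also have "\<dots> = Im (z * deriv (canon_prod c) z / canon_prod c z)"
    using 1 by (simp add: sums_iff)
  finally have "Im z * (c 0 / (norm (1 + of_real (c 0) * z))\<^sup>2) \<le> Im (z * deriv (canon_prod c) z / canon_prod c z)" .
  moreover have "Im ((- z) * deriv (canon_prod d) (- z) / canon_prod d (- z)) \<le> 0"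
    by (rule sums_le[OF _ 2 sums_zero])
      (use assms d in \<open>auto simp: mult_nonneg_nonneg\<close>)
  moreover have "Im (of_real A * z) \<ge> 0" using A assms by simp
  ultimately show ?thesis unfolding q_def minus_complex.sel plus_complex.sel by linarith
qed

lemma Im_q_pos: "Im z > 0 \<Longrightarrow> Im (q z) > 0"
proof -
  assume z: "Im z > 0"
  have "1 + of_real (c 0) * z \<noteq> 0" using z c(3) by (auto simp: complex_eq_iff)
  then have "0 < Im z * (c 0 / (norm (1 + of_real (c 0) * z))\<^sup>2)" using z c(3) by simp
  also have "\<dots> \<le> Im (q z)" using z by (intro Im_q_ge E_nonzero D_nonzero) auto
  finally show ?thesis .
qed

lemma open_domain: "open {z. E z \<noteq> 0 \<and> D z \<noteq> 0}"
  unfolding Collect_conj_eq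
  by (intro open_Int open_Collect_neq continuous_intros)

lemma q_holomorphic: "q holomorphic_on {z. E z \<noteq> 0 \<and> D z \<noteq> 0}"
proof -
  have "(\<lambda>z. deriv (canon_prod d) (- z)) holomorphic_on UNIV" "(\<lambda>z. canon_prod d (- z)) holomorphic_on UNIV"
    using holomorphic_on_compose[of uminus UNIV] canon_prod_holomorphic[OF d, of UNIV]
      holomorphic_deriv[OF canon_prod_holomorphic[OF d, of UNIV]]
    by (auto simp: o_def holomorphic_on_minus)
  moreover have "canon_prod c holomorphic_on UNIV" "deriv (canon_prod c) holomorphic_on UNIV"
    using canon_prod_holomorphic[OF c(1,2), of UNIV] holomorphic_deriv by auto
  ultimately show ?thesis unfolding q_def
    by (intro holomorphic_intros) (use open_domain in \<open>auto simp: E_def D_def intro: holomorphic_on_subset\<close>)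
qed

lemma q_has_field_derivative:
  "E z \<noteq> 0 \<Longrightarrow> D z \<noteq> 0 \<Longrightarrow> (q has_field_derivative deriv q z) (at z)"
  by (rule holomorphic_derivI[OF q_holomorphic open_domain]) auto

text \<open>Since \<open>q\<close> is real on the real axis, \<open>Re (q' x)\<close> is the limit of \<open>Im (q (x + \<i>t)) / t\<close>.\<close>

lemma Re_deriv_q_pos:
  assumes "Im z = 0" "E z \<noteq> 0" "D z \<noteq> 0"
  shows "Re (deriv q z) > 0"
proof -
  have nz: "1 + of_real (c 0) * z \<noteq> 0"
    using assms(2) canon_prod_split_head[OF c(1,2), of z] by (auto simp: E_def)
  let ?m = "\<lambda>t::real. c 0 / (norm (1 + of_real (c 0) * (z + \<i> * of_real t)))\<^sup>2"
  have "((\<lambda>h. (q (z + h) - q z) / h) \<longlongrightarrow> deriv q z) (at 0)"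
    using q_has_field_derivative[OF assms(2,3)] by (simp add: DERIV_def)
  moreover have "filterlim (\<lambda>t::real. \<i> * of_real t) (at 0) (at_right 0)"
    by (auto simp: filterlim_at eventually_at_filter intro!: tendsto_eq_intros)
  ultimately have "((\<lambda>t. (q (z + \<i> * of_real t) - q z) / (\<i> * of_real t)) \<longlongrightarrow> deriv q z) (at_right 0)"
    by (rule filterlim_compose)
  then have "((\<lambda>t. Re ((q (z + \<i> * of_real t) - q z) / (\<i> * of_real t))) \<longlongrightarrow> Re (deriv q z)) (at_right 0)"
    by (rule tendsto_Re)
  moreover have "(?m \<longlongrightarrow> c 0 / (norm (1 + of_real (c 0) * z))\<^sup>2) (at_right 0)"
    using nz by (auto intro!: tendsto_eq_intros)
  moreover have "\<forall>\<^sub>F t in at_right 0. ?m t \<le> Re ((q (z + \<i> * of_real t) - q z) / (\<i> * of_real t))"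
    unfolding eventually_at_right_field
  proof (intro exI[of _ 1] conjI allI impI)
    fix t :: real assume t: "0 < t" "t < 1"
    have "t * ?m t \<le> Im (q (z + \<i> * of_real t))"
      using Im_q_ge[of "z + \<i> * of_real t"] E_nonzero[of "z + \<i> * of_real t"] D_nonzero[of "z + \<i> * of_real t"] t assms
      by simp
    moreover have "Re ((q (z + \<i> * of_real t) - q z) / (\<i> * of_real t)) = Im (q (z + \<i> * of_real t)) / t"
      using Im_q_real[OF assms] t by (simp add: Re_divide power2_eq_square)
    ultimately show "?m t \<le> Re ((q (z + \<i> * of_real t) - q z) / (\<i> * of_real t))"
      using t by (simp add: pos_le_divide_eq mult.commute)
  qed simp
  ultimately have "c 0 / (norm (1 + of_real (c 0) * z))\<^sup>2 \<le> Re (deriv q z)"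
    by (intro tendsto_le[OF trivial_limit_at_right_real])
  moreover have "0 < c 0 / (norm (1 + of_real (c 0) * z))\<^sup>2" using nz c(3) by simp
  ultimately show ?thesis by linarith
qed

end

section \<open>A logarithm of the quotient\<close>

lemma has_field_derivative_continuous_log:
  fixes g h :: "complex \<Rightarrow> complex"
  assumes S: "open S" "z \<in> S" and g: "continuous_on S g" and eq: "\<And>w. w \<in> S \<Longrightarrow> exp (g w) = h w"
    and h: "(h has_field_derivative h') (at z)"
  shows "(g has_field_derivative h' / h z) (at z)"
proof -
  obtain \<psi> where \<psi>: "\<And>y. exp y - exp (g z) = \<psi> y * (y - g z)" "isCont \<psi> (g z)" "\<psi> (g z) = exp (g z)"
    using DERIV_exp[of "g z"] unfolding CARAT_DERIV by blast
  obtain \<eta> where \<eta>: "\<And>w. h w - h z = \<eta> w * (w - z)" "isCont \<eta> z" "\<eta> z = h'"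
    using h unfolding CARAT_DERIV by blast
  have "isCont g z" using g S by (simp add: continuous_on_eq_continuous_at)
  then have lim: "((\<lambda>w. \<psi> (g w)) \<longlongrightarrow> \<psi> (g z)) (at z)"
    using \<psi>(2) isCont_o2[of z g \<psi>] by (simp add: isCont_def)
  have "((\<lambda>w. \<eta> w / \<psi> (g w)) \<longlongrightarrow> \<eta> z / \<psi> (g z)) (at z)"
    using \<eta>(2) \<psi>(3) by (intro tendsto_divide lim) (auto simp: isCont_def)
  moreover have "\<forall>\<^sub>F w in at z. \<eta> w / \<psi> (g w) = (g w - g z) / (w - z)"
  proof -
    have "\<forall>\<^sub>F w in at z. \<psi> (g w) \<noteq> 0" by (rule tendsto_imp_eventually_ne[OF lim]) (simp add: \<psi>(3))
    moreover have "\<forall>\<^sub>F w in at z. w \<in> S" using S by (rule eventually_at_in_open')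
    moreover have "\<forall>\<^sub>F w in at z. w \<noteq> z" by (simp add: eventually_at_filter)
    ultimately show ?thesis
    proof eventually_elim
      case (elim w)
      have "\<psi> (g w) * (g w - g z) = \<eta> w * (w - z)"
        using \<psi>(1)[of "g w"] \<eta>(1)[of w] eq elim S by auto
      with elim show ?case by (simp add: field_simps)
    qed
  qed
  ultimately have "((\<lambda>w. (g w - g z) / (w - z)) \<longlongrightarrow> \<eta> z / \<psi> (g z)) (at z)"
    by (simp add: tendsto_cong)
  then show ?thesis using \<psi>(3) \<eta>(3) eq[OF S(2)] by (simp add: has_field_derivative_iff)
qed

context laguerre_quotient
begin

definition H :: "complex set" where "H = {z. Im z \<ge> 0 \<and> E z \<noteq> 0 \<and> D z \<noteq> 0}"

lemma upper_half_plane_subset_H: "{z. Im z > 0} \<subseteq> H"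
  using E_nonzero D_nonzero by (auto simp: H_def)

lemma contractible_H: "contractible H"
proof -
  have i: "\<i> \<in> H" using upper_half_plane_subset_H by auto
  have "closed_segment \<i> z \<subseteq> H" if z: "z \<in> H" for z
  proof
    fix w assume "w \<in> closed_segment \<i> z"
    then obtain u where u: "0 \<le> u" "u \<le> 1" "w = (1 - u) *\<^sub>R \<i> + u *\<^sub>R z"
      by (auto simp: closed_segment_def)
    show "w \<in> H"
    proof (cases "u = 1")
      case True then show ?thesis using u z by simp
    next
      case False
      then have "(1 - u) + u * Im z > 0" using u z by (intro add_pos_nonneg) (auto simp: H_def)
      then show ?thesis using u upper_half_plane_subset_H by auto
    qed
  qed
  then show ?thesis using i by (intro starlike_imp_contractible) (auto simp: starlike_def)
qed

definition logG :: "complex \<Rightarrow> complex" where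
  "logG = (SOME g. continuous_on H g \<and> g 0 = 0 \<and> (\<forall>z\<in>H. exp (g z) = E z / D z))"

lemma logG: "continuous_on H logG" "logG 0 = 0" "z \<in> H \<Longrightarrow> exp (logG z) = E z / D z"
proof -
  have "continuous_on H (\<lambda>z. E z / D z)"
    by (intro continuous_intros) (auto simp: H_def)
  then obtain g where g: "continuous_on H g" "\<And>z. z \<in> H \<Longrightarrow> E z / D z = exp (g z)"
    using continuous_logarithm_on_contractible[OF _ contractible_H, of "\<lambda>z. E z / D z"] by (auto simp: H_def)
  have "0 \<in> H" by (simp add: H_def)
  then have "exp (g 0) = 1" using g(2)[of 0] by simp
  then have "continuous_on H (\<lambda>z. g z - g 0) \<and> g 0 - g 0 = 0 \<and> (\<forall>z\<in>H. exp (g z - g 0) = E z / D z)"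
    using g by (auto simp: exp_diff intro!: continuous_intros)
  then have *: "\<exists>g. continuous_on H g \<and> g 0 = 0 \<and> (\<forall>z\<in>H. exp (g z) = E z / D z)" by blast
  show "continuous_on H logG" "logG 0 = 0" "z \<in> H \<Longrightarrow> exp (logG z) = E z / D z"
    using someI_ex[OF *] unfolding logG_def[symmetric] by auto
qed

lemma logG_has_field_derivative:
  assumes z: "Im z > 0"
  shows "(logG has_field_derivative q z / z) (at z)"
proof -
  have nz: "E z \<noteq> 0" "D z \<noteq> 0" "z \<noteq> 0" using z E_nonzero D_nonzero by auto
  obtain G' where G': "((\<lambda>z. E z / D z) has_field_derivative G') (at z)" "z * G' = E z / D z * q z"
    using quotient_has_field_derivative[OF nz(1,2)] .
  have "(logG has_field_derivative G' / (E z / D z)) (at z)"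
    by (rule has_field_derivative_continuous_log[OF open_halfspace_Im_gt[of 0] _ _ _ G'(1)])
      (use z logG upper_half_plane_subset_H in \<open>auto intro: continuous_on_subset\<close>)
  moreover have "G' / (E z / D z) = q z / z" using G'(2) nz by (simp add: field_simps)
  ultimately show ?thesis by simp
qed

lemma Im_logG_pos:
  assumes z: "Im z > 0"
  shows "Im (logG z) > 0"
proof -
  have "Im (logG (of_real 0 * z)) < Im (logG (of_real 1 * z))"
  proof (rule DERIV_pos_imp_increasing_open[of "0::real" 1 "\<lambda>t. Im (logG (of_real t * z))"])
    have "continuous_on {0..1} (\<lambda>t. logG (of_real t * z))"
    proof (rule continuous_on_compose2[OF logG(1)])
      show "(\<lambda>t. of_real t * z) ` {0..1} \<subseteq> H"
      proof safe
        fix t :: real assume "t \<in> {0..1}"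
        then show "of_real t * z \<in> H"
          using z subsetD[OF upper_half_plane_subset_H, of "of_real t * z"]
          by (cases "t = 0") (auto simp: H_def)
      qed
    qed (intro continuous_intros)
    then show "continuous_on {0..1} (\<lambda>t. Im (logG (of_real t * z)))"
      by (intro continuous_intros)
    fix t :: real assume t: "0 < t" "t < 1"
    then have tz: "Im (of_real t * z) > 0" using z by simp
    have "((\<lambda>t. logG (of_real t * z)) has_vector_derivative z * (q (of_real t * z) / (of_real t * z))) (at t)"
      by (rule field_vector_diff_chain_at[where f = "\<lambda>t. of_real t * z" and g = logG, unfolded o_def, OF _ logG_has_field_derivative[OF tz]])
         (auto intro!: derivative_eq_intros simp: has_vector_derivative_def scaleR_conv_of_real)
    then have "((\<lambda>t. Im (logG (of_real t * z))) has_real_derivative Im (z * (q (of_real t * z) / (of_real t * z)))) (at t)"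
      unfolding has_real_derivative_iff_has_vector_derivative
      by (rule bounded_linear.has_vector_derivative[OF bounded_linear_Im])
    moreover have "z * (q (of_real t * z) / (of_real t * z)) = q (of_real t * z) / of_real t"
      using z t by (cases "z = 0") auto
    ultimately show "\<exists>y. ((\<lambda>t. Im (logG (of_real t * z))) has_real_derivative y) (at t) \<and> y > 0"
      using Im_q_pos[OF tz] t by (intro exI[of _ "Im (q (of_real t * z)) / t"]) auto
  qed simp
  then show ?thesis by (simp add: logG)
qed

lemma Im_logG_nonneg:
  assumes z: "z \<in> H"
  shows "Im (logG z) \<ge> 0"
proof (cases "Im z > 0")
  case True then show ?thesis using Im_logG_pos by force
next
  case False
  then have [simp]: "Im z = 0" using z by (simp add: H_def)
  have "continuous_on {0..} (\<lambda>t::real. logG (z + \<i> * of_real t))"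
  proof (rule continuous_on_compose2[OF logG(1)])
    show "(\<lambda>t. z + \<i> * of_real t) ` {0..} \<subseteq> H"
    proof (rule image_subsetI)
      fix t :: real assume "t \<in> {0..}"
      then show "z + \<i> * of_real t \<in> H"
        using z upper_half_plane_subset_H by (cases "t = 0") auto
    qed
  qed (intro continuous_intros)
  then have "((\<lambda>t::real. logG (z + \<i> * of_real t)) \<longlongrightarrow> logG (z + \<i> * of_real 0)) (at 0 within {0..})"
    unfolding continuous_on_def by (rule bspec) auto
  then have "((\<lambda>t::real. logG (z + \<i> * of_real t)) \<longlongrightarrow> logG (z + \<i> * of_real 0)) (at_right 0)"
    by (rule filterlim_mono) (auto intro: at_le)
  then have "((\<lambda>t::real. Im (logG (z + \<i> * of_real t))) \<longlongrightarrow> Im (logG z)) (at_right 0)"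
    using tendsto_Im by fastforce
  moreover have "\<forall>\<^sub>F t in at_right 0. 0 \<le> Im (logG (z + \<i> * of_real t))"
    unfolding eventually_at_right_field
    by (rule exI[of _ 1]) (auto intro!: less_imp_le[OF Im_logG_pos])
  ultimately show ?thesis
    by (intro tendsto_le[OF trivial_limit_at_right_real _ tendsto_const])
qed

lemma Im_logG_real:
  assumes z: "z \<in> H" "Im z = 0"
  obtains n :: int where "n \<ge> 0" "Im (logG z) = of_int n * pi"
proof -
  have "cnj z = z" using z by (simp add: complex_eq_iff)
  then have "cnj (exp (logG z)) = exp (logG z)"
    using E_cnj[of z] D_cnj[of z] logG(3)[OF z(1)] by simp
  then have "Im (exp (logG z)) = 0" by (metis Reals_cnj_iff complex_is_Real_iff)
  then have "sin (Im (logG z)) = 0" by (simp add: Im_exp)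
  then obtain n :: int where n: "Im (logG z) = of_int n * pi" by (auto simp: sin_zero_iff_int2)
  moreover have "n \<ge> 0" using Im_logG_nonneg[OF z(1)] n pi_gt_zero by (simp add: zero_le_mult_iff)
  ultimately show thesis by (rule that[rotated])
qed

definition T :: "complex set" where
  "T = {w. 0 \<le> Im w \<and> Im w \<le> pi / 2 \<and> E (exp (2 * w)) \<noteq> 0 \<and> D (exp (2 * w)) \<noteq> 0}"

definition F :: "complex \<Rightarrow> complex" where
  "F z = z powi (2 * j + 1) * E (z\<^sup>2) / D (z\<^sup>2)"

definition logF :: "complex \<Rightarrow> complex" where
  "logF w = of_int (2 * j + 1) * w + logG (exp (2 * w))"

definition r :: "complex \<Rightarrow> complex" where
  "r z = of_int (2 * j + 1) + 2 * q (z\<^sup>2)"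

lemma strip_subset_T: "0 < Im w \<Longrightarrow> Im w < pi / 2 \<Longrightarrow> w \<in> T"
  using sin_gt_zero[of "2 * Im w"]
  by (auto simp: T_def Im_exp intro!: E_nonzero D_nonzero)

lemma exp_T: "w \<in> T \<Longrightarrow> exp (2 * w) \<in> H"
  using sin_ge_zero[of "2 * Im w"] by (auto simp: T_def H_def Im_exp)

lemma exp_logF:
  assumes "w \<in> T"
  shows "exp (logF w) = F (exp w)"
proof -
  have "exp (of_int (2 * j + 1) * w) = exp w powi (2 * j + 1)"
    by (simp add: exp_power_int mult.commute)
  moreover have "(exp w)\<^sup>2 = exp (2 * w)" by (simp add: exp_double)
  ultimately show ?thesis
    using logG(3)[OF exp_T[OF assms]] by (simp add: logF_def F_def exp_add)
qed

lemma logF_continuous: "continuous_on T logF"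
  unfolding logF_def
  by (intro continuous_intros continuous_on_compose2[OF logG(1)]) (use exp_T in auto)

lemma logF_has_field_derivative:
  assumes "0 < Im w" "Im w < pi / 2"
  shows "(logF has_field_derivative r (exp w)) (at w)"
proof -
  have "Im (exp (2 * w)) > 0" using sin_gt_zero[of "2 * Im w"] assms by (simp add: Im_exp)
  note 1 = logG_has_field_derivative[OF this]
  have "((\<lambda>w. logG (exp (2 * w))) has_field_derivative q (exp (2 * w)) / exp (2 * w) * (exp (2 * w) * 2)) (at w)"
    by (rule DERIV_chain2[of logG _ "\<lambda>w. exp (2 * w)", OF 1]) (auto intro!: derivative_eq_intros)
  then have "(logF has_field_derivative of_int (2 * j + 1) + q (exp (2 * w)) / exp (2 * w) * (exp (2 * w) * 2)) (at w)"
    unfolding logF_def by (auto intro!: derivative_eq_intros)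
  moreover have "of_int (2 * j + 1) + q (exp (2 * w)) / exp (2 * w) * (exp (2 * w) * 2) = r (exp w)"
    by (simp add: r_def exp_double)
  ultimately show ?thesis by simp
qed

lemma Im_r_exp_pos:
  assumes "0 < Im w" "Im w < pi / 2"
  shows "Im (r (exp w)) > 0"
proof -
  have "Im (exp (2 * w)) > 0" using sin_gt_zero[of "2 * Im w"] assms by (simp add: Im_exp)
  from Im_q_pos[OF this] show ?thesis by (simp add: r_def exp_double)
qed

lemma Im_logF_less:
  assumes w1: "0 < Im w1" "Im w1 < pi / 2" and w2: "0 < Im w2" "Im w2 < pi / 2"
    and Re: "Re (logF w1) = Re (logF w2)" "Re w1 < Re w2"
  shows "Im (logF w1) < Im (logF w2)"
proof -
  define \<Delta> where "\<Delta> = w2 - w1"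
  have \<Delta>: "Re \<Delta> > 0" "\<Delta> \<noteq> 0" using Re by (auto simp: \<Delta>_def)
  have "Im (logF (w1 + of_real 0 * \<Delta>) / \<Delta>) < Im (logF (w1 + of_real 1 * \<Delta>) / \<Delta>)"
  proof (rule DERIV_pos_imp_increasing[of "0::real" 1 "\<lambda>t. Im (logF (w1 + of_real t * \<Delta>) / \<Delta>)"])
    fix t :: real assume t: "0 \<le> t" "t \<le> 1"
    let ?w = "w1 + of_real t * \<Delta>"
    have w: "Im ?w = (1 - t) * Im w1 + t * Im w2" by (simp add: \<Delta>_def algebra_simps)
    have "0 < Im ?w" unfolding w
      using t w1 w2 by (cases "t = 0") (auto intro!: add_nonneg_pos)
    moreover have "Im ?w < pi / 2" unfolding w
      using convex_bound_lt[of "Im w1" "pi/2" "Im w2" "1 - t" t] t w1 w2 by auto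
    ultimately have wi: "0 < Im ?w" "Im ?w < pi / 2" by auto
    have "((\<lambda>t. logF (w1 + of_real t * \<Delta>)) has_vector_derivative \<Delta> * r (exp ?w)) (at t)"
      by (rule field_vector_diff_chain_at[where f = "\<lambda>t. w1 + of_real t * \<Delta>" and g = logF, unfolded o_def, OF _ logF_has_field_derivative[OF wi]])
         (auto intro!: derivative_eq_intros simp: has_vector_derivative_def scaleR_conv_of_real)
    then have "((\<lambda>t. logF (w1 + of_real t * \<Delta>) / \<Delta>) has_vector_derivative \<Delta> * r (exp ?w) / \<Delta>) (at t)"
      by (rule has_vector_derivative_divide)
    then have "((\<lambda>t. Im (logF (w1 + of_real t * \<Delta>) / \<Delta>)) has_real_derivative Im (\<Delta> * r (exp ?w) / \<Delta>)) (at t)"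
      unfolding has_real_derivative_iff_has_vector_derivative by (rule bounded_linear.has_vector_derivative[OF bounded_linear_Im])
    then show "\<exists>y. ((\<lambda>t. Im (logF (w1 + of_real t * \<Delta>) / \<Delta>)) has_real_derivative y) (at t) \<and> 0 < y"
      using Im_r_exp_pos[OF wi] \<Delta> by auto
  qed simp
  then have "0 < Im ((logF w2 - logF w1) / \<Delta>)" by (simp add: \<Delta>_def diff_divide_distrib)
  moreover have "logF w2 - logF w1 = \<i> * of_real (Im (logF w2) - Im (logF w1))"
    using Re by (simp add: complex_eq_iff)
  ultimately have "0 < (Im (logF w2) - Im (logF w1)) * Re \<Delta> / ((Re \<Delta>)\<^sup>2 + (Im \<Delta>)\<^sup>2)"
    by (simp add: Im_divide)
  then show ?thesis using \<Delta> by (simp add: zero_less_divide_iff zero_less_mult_iff not_sum_power2_lt_zero)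
qed

end

section \<open>The level curve of the modulus\<close>

locale level_curve = laguerre_quotient +
  fixes \<rho> :: real
  assumes \<rho>: "\<rho> > 0"
begin

definition \<Psi> :: "real \<Rightarrow> real \<Rightarrow> real" where
  "\<Psi> s a = exp (of_int (2 * j + 1) * s) * norm (E (exp (2 * Complex s a))) - \<rho> * norm (D (exp (2 * Complex s a)))"

lemma \<Psi>_strict_antimono:
  assumes "0 \<le> a" "a < b" "b \<le> pi / 2"
  shows "\<Psi> s b < \<Psi> s a"
proof -
  let ?u = "exp (2 * Complex s b)" and ?v = "exp (2 * Complex s a)"
  have uv: "norm ?u = norm ?v" by simp
  have "cos (2 * b) < cos (2 * a)" using assms by (intro cos_monotone_0_pi) auto
  then have Re: "Re ?u < Re ?v" by (simp add: Re_exp)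
  show ?thesis unfolding \<Psi>_def
    using E_norm_strict_mono[OF uv Re] D_norm_mono[OF uv] Re \<rho>
    by (smt (verit) exp_gt_zero mult_strict_left_mono mult_left_mono)
qed

lemma \<Psi>_continuous [continuous_intros]:
  "continuous_on S f \<Longrightarrow> continuous_on S g \<Longrightarrow> continuous_on S (\<lambda>x. \<Psi> (f x) (g x))"
  unfolding \<Psi>_def complex_eq by (intro continuous_intros)

text \<open>The argument in \<open>[0, pi/2]\<close> at which \<open>|F|\<close> takes the value \<open>\<rho>\<close> on the circle of radius \<open>exp s\<close>,
  clamped to an end of the interval where there is none.\<close>

definition \<phi> :: "real \<Rightarrow> real" where
  "\<phi> s = (SOME a. 0 \<le> a \<and> a \<le> pi / 2 \<and> (0 < a \<longrightarrow> \<Psi> s a \<ge> 0) \<and> (a < pi / 2 \<longrightarrow> \<Psi> s a \<le> 0))"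

lemma \<phi>: "0 \<le> \<phi> s" "\<phi> s \<le> pi / 2" "0 < \<phi> s \<Longrightarrow> \<Psi> s (\<phi> s) \<ge> 0" "\<phi> s < pi / 2 \<Longrightarrow> \<Psi> s (\<phi> s) \<le> 0"
proof -
  have "\<exists>a. 0 \<le> a \<and> a \<le> pi / 2 \<and> (0 < a \<longrightarrow> \<Psi> s a \<ge> 0) \<and> (a < pi / 2 \<longrightarrow> \<Psi> s a \<le> 0)"
  proof -
    consider "\<Psi> s 0 \<le> 0" | "\<Psi> s (pi / 2) \<ge> 0" | "\<Psi> s (pi / 2) \<le> 0" "0 \<le> \<Psi> s 0" by linarith
    then show ?thesis
    proof cases
      case 1 then show ?thesis by (intro exI[of _ 0]) auto
    next
      case 2 then show ?thesis by (intro exI[of _ "pi / 2"]) auto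
    next
      case 3
      have "continuous_on {0..pi / 2} (\<Psi> s)" by (intro continuous_intros)
      then show ?thesis using IVT2'[of "\<Psi> s" "pi / 2" 0 0] 3 by auto
    qed
  qed
  from someI_ex[OF this] show "0 \<le> \<phi> s" "\<phi> s \<le> pi / 2" "0 < \<phi> s \<Longrightarrow> \<Psi> s (\<phi> s) \<ge> 0" "\<phi> s < pi / 2 \<Longrightarrow> \<Psi> s (\<phi> s) \<le> 0"
    unfolding \<phi>_def by auto
qed

lemma less_\<phi>_iff: "0 \<le> a \<Longrightarrow> a < pi / 2 \<Longrightarrow> a < \<phi> s \<longleftrightarrow> \<Psi> s a > 0"
  using \<phi>[of s] \<Psi>_strict_antimono[of a "\<phi> s" s] \<Psi>_strict_antimono[of "\<phi> s" a s]
  by (cases a "\<phi> s" rule: linorder_cases) auto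

lemma \<phi>_less_iff: "0 < a \<Longrightarrow> a \<le> pi / 2 \<Longrightarrow> \<phi> s < a \<longleftrightarrow> \<Psi> s a < 0"
  using \<phi>[of s] \<Psi>_strict_antimono[of a "\<phi> s" s] \<Psi>_strict_antimono[of "\<phi> s" a s]
  by (cases a "\<phi> s" rule: linorder_cases) auto

lemma \<phi>_eqI: "0 \<le> a \<Longrightarrow> a \<le> pi / 2 \<Longrightarrow> \<Psi> s a = 0 \<Longrightarrow> \<phi> s = a"
  using \<phi>[of s] \<Psi>_strict_antimono[of a "\<phi> s" s] \<Psi>_strict_antimono[of "\<phi> s" a s]
  by (cases a "\<phi> s" rule: linorder_cases) auto

lemma \<phi>_continuous: "continuous_on S \<phi>"
proof -
  have "isCont \<phi> s" for s
    unfolding isCont_def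
  proof (rule order_tendstoI)
    have lim: "((\<lambda>t. \<Psi> t a) \<longlongrightarrow> \<Psi> s a) (at s)" for a
    proof -
      have "continuous_on UNIV (\<lambda>t. \<Psi> t a)" by (intro continuous_intros)
      then show ?thesis by (simp add: continuous_on_def)
    qed
    show "\<forall>\<^sub>F t in at s. a < \<phi> t" if "a < \<phi> s" for a
    proof (cases "a < 0")
      case True then show ?thesis using \<phi>(1) by (auto intro: always_eventually less_le_trans)
    next
      case False
      then have a: "0 \<le> a" "a < pi / 2" using that \<phi>(2)[of s] by auto
      then have "\<Psi> s a > 0" using that less_\<phi>_iff by blast
      from order_tendstoD(1)[OF lim this] show ?thesis using less_\<phi>_iff[OF a] by simp
    qed
    show "\<forall>\<^sub>F t in at s. \<phi> t < a" if "\<phi> s < a" for a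
    proof (cases "a > pi / 2")
      case True then show ?thesis using \<phi>(2) le_less_trans[of "\<phi> _" "pi / 2" a] by simp
    next
      case False
      then have a: "0 < a" "a \<le> pi / 2" using that \<phi>(1)[of s] by auto
      then have "\<Psi> s a < 0" using that \<phi>_less_iff by blast
      from order_tendstoD(2)[OF lim this] show ?thesis using \<phi>_less_iff[OF a] by simp
    qed
  qed
  then show ?thesis by (simp add: continuous_at_imp_continuous_on)
qed

definition W :: "real \<Rightarrow> complex" where "W s = Complex s (\<phi> s)"

lemma W_sel [simp]: "Re (W s) = s" "Im (W s) = \<phi> s" by (simp_all add: W_def)

lemma exp_double_Complex: "exp (2 * Complex s a) = Complex (exp (2 * s) * cos (2 * a)) (exp (2 * s) * sin (2 * a))"
  by (simp add: complex_eq_iff Re_exp Im_exp)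

lemma W_in_T: "W s \<in> T"
proof -
  consider "0 < \<phi> s" "\<phi> s < pi / 2" | "\<phi> s = 0" | "\<phi> s = pi / 2" using \<phi>(1,2)[of s] by linarith
  then show ?thesis
  proof cases
    case 1 then show ?thesis by (intro strip_subset_T) auto
  next
    case 2
    have E: "E (exp (2 * Complex s 0)) \<noteq> 0" by (rule E_nonzero) (simp add: exp_double_Complex)
    have "D (exp (2 * Complex s 0)) \<noteq> 0" using \<phi>(4)[of s] 2 E by (auto simp: \<Psi>_def mult_le_0_iff)
    with E 2 show ?thesis by (simp add: T_def W_def)
  next
    case 3
    have D: "D (exp (2 * Complex s (pi / 2))) \<noteq> 0" by (rule D_nonzero) (simp add: exp_double_Complex)
    have "\<rho> * norm (D (exp (2 * Complex s (pi / 2)))) > 0" using D \<rho> by simp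
    then have "E (exp (2 * Complex s (pi / 2))) \<noteq> 0" using \<phi>(3)[of s] 3 by (auto simp: \<Psi>_def)
    moreover have "W s = Complex s (pi / 2)" using 3 by (simp add: W_def)
    ultimately show ?thesis using D by (simp add: T_def)
  qed
qed

definition V :: "real \<Rightarrow> real" where "V s = Im (logF (W s))"

lemma V_continuous: "continuous_on S V"
proof -
  have "continuous_on S (\<lambda>s. logF (W s))"
    by (rule continuous_on_compose2[OF logF_continuous])
      (use W_in_T in \<open>auto simp: W_def complex_eq intro!: continuous_intros \<phi>_continuous\<close>)
  then show ?thesis unfolding V_def by (intro continuous_intros)
qed

lemma norm_F_exp:
  "norm (F (exp (Complex s a))) = exp (of_int (2 * j + 1) * s) * norm (E (exp (2 * Complex s a))) / norm (D (exp (2 * Complex s a)))"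
proof -
  have "norm (exp (Complex s a) powi (2 * j + 1)) = exp (of_int (2 * j + 1) * s)"
    by (simp add: norm_power_int exp_power_int)
  then show ?thesis by (simp add: F_def norm_mult norm_divide exp_double)
qed

lemma \<Psi>_eq: "D (exp (2 * Complex s a)) \<noteq> 0 \<Longrightarrow> \<Psi> s a = norm (D (exp (2 * Complex s a))) * (norm (F (exp (Complex s a))) - \<rho>)"
  by (simp add: norm_F_exp \<Psi>_def field_simps)

lemma Re_logF:
  assumes "w \<in> T"
  shows "Re (logF w) = ln (norm (F (exp w)))"
  by (simp flip: exp_logF[OF assms])

lemma \<Psi>_W_eq_0_iff: "\<Psi> s (\<phi> s) = 0 \<longleftrightarrow> norm (F (exp (W s))) = \<rho>"
  using W_in_T[of s] unfolding W_def by (subst \<Psi>_eq) (auto simp: T_def)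

lemma V_strict_mono_interior:
  assumes "0 < \<phi> s" "\<phi> s < pi / 2" "0 < \<phi> t" "\<phi> t < pi / 2" "s < t"
  shows "V s < V t"
proof -
  have "norm (F (exp (W s))) = \<rho>" "norm (F (exp (W t))) = \<rho>"
    using \<phi>(3,4)[of s] \<phi>(3,4)[of t] assms by (auto simp flip: \<Psi>_W_eq_0_iff)
  then show ?thesis unfolding V_def
    using assms by (intro Im_logF_less) (auto simp: Re_logF W_in_T)
qed

lemma V_real_axis:
  assumes "\<phi> s = 0" obtains n :: int where "n \<ge> 0" "V s = of_int n * pi"
proof -
  have "exp (2 * W s) \<in> H" "Im (exp (2 * W s)) = 0" using exp_T[OF W_in_T] assms by (auto simp: Im_exp)
  from Im_logG_real[OF this] obtain n :: int where "n \<ge> 0" "Im (logG (exp (2 * W s))) = of_int n * pi" .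
  then show thesis using that assms by (simp add: V_def logF_def)
qed

lemma V_imaginary_axis:
  assumes "\<phi> s = pi / 2" obtains n :: int where "n \<ge> 0" "V s = of_int (2 * j + 1) * (pi / 2) + of_int n * pi"
proof -
  have "exp (2 * W s) \<in> H" "Im (exp (2 * W s)) = 0" using exp_T[OF W_in_T, of s] by (simp_all add: Im_exp assms)
  from Im_logG_real[OF this] obtain n :: int where "n \<ge> 0" "Im (logG (exp (2 * W s))) = of_int n * pi" .
  then show thesis using that assms by (simp add: V_def logF_def)
qed

lemma V_near_at_bot: "\<forall>\<^sub>F s in at_bot. \<phi> s = pi / 2 \<and> V s = of_int (2 * j + 1) * (pi / 2)"
proof -
  have lim0: "((\<lambda>s. exp (2 * Complex s (pi / 2))) \<longlongrightarrow> 0) at_bot"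
  proof (rule tendsto_norm_zero_cancel)
    have "((\<lambda>s::real. exp (2 * s)) \<longlongrightarrow> 0) at_bot" by real_asymp
    then show "((\<lambda>s. norm (exp (2 * Complex s (pi / 2)))) \<longlongrightarrow> 0) at_bot" by simp
  qed
  have "isCont E 0" "isCont D 0"
    using E_continuous[of UNIV "\<lambda>x. x"] D_continuous[of UNIV "\<lambda>x. x"] by (auto simp: continuous_on_eq_continuous_at)
  then have "((\<lambda>s. norm (E (exp (2 * Complex s (pi / 2))))) \<longlongrightarrow> norm (E 0)) at_bot"
      "((\<lambda>s. norm (D (exp (2 * Complex s (pi / 2))))) \<longlongrightarrow> norm (D 0)) at_bot"
    using isCont_tendsto_compose[OF \<open>isCont E 0\<close> lim0] isCont_tendsto_compose[OF \<open>isCont D 0\<close> lim0] tendsto_norm by blast+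
  then have E: "\<forall>\<^sub>F s in at_bot. norm (E (exp (2 * Complex s (pi / 2)))) > 1 / 2"
    and D: "\<forall>\<^sub>F s in at_bot. norm (D (exp (2 * Complex s (pi / 2)))) < 2"
    using order_tendstoD(1)[of "\<lambda>s. norm (E (exp (2 * Complex s (pi / 2))))" "norm (E 0)" at_bot "1 / 2"]
      order_tendstoD(2)[of "\<lambda>s. norm (D (exp (2 * Complex s (pi / 2))))" "norm (D 0)" at_bot 2] by simp_all
  have "filterlim (\<lambda>s::real. exp (of_int (2 * j + 1) * s)) at_top at_bot"
  proof (rule filterlim_compose[OF exp_at_top])
    have "0 < - real_of_int (2 * j + 1)" using j by linarith
    from filterlim_tendsto_pos_mult_at_top[OF tendsto_const this filterlim_ident]
    show "filterlim (\<lambda>s::real. of_int (2 * j + 1) * s) at_top at_bot"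
      by (simp add: filterlim_at_bot_mirror algebra_simps)
  qed
  then have X: "\<forall>\<^sub>F s in at_bot. exp (of_int (2 * j + 1) * s) > 4 * \<rho>"
    by (simp add: filterlim_at_top_dense)
  have "continuous (at 0 within H) logG" using logG(1) by (auto simp: continuous_on_eq_continuous_within H_def)
  then obtain \<delta> where \<delta>: "\<delta> > 0" "\<And>z. z \<in> H \<Longrightarrow> norm z < \<delta> \<Longrightarrow> norm (logG z) < 1"
    unfolding continuous_within_eps_delta using logG(2) by (auto dest!: spec[of _ 1])
  have "\<forall>\<^sub>F s in at_bot. norm (exp (2 * Complex s (pi / 2))) < \<delta>"
    using order_tendstoD(2)[OF tendsto_norm[OF lim0]] \<delta>(1) by simp
  with E D X show ?thesis
  proof eventually_elim
    case (elim s)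
    have "\<rho> * norm (D (exp (2 * Complex s (pi / 2)))) < \<rho> * 2" using elim \<rho> by simp
    also have "\<dots> = 4 * \<rho> * (1 / 2)" by simp
    also have "\<dots> < exp (of_int (2 * j + 1) * s) * norm (E (exp (2 * Complex s (pi / 2))))"
      using elim \<rho> by (intro mult_strict_mono) auto
    finally have "\<Psi> s (pi / 2) > 0" by (simp add: \<Psi>_def)
    then have ph: "\<phi> s = pi / 2" using \<phi>_less_iff[of "pi / 2" s] \<phi>(2)[of s] by auto
    have W: "exp (2 * W s) \<in> H" "Im (exp (2 * W s)) = 0" using exp_T[OF W_in_T, of s] by (simp_all add: Im_exp ph)
    from Im_logG_real[OF this] obtain n :: int where n: "n \<ge> 0" "Im (logG (exp (2 * W s))) = of_int n * pi" .
    have "norm (logG (exp (2 * W s))) < 1" by (rule \<delta>(2)) (use W elim ph in simp_all)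
    then have "of_int n * pi < 1" using n abs_Im_le_cmod[of "logG (exp (2 * W s))"] by linarith
    then have "n < 1" using pi_gt3 mult_mono[of 1 "of_int n" 1 pi] by (cases "n \<ge> 1") auto
    then have "n = 0" using n by linarith
    then show ?case using n ph by (simp add: V_def logF_def)
  qed
qed

end

context laguerre_quotient
begin

lemma F_0 [simp]: "F 0 = 0"
proof -
  have "2 * j + 1 \<noteq> 0" by presburger
  then show ?thesis by (simp add: F_def)
qed

lemma F_minus: "F (- z) = - F z"
  by (simp add: F_def power_int_minus_left)

lemma F_cnj: "F (cnj z) = cnj (F z)"
  by (simp add: F_def E_cnj D_cnj flip: complex_cnj_power)

lemma F_signs:
  assumes "\<sigma> \<in> {1, - 1}" "\<tau> \<in> {1, - 1}"
  shows "F (Complex (\<sigma> * x) (\<tau> * y)) = Complex (\<sigma> * Re (F (Complex x y))) (\<tau> * Im (F (Complex x y)))"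
proof -
  have "F (Complex x (- y)) = cnj (F (Complex x y))" "F (Complex (- x) y) = - cnj (F (Complex x y))"
    "F (Complex (- x) (- y)) = - F (Complex x y)"
    by (simp_all flip: F_cnj F_minus add: complex_cnj complex_minus)
  then show ?thesis using assms by (auto simp: complex_eq_iff)
qed

end

context level_curve
begin

definition active :: "real \<Rightarrow> bool" where "active s \<longleftrightarrow> \<Psi> s (\<phi> s) = 0"

lemma interior_imp_active: "0 < \<phi> s \<Longrightarrow> \<phi> s < pi / 2 \<Longrightarrow> active s"
  using \<phi>(3,4)[of s] by (auto simp: active_def)

lemma interiorI:
  assumes "\<And>n::int. V s \<noteq> of_int n * (pi / 2)"
  shows "0 < \<phi> s \<and> \<phi> s < pi / 2"
proof (rule ccontr)
  assume "\<not> ?thesis"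
  then consider "\<phi> s = 0" | "\<phi> s = pi / 2" using \<phi>(1,2)[of s] by linarith
  then show False
  proof cases
    case 1
    then obtain n :: int where "V s = of_int n * pi" using V_real_axis by blast
    then show False using assms[of "2 * n"] by simp
  next
    case 2
    then obtain n :: int where "V s = of_int (2 * j + 1) * (pi / 2) + of_int n * pi" using V_imaginary_axis by blast
    then show False using assms[of "2 * j + 1 + 2 * n"] by (simp add: algebra_simps)
  qed
qed

lemma V_mono:
  assumes "s \<le> t"
  shows "V s \<le> V t"
proof (rule ccontr)
  assume "\<not> V s \<le> V t"
  define k where "k = \<lfloor>V t / (pi / 2)\<rfloor>"
  define u where "u = min (V s) (of_int (k + 1) * (pi / 2))"
  have kt: "of_int k * (pi / 2) \<le> V t" "V t < of_int (k + 1) * (pi / 2)"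
    using floor_divide_lower[of "pi / 2" "V t"] floor_divide_upper[of "pi / 2" "V t"]
    by (auto simp: k_def add.commute)
  then have u: "V t < u" "u \<le> V s" "u \<le> of_int (k + 1) * (pi / 2)"
    using \<open>\<not> V s \<le> V t\<close> by (auto simp: u_def)
  have int: "0 < \<phi> x \<and> \<phi> x < pi / 2" if "V t < V x" "V x < u" for x
  proof (rule interiorI)
    fix n :: int
    show "V x \<noteq> of_int n * (pi / 2)"
    proof
      assume "V x = of_int n * (pi / 2)"
      then have "of_int k * (pi / 2) < of_int n * (pi / 2)" "of_int n * (pi / 2) < of_int (k + 1) * (pi / 2)"
        using that kt u by linarith+
      then have "k < n" "n < k + 1" by (auto simp: mult_less_cancel_right)
      then show False by linarith
    qed
  qed
  define y1 y2 where "y1 = V t + (u - V t) / 3" and "y2 = V t + 2 * (u - V t) / 3"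
  have y: "V t < y1" "y1 < y2" "y2 < u" using u(1) unfolding y1_def y2_def by (simp_all add: field_simps)
  obtain a where a: "s \<le> a" "a \<le> t" "V a = y2"
    using IVT2'[of V t y2 s] V_continuous assms y u by auto
  obtain b where b: "a \<le> b" "b \<le> t" "V b = y1"
    using IVT2'[of V t y1 a] V_continuous a y u by auto
  have "a < b" using a b y by (cases "a = b") auto
  then have "V a < V b" using int[of a] int[of b] a b y by (intro V_strict_mono_interior) auto
  then show False using a b y by simp
qed

lemma V_strict_mono:
  assumes "s < t" and int: "(0 < \<phi> s \<and> \<phi> s < pi / 2) \<or> (0 < \<phi> t \<and> \<phi> t < pi / 2)"
  shows "V s < V t"
proof -
  have lim: "(\<phi> \<longlongrightarrow> \<phi> x) (at x)" for x
    using \<phi>_continuous[of UNIV] by (simp add: continuous_on_def)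
  have ev: "\<forall>\<^sub>F y in at x. 0 < \<phi> y \<and> \<phi> y < pi / 2" if "0 < \<phi> x \<and> \<phi> x < pi / 2" for x
    using that order_tendstoD(1)[OF lim, of 0 x] order_tendstoD(2)[OF lim, of x "pi / 2"]
    by (intro eventually_conj) auto
  show ?thesis
  proof (cases "0 < \<phi> s \<and> \<phi> s < pi / 2")
    case True
    have "\<forall>\<^sub>F y in at_right s. (0 < \<phi> y \<and> \<phi> y < pi / 2) \<and> y \<in> {s<..<t}"
      using eventually_conj[OF _ eventually_at_right_real[OF assms(1)]] ev[OF True]
      unfolding eventually_at_split by blast
    then obtain y where "0 < \<phi> y \<and> \<phi> y < pi / 2" "s < y" "y < t"
      using eventually_happens[of _ "at_right s"] by auto
    then show ?thesis using V_strict_mono_interior[of s y] V_mono[of y t] True by auto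
  next
    case False
    then have True: "0 < \<phi> t \<and> \<phi> t < pi / 2" using int by blast
    have "\<forall>\<^sub>F y in at_left t. (0 < \<phi> y \<and> \<phi> y < pi / 2) \<and> y \<in> {s<..<t}"
      using eventually_conj[OF _ eventually_at_left_real[OF assms(1)]] ev[OF True]
      unfolding eventually_at_split by blast
    then obtain y where "0 < \<phi> y \<and> \<phi> y < pi / 2" "s < y" "y < t"
      using eventually_happens[of _ "at_left t"] by auto
    then show ?thesis using V_strict_mono_interior[of y t] V_mono[of s y] True by auto
  qed
qed

lemma F_exp_W:
  assumes "active s"
  shows "F (exp (W s)) = Complex (\<rho> * cos (V s)) (\<rho> * sin (V s))"
proof -
  have "Re (logF (W s)) = ln \<rho>"
    using assms \<Psi>_W_eq_0_iff by (simp add: Re_logF[OF W_in_T] active_def)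
  then have "Re (exp (logF (W s))) = \<rho> * cos (V s)" "Im (exp (logF (W s))) = \<rho> * sin (V s)"
    using \<rho> by (simp_all add: Re_exp Im_exp V_def)
  then show ?thesis by (simp add: exp_logF[OF W_in_T] complex_eq_iff)
qed

definition point :: "real \<Rightarrow> real \<Rightarrow> real \<Rightarrow> complex" where
  "point \<sigma> \<tau> s = Complex (\<sigma> * (exp s * cos (\<phi> s))) (\<tau> * (exp s * sin (\<phi> s)))"

lemma norm_point: "\<sigma> \<in> {1, - 1} \<Longrightarrow> \<tau> \<in> {1, - 1} \<Longrightarrow> norm (point \<sigma> \<tau> s) = exp s"
proof -
  assume "\<sigma> \<in> {1, - 1}" "\<tau> \<in> {1, - 1}"
  then have "(norm (point \<sigma> \<tau> s))\<^sup>2 = (exp s)\<^sup>2 * ((cos (\<phi> s))\<^sup>2 + (sin (\<phi> s))\<^sup>2)"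
    unfolding cmod_power2 distrib_left by (auto simp: point_def power_mult_distrib)
  then show ?thesis by (simp add: power2_eq_iff_nonneg)
qed

lemma F_point:
  assumes "active s" "\<sigma> \<in> {1, - 1}" "\<tau> \<in> {1, - 1}"
  shows "F (point \<sigma> \<tau> s) = Complex (\<sigma> * (\<rho> * cos (V s))) (\<tau> * (\<rho> * sin (V s)))"
proof -
  have "Complex (exp s * cos (\<phi> s)) (exp s * sin (\<phi> s)) = exp (W s)"
    by (simp add: complex_eq_iff Re_exp Im_exp)
  then show ?thesis
    using F_signs[OF assms(2,3), of "exp s * cos (\<phi> s)" "exp s * sin (\<phi> s)"] F_exp_W[OF assms(1)]
    by (simp add: point_def)
qed

lemma norm_F_eq_imp:
  assumes "norm (F p) = \<rho>"
  obtains \<sigma> \<tau> where "active (ln (norm p))" "\<sigma> \<in> {1, - 1}" "\<tau> \<in> {1, - 1}" "p = point \<sigma> \<tau> (ln (norm p))"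
proof -
  have "p \<noteq> 0" using assms \<rho> by auto
  define s where "s = ln (norm p)"
  define \<sigma> \<tau> :: real where "\<sigma> = (if Re p \<ge> 0 then 1 else - 1)" and "\<tau> = (if Im p \<ge> 0 then 1 else - 1)"
  have st: "\<sigma> \<in> {1, - 1}" "\<tau> \<in> {1, - 1}" by (auto simp: \<sigma>_def \<tau>_def)
  define h where "h = Complex \<bar>Re p\<bar> \<bar>Im p\<bar>"
  have p: "p = Complex (\<sigma> * Re h) (\<tau> * Im h)"
    by (rule complex_eqI) (simp_all add: h_def \<sigma>_def \<tau>_def)
  have nh: "norm h = norm p" by (simp add: h_def cmod_def)
  have "h \<noteq> 0" using nh \<open>p \<noteq> 0\<close> by auto
  define a where "a = Arg h"
  have a: "0 \<le> a" "a \<le> pi / 2"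
    using Arg_Re_nonneg[of h] Arg_less_0[of h] by (auto simp: a_def h_def)
  have "h = of_real (norm h) * exp (\<i> * of_real (Arg h))"
    by (rule Arg_eq[OF \<open>h \<noteq> 0\<close>])
  also have "\<dots> = exp (Complex s a)"
    using \<open>p \<noteq> 0\<close> by (simp add: s_def a_def nh complex_eq_iff Re_exp Im_exp)
  finally have h: "h = exp (Complex s a)" .
  have "F p = Complex (\<sigma> * Re (F h)) (\<tau> * Im (F h))"
    using F_signs[OF st, of "Re h" "Im h"] p by simp
  then have "(norm (F p))\<^sup>2 = (norm (F h))\<^sup>2"
    unfolding cmod_power2 using st by auto
  then have nF: "norm (F (exp (Complex s a))) = \<rho>"
    using assms \<rho> unfolding h by (simp add: power2_eq_iff_nonneg)
  then have "D (exp (2 * Complex s a)) \<noteq> 0" using \<rho> by (auto simp: F_def exp_double)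
  then have 0: "\<Psi> s a = 0" using \<Psi>_eq[of s a] nF by simp
  then have "\<phi> s = a" using \<phi>_eqI a by blast
  show thesis
  proof (rule that)
    show "active (ln (norm p))" using 0 \<open>\<phi> s = a\<close> by (simp add: active_def s_def)
    show "p = point \<sigma> \<tau> (ln (norm p))"
      by (subst p) (simp add: h point_def Re_exp Im_exp \<open>\<phi> s = a\<close> flip: s_def)
  qed (use st in auto)
qed

end

context laguerre_quotient
begin

lemma F_has_field_derivative:
  assumes "p \<noteq> 0" "E (p\<^sup>2) \<noteq> 0" "D (p\<^sup>2) \<noteq> 0"
  shows "(F has_field_derivative F p * r p / p) (at p)"
proof -
  obtain G' where G': "((\<lambda>z. E z / D z) has_field_derivative G') (at (p\<^sup>2))" "p\<^sup>2 * G' = E (p\<^sup>2) / D (p\<^sup>2) * q (p\<^sup>2)"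
    using quotient_has_field_derivative[OF assms(2,3)] .
  have G2: "((\<lambda>z. E (z\<^sup>2) / D (z\<^sup>2)) has_field_derivative G' * (2 * p)) (at p)"
    by (rule DERIV_chain2[of "\<lambda>z. E z / D z" _ "\<lambda>z. z\<^sup>2", OF G'(1)]) (auto intro!: derivative_eq_intros)
  have "((\<lambda>z. z powi (2 * j + 1) * (E (z\<^sup>2) / D (z\<^sup>2))) has_field_derivative
      of_int (2 * j + 1) * p powi (2 * j + 1 - 1) * (E (p\<^sup>2) / D (p\<^sup>2)) + p powi (2 * j + 1) * (G' * (2 * p))) (at p)"
  proof -
    have "((\<lambda>z. z powi (2 * j + 1)) has_field_derivative of_int (2 * j + 1) * p powi (2 * j + 1 - 1)) (at p)"
      using assms(1) by (auto intro!: derivative_eq_intros)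
    from DERIV_mult[OF this G2] show ?thesis by (simp only: mult.commute)
  qed
  moreover have "of_int (2 * j + 1) * p powi (2 * j + 1 - 1) * (E (p\<^sup>2) / D (p\<^sup>2)) + p powi (2 * j + 1) * (G' * (2 * p))
     = F p * r p / p"
  proof -
    define m X Q P where "m = complex_of_int (2 * j + 1)" and "X = E (p\<^sup>2) / D (p\<^sup>2)"
      and "Q = q (p\<^sup>2)" and "P = p powi (2 * j + 1)"
    have "p powi (2 * j + 1 - 1) = P / p" unfolding P_def using assms(1) by (subst power_int_diff) auto
    moreover have "G' = X * Q / p\<^sup>2"
      using G'(2) assms(1) unfolding X_def Q_def by (metis nonzero_mult_div_cancel_left power_not_zero)
    moreover have "F p = P * X" "r p = m + 2 * Q" by (simp_all add: F_def r_def P_def X_def Q_def m_def)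
    ultimately show ?thesis
      using assms(1) unfolding m_def[symmetric] X_def[symmetric] P_def[symmetric]
      by (simp add: field_simps power2_eq_square)
  qed
  ultimately show ?thesis by (simp add: F_def[abs_def])
qed

lemma r_has_field_derivative:
  assumes "E (p\<^sup>2) \<noteq> 0" "D (p\<^sup>2) \<noteq> 0"
  shows "(r has_field_derivative 4 * p * deriv q (p\<^sup>2)) (at p)"
proof -
  have "((\<lambda>z. q (z\<^sup>2)) has_field_derivative deriv q (p\<^sup>2) * (2 * p)) (at p)"
    by (rule DERIV_chain2[of q _ "\<lambda>z. z\<^sup>2", OF q_has_field_derivative[OF assms]]) (auto intro!: derivative_eq_intros)
  then show ?thesis unfolding r_def[abs_def] by (auto intro!: derivative_eq_intros)
qed

lemma open_F_domain: "open {p. p \<noteq> 0 \<and> E (p\<^sup>2) \<noteq> 0 \<and> D (p\<^sup>2) \<noteq> 0}"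
  unfolding Collect_conj_eq by (intro open_Int open_Collect_neq continuous_intros)

lemma F_analytic:
  assumes "p \<noteq> 0" "E (p\<^sup>2) \<noteq> 0" "D (p\<^sup>2) \<noteq> 0"
  shows "F analytic_on {p}"
proof -
  have "F holomorphic_on {p. p \<noteq> 0 \<and> E (p\<^sup>2) \<noteq> 0 \<and> D (p\<^sup>2) \<noteq> 0}"
    unfolding holomorphic_on_open[OF open_F_domain] using F_has_field_derivative by blast
  then show ?thesis using open_F_domain assms by (auto simp: analytic_at)
qed

text \<open>Division by zero makes \<open>F\<close> vanish at \<open>0\<close> and at its poles, so \<open>F p \<noteq> 0\<close> excludes them.\<close>

lemma F_nonzero_imp:
  assumes "F p \<noteq> 0"
  shows "p \<noteq> 0" "E (p\<^sup>2) \<noteq> 0" "D (p\<^sup>2) \<noteq> 0" "F analytic_on {p}"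
proof -
  show "p \<noteq> 0" using assms by auto
  moreover show "E (p\<^sup>2) \<noteq> 0" "D (p\<^sup>2) \<noteq> 0" using assms by (auto simp: F_def)
  ultimately show "F analytic_on {p}" by (rule F_analytic)
qed

lemma alpha_points_F: "\<alpha> \<noteq> 0 \<Longrightarrow> alpha_points F \<alpha> = {p. F p = \<alpha>}"
  using F_nonzero_imp(4) by (auto simp: alpha_points_def)

lemma deriv_F_minus:
  assumes "F p \<noteq> 0"
  shows "\<forall>\<^sub>F z in nhds p. deriv (\<lambda>z. F z - \<alpha>) z = F z * r z / z"
proof -
  have "\<forall>\<^sub>F z in nhds p. z \<in> {p. p \<noteq> 0 \<and> E (p\<^sup>2) \<noteq> 0 \<and> D (p\<^sup>2) \<noteq> 0}"
    using F_nonzero_imp[OF assms] by (intro eventually_nhds_in_open open_F_domain) auto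
  then show ?thesis
    by eventually_elim (auto intro!: DERIV_imp_deriv derivative_eq_intros F_has_field_derivative)
qed

lemma alpha_mult_simple:
  assumes "F p = \<alpha>" "\<alpha> \<noteq> 0" "r p \<noteq> 0"
  shows "alpha_mult F \<alpha> p = 1"
proof -
  have nz: "F p \<noteq> 0" using assms by simp
  have "zorder (\<lambda>z. F z - \<alpha>) p = 1"
    using F_nonzero_imp[OF nz] assms eventually_nhds_x_imp_x[OF deriv_F_minus[OF nz, of \<alpha>]]
    by (intro zorder_zero_eqI') (auto intro!: analytic_intros)
  then show ?thesis by (simp add: alpha_mult_def)
qed

lemma alpha_mult_double:
  assumes "F p = \<alpha>" "\<alpha> \<noteq> 0" "r p = 0" "deriv q (p\<^sup>2) \<noteq> 0"
  shows "alpha_mult F \<alpha> p = 2"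
proof -
  have nz: "F p \<noteq> 0" using assms by simp
  note ev = deriv_F_minus[OF nz, of \<alpha>]
  note nz' = F_nonzero_imp[OF nz]
  have "((\<lambda>z. F z * r z / z) has_field_derivative \<alpha> * 4 * deriv q (p\<^sup>2)) (at p)"
    using nz' assms
    by (auto intro!: derivative_eq_intros F_has_field_derivative r_has_field_derivative)
  then have "deriv (deriv (\<lambda>z. F z - \<alpha>)) p = \<alpha> * 4 * deriv q (p\<^sup>2)"
    using deriv_cong_ev[OF ev refl] by (simp add: DERIV_imp_deriv)
  then have "(deriv ^^ 2) (\<lambda>z. F z - \<alpha>) p = \<alpha> * 4 * deriv q (p\<^sup>2)"
    by (simp add: numeral_2_eq_2)
  moreover have "deriv (\<lambda>z. F z - \<alpha>) p = 0" using eventually_nhds_x_imp_x[OF ev] assms by simp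
  ultimately have "zorder (\<lambda>z. F z - \<alpha>) p = 2"
    using nz' assms
    by (intro zorder_zero_eqI') (auto intro!: analytic_intros simp: less_2_cases_iff)
  then show ?thesis by (simp add: alpha_mult_def)
qed

lemma q_cnj: "q (cnj z) = cnj (q z)"
proof -
  have *: "deriv (canon_prod f) (cnj z) = cnj (deriv (canon_prod f) z)"
    if "summable f" "\<And>k. f k \<ge> 0" for f z
  proof -
    have "(canon_prod f has_field_derivative deriv (canon_prod f) z) (at (cnj (cnj z)))"
      unfolding complex_cnj_cnj by (rule holomorphic_derivI[OF canon_prod_holomorphic[OF that, of UNIV]]) auto
    from has_field_derivative_cnj_cnj[OF this]
    show ?thesis using canon_prod_cnj[OF that] by (intro DERIV_imp_deriv) (simp add: o_def)
  qed
  have "- cnj z = cnj (- z)" by simp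
  then show ?thesis
    unfolding q_def by (simp only: *[OF c(1,2)] *[OF d] canon_prod_cnj[OF c(1,2)] canon_prod_cnj[OF d]) simp
qed

lemma r_nonzero:
  assumes "Im (p\<^sup>2) \<noteq> 0"
  shows "r p \<noteq> 0"
proof -
  have "Im (q (p\<^sup>2)) \<noteq> 0"
    using Im_q_pos[of "p\<^sup>2"] Im_q_pos[of "cnj (p\<^sup>2)"] assms
    by (cases "Im (p\<^sup>2) > 0") (simp_all add: q_cnj del: complex_cnj_power)
  then have "Im (r p) \<noteq> 0" by (simp add: r_def)
  then show ?thesis by auto
qed

end

lemma strictly_convex_increasing_right:
  fixes u u' :: "real \<Rightarrow> real"
  assumes "\<forall>\<^sub>F t in nhds s. (u has_real_derivative u' t) (at t)"
    and "(u' has_real_derivative d) (at s)" "d > 0" "u' s \<ge> 0"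
  shows "\<exists>\<delta>>0. \<forall>t. s < t \<and> t < s + \<delta> \<longrightarrow> u s < u t"
proof -
  obtain \<eta> where \<eta>: "\<eta> > 0" "\<And>t. \<bar>t - s\<bar> < \<eta> \<Longrightarrow> (u has_real_derivative u' t) (at t)"
    using assms(1) unfolding eventually_nhds_metric dist_real_def by blast
  obtain \<epsilon> where \<epsilon>: "\<epsilon> > 0" "\<And>h. 0 < h \<Longrightarrow> h < \<epsilon> \<Longrightarrow> u' s < u' (s + h)"
    using DERIV_pos_inc_right[OF assms(2,3)] by blast
  have "u s < u t" if t: "s < t" "t < s + \<eta>" "t < s + \<epsilon>" for t
  proof (rule DERIV_pos_imp_increasing_open[OF t(1)])
    fix x assume "s < x" "x < t"
    then show "\<exists>y. (u has_real_derivative y) (at x) \<and> 0 < y"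
      using t \<eta>(2)[of x] \<epsilon>(2)[of "x - s"] assms(4) by (intro exI[of _ "u' x"]) auto
  next
    show "continuous_on {s..t} u"
      using t by (intro continuous_at_imp_continuous_on ballI DERIV_isCont[OF \<eta>(2)]) auto
  qed
  then show ?thesis using \<eta>(1) \<epsilon>(1) by (intro exI[of _ "min \<eta> \<epsilon>"]) auto
qed

lemma strictly_convex_decreasing_left:
  fixes u u' :: "real \<Rightarrow> real"
  assumes "\<forall>\<^sub>F t in nhds s. (u has_real_derivative u' t) (at t)"
    and "(u' has_real_derivative d) (at s)" "d > 0" "u' s \<le> 0"
  shows "\<exists>\<delta>>0. \<forall>t. s - \<delta> < t \<and> t < s \<longrightarrow> u s < u t"
proof -
  obtain \<eta> where \<eta>: "\<eta> > 0" "\<And>t. \<bar>t - s\<bar> < \<eta> \<Longrightarrow> (u has_real_derivative u' t) (at t)"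
    using assms(1) unfolding eventually_nhds_metric dist_real_def by blast
  obtain \<epsilon> where \<epsilon>: "\<epsilon> > 0" "\<And>h. 0 < h \<Longrightarrow> h < \<epsilon> \<Longrightarrow> u' (s - h) < u' s"
    using DERIV_pos_inc_left[OF assms(2,3)] by blast
  have "u s < u t" if t: "s - \<eta> < t" "t < s" "s - \<epsilon> < t" for t
  proof (rule DERIV_neg_imp_decreasing_open[OF t(2)])
    fix x assume "t < x" "x < s"
    then show "\<exists>y. (u has_real_derivative y) (at x) \<and> y < 0"
      using t \<eta>(2)[of x] \<epsilon>(2)[of "s - x"] assms(4) by (intro exI[of _ "u' x"]) auto
  next
    show "continuous_on {t..s} u"
      using t by (intro continuous_at_imp_continuous_on ballI DERIV_isCont[OF \<eta>(2)]) auto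
  qed
  then show ?thesis using \<eta>(1) \<epsilon>(1) by (intro exI[of _ "min \<eta> \<epsilon>"]) auto
qed

context level_curve
begin

definition left_end :: "real \<Rightarrow> bool" where "left_end s \<longleftrightarrow> (\<forall>t<s. V t < V s)"
definition right_end :: "real \<Rightarrow> bool" where "right_end s \<longleftrightarrow> (\<forall>t>s. V s < V t)"

lemma left_end_unique: "left_end s \<Longrightarrow> left_end t \<Longrightarrow> V s = V t \<Longrightarrow> s = t"
  by (cases s t rule: linorder_cases) (auto simp: left_end_def)

lemma right_end_unique: "right_end s \<Longrightarrow> right_end t \<Longrightarrow> V s = V t \<Longrightarrow> s = t"
  by (cases s t rule: linorder_cases) (auto simp: right_end_def)

lemma V_attains:
  assumes "V s \<le> v" "v \<le> V t"
  shows "\<exists>x. V x = v"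
proof (cases "s \<le> t")
  case True
  then show ?thesis using IVT'[of V s v t] V_continuous assms by auto
next
  case False
  then have "V t \<le> V s" by (intro V_mono) auto
  with assms show ?thesis by (intro exI[of _ s]) auto
qed

lemma closed_V_level: "closed {s. V s = v}"
  by (intro closed_Collect_eq continuous_intros V_continuous)

lemma left_end_exists:
  assumes "V s < v" "v \<le> V t"
  obtains l where "V l = v" "left_end l"
proof -
  let ?K = "{s. V s = v}"
  obtain x where x: "V x = v" using V_attains[of s v t] assms by auto
  have low: "s \<le> y" if "V y = v" for y using V_mono[of y s] assms that by (cases "s \<le> y") auto
  have "Inf ?K \<in> ?K"
    using x low by (intro closed_contains_Inf closed_V_level) (auto intro!: bdd_belowI)
  moreover have "left_end (Inf ?K)" unfolding left_end_def
  proof (intro allI impI)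
    fix t assume t: "t < Inf ?K"
    have "bdd_below ?K" using low by (auto intro!: bdd_belowI)
    then have "V t \<noteq> v" using cInf_lower[of t ?K] t by auto
    then show "V t < V (Inf ?K)" using V_mono[of t "Inf ?K"] t \<open>Inf ?K \<in> ?K\<close> by auto
  qed
  ultimately show thesis using that by blast
qed

lemma right_end_exists:
  assumes "V s \<le> v" "v < V t"
  obtains x where "V x = v" "right_end x"
proof -
  let ?K = "{s. V s = v}"
  obtain x where x: "V x = v" using V_attains[of s v t] assms by auto
  have up: "y \<le> t" if "V y = v" for y using V_mono[of t y] assms that by (cases "y \<le> t") auto
  have "Sup ?K \<in> ?K"
    using x up by (intro closed_contains_Sup closed_V_level) (auto intro!: bdd_aboveI)
  moreover have "right_end (Sup ?K)" unfolding right_end_def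
  proof (intro allI impI)
    fix y assume y: "Sup ?K < y"
    have "bdd_above ?K" using up by (auto intro!: bdd_aboveI)
    then have "V y \<noteq> v" using cSup_upper[of y ?K] y by auto
    then show "V (Sup ?K) < V y" using V_mono[of "Sup ?K" y] y \<open>Sup ?K \<in> ?K\<close> by auto
  qed
  ultimately show thesis using that by blast
qed

lemma V_initial: "\<exists>s. \<forall>t\<le>s. V t = of_int (2 * j + 1) * (pi / 2)"
  using V_near_at_bot unfolding eventually_at_bot_linorder by blast

lemma V_ge: "of_int (2 * j + 1) * (pi / 2) \<le> V s"
proof -
  obtain t where t: "\<And>x. x \<le> t \<Longrightarrow> V x = of_int (2 * j + 1) * (pi / 2)"
    using V_initial by blast
  show ?thesis unfolding t[of "min s t", OF min.cobounded2, symmetric] by (rule V_mono) simp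
qed

end

section \<open>The level curve on an axis\<close>

locale level_curve_axis = level_curve +
  fixes a e :: real
  assumes axis: "a = 0 \<and> e = 1 \<or> a = pi / 2 \<and> e = - 1"
begin

text \<open>\<open>(a, e)\<close> is \<open>(0, 1)\<close> for the real and \<open>(pi / 2, - 1)\<close> for the imaginary axis; the sign \<open>e\<close> of \<open>z\<^sup>2\<close> on the axis
  makes \<open>U\<close> below strictly convex in both cases.\<close>

lemmas [simp del] = eq_divide_eq_numeral1 divide_eq_eq_numeral1

definition U :: "real \<Rightarrow> real" where
  "U s = e * (ln (norm (F (exp (Complex s a)))) - ln \<rho>)"

definition U' :: "real \<Rightarrow> real" where
  "U' s = e * Re (r (exp (Complex s a)))"

lemma exp_axis: "exp (2 * Complex s a) = of_real (e * exp (2 * s))"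
  using axis by (auto simp: complex_eq_iff Re_exp Im_exp)

lemma ee [simp]: "e * (e * x) = x" using axis by auto

definition regular :: "real set" where
  "regular = {s. E (of_real (e * exp (2 * s))) \<noteq> 0 \<and> D (of_real (e * exp (2 * s))) \<noteq> 0}"

lemma open_regular: "open regular"
  unfolding regular_def Collect_conj_eq by (intro open_Int open_Collect_neq continuous_intros)

lemma F_axis_nonzero: "s \<in> regular \<Longrightarrow> F (exp (Complex s a)) \<noteq> 0"
  using exp_axis[of s] by (simp add: regular_def F_def exp_double)

lemma U_has_real_derivative:
  assumes "s \<in> regular"
  shows "(U has_real_derivative U' s) (at s)"
proof -
  define h where "h t = F (exp (Complex t a))" for t
  have h0: "h s \<noteq> 0" using F_axis_nonzero[OF assms] by (simp add: h_def)
  have "(F has_field_derivative h s * r (exp (Complex s a)) / exp (Complex s a)) (at (exp (Complex s a)))"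
    unfolding h_def using F_nonzero_imp[OF F_axis_nonzero[OF assms]] by (intro F_has_field_derivative)
  moreover have "((\<lambda>t. exp (Complex t a)) has_vector_derivative exp (Complex s a)) (at s)"
  proof -
    have "((\<lambda>t. Complex t a) has_vector_derivative 1) (at s)"
      unfolding Complex_eq has_vector_derivative_def scaleR_conv_of_real
      by (rule has_derivative_eq_rhs, (rule derivative_intros)+) auto
    from field_vector_diff_chain_at[OF this DERIV_exp] show ?thesis by (simp add: o_def)
  qed
  ultimately have "(F \<circ> (\<lambda>t. exp (Complex t a)) has_vector_derivative
      exp (Complex s a) * (h s * r (exp (Complex s a)) / exp (Complex s a))) (at s)"
    by (rule field_vector_diff_chain_at[rotated])
  then have hd: "(h has_vector_derivative h s * r (exp (Complex s a))) (at s)"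
    by (simp add: h_def[abs_def] o_def)
  have d: "((\<lambda>t. Re (h t)) has_real_derivative Re (h s * r (exp (Complex s a)))) (at s)"
    "((\<lambda>t. Im (h t)) has_real_derivative Im (h s * r (exp (Complex s a)))) (at s)"
    unfolding has_real_derivative_iff_has_vector_derivative
    by (rule bounded_linear.has_vector_derivative[OF bounded_linear_Re hd])
      (rule bounded_linear.has_vector_derivative[OF bounded_linear_Im hd])
  have pos: "(Re (h s))\<^sup>2 + (Im (h s))\<^sup>2 > 0" using h0 by (simp add: complex_neq_0)
  let ?r = "r (exp (Complex s a))" and ?N = "\<lambda>t. (Re (h t))\<^sup>2 + (Im (h t))\<^sup>2"
  have N: "(?N has_real_derivative 2 * Re ?r * ?N s) (at s)"
    by (rule DERIV_cong[OF DERIV_add[OF DERIV_power[OF d(1), of 2] DERIV_power[OF d(2), of 2]]])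
      (simp add: algebra_simps power2_eq_square)
  have L: "((\<lambda>t. ln (?N t)) has_real_derivative 2 * Re ?r) (at s)"
    by (rule DERIV_cong[OF DERIV_chain2[OF DERIV_ln_divide[OF pos] N]])
      (use less_imp_neq[OF pos] in \<open>simp del: sum_power2_eq_zero_iff\<close>)
  have dU: "((\<lambda>t. e * (ln (?N t) / 2 - ln \<rho>)) has_real_derivative e * Re ?r) (at s)"
    using DERIV_cmult[OF DERIV_diff[OF DERIV_cdivide[OF L, of 2] DERIV_const[of "ln \<rho>"]], of e]
    by (simp only: diff_0_right nonzero_mult_div_cancel_left zero_neq_numeral[symmetric] not_False_eq_True)
  have eq: "(\<lambda>t. e * (ln ((Re (h t))\<^sup>2 + (Im (h t))\<^sup>2) / 2 - ln \<rho>)) = U"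
  proof
    fix t
    have "ln ((norm (h t))\<^sup>2) = 2 * ln (norm (h t))"
    proof (cases "h t = 0")
      case False
      then show ?thesis using ln_realpow[of "norm (h t)" 2] by simp
    qed simp
    then show "e * (ln ((Re (h t))\<^sup>2 + (Im (h t))\<^sup>2) / 2 - ln \<rho>) = U t"
      unfolding cmod_power2 U_def h_def by (simp only: nonzero_mult_div_cancel_left zero_neq_numeral[symmetric] not_False_eq_True)
  qed
  show ?thesis using dU unfolding eq U'_def .
qed

lemma U'_has_real_derivative:
  assumes "s \<in> regular"
  obtains x where "(U' has_real_derivative x) (at s)" "x > 0"
proof -
  let ?x = "complex_of_real (e * exp (2 * s))"
  have nz: "E ?x \<noteq> 0" "D ?x \<noteq> 0" using assms by (auto simp: regular_def)
  have "((\<lambda>t. complex_of_real (e * exp (2 * t))) has_vector_derivative 2 * ?x) (at s)"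
    unfolding has_vector_derivative_def
    by (auto intro!: derivative_eq_intros simp: scaleR_conv_of_real algebra_simps)
  from field_vector_diff_chain_at[OF this q_has_field_derivative[OF nz]]
  have "((\<lambda>t. q (of_real (e * exp (2 * t)))) has_vector_derivative 2 * ?x * deriv q ?x) (at s)"
    by (simp add: o_def)
  then have "((\<lambda>t. Re (q (of_real (e * exp (2 * t))))) has_real_derivative Re (2 * ?x * deriv q ?x)) (at s)"
    unfolding has_real_derivative_iff_has_vector_derivative
    by (rule bounded_linear.has_vector_derivative[OF bounded_linear_Re])
  note d = this
  have "((\<lambda>t. e * (of_int (2 * j + 1) + 2 * Re (q (of_real (e * exp (2 * t)))))) has_real_derivative
      e * (2 * Re (2 * ?x * deriv q ?x))) (at s)"
    using DERIV_cmult[OF DERIV_add[OF DERIV_const[of "of_int (2 * j + 1)"] DERIV_cmult[OF d, of 2]], of e]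
    by (simp only: add_0_left)
  moreover have "(\<lambda>t. e * (of_int (2 * j + 1) + 2 * Re (q (of_real (e * exp (2 * t)))))) = U'"
  proof
    fix t show "e * (of_int (2 * j + 1) + 2 * Re (q (of_real (e * exp (2 * t))))) = U' t"
      unfolding U'_def r_def exp_axis[symmetric] by (simp add: exp_double)
  qed
  moreover have "e * (2 * Re (2 * ?x * deriv q ?x)) = 4 * exp (2 * s) * Re (deriv q ?x)"
    by (simp add: algebra_simps)
  moreover have "4 * exp (2 * s) * Re (deriv q ?x) > 0"
    using Re_deriv_q_pos[OF _ nz] by simp
  ultimately show thesis using that by metis
qed

lemma U_right:
  assumes "s \<in> regular" "U' s \<ge> 0"
  shows "\<exists>\<delta>>0. \<forall>t. s < t \<and> t < s + \<delta> \<longrightarrow> U s < U t"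
proof -
  obtain x where x: "(U' has_real_derivative x) (at s)" "x > 0" using U'_has_real_derivative[OF assms(1)] .
  have "\<forall>\<^sub>F t in nhds s. (U has_real_derivative U' t) (at t)"
    using eventually_nhds_in_open[OF open_regular assms(1)] by eventually_elim (rule U_has_real_derivative)
  then show ?thesis using x assms(2) by (rule strictly_convex_increasing_right)
qed

lemma U_left:
  assumes "s \<in> regular" "U' s \<le> 0"
  shows "\<exists>\<delta>>0. \<forall>t. s - \<delta> < t \<and> t < s \<longrightarrow> U s < U t"
proof -
  obtain x where x: "(U' has_real_derivative x) (at s)" "x > 0" using U'_has_real_derivative[OF assms(1)] .
  have "\<forall>\<^sub>F t in nhds s. (U has_real_derivative U' t) (at t)"
    using eventually_nhds_in_open[OF open_regular assms(1)] by eventually_elim (rule U_has_real_derivative)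
  then show ?thesis using x assms(2) by (rule strictly_convex_decreasing_left)
qed

lemma on_axis_regular: "\<phi> s = a \<Longrightarrow> s \<in> regular"
  using W_in_T[of s] exp_axis[of s] by (auto simp: regular_def T_def W_def)

lemma \<Psi>_axis: "s \<in> regular \<Longrightarrow> \<Psi> s a = norm (D (of_real (e * exp (2 * s)))) * (norm (F (exp (Complex s a))) - \<rho>)"
  using \<Psi>_eq[of s a] by (simp add: exp_axis regular_def)

lemma sgn_U:
  assumes "s \<in> regular"
  shows "U s < 0 \<longleftrightarrow> e * \<Psi> s a < 0" "U s = 0 \<longleftrightarrow> \<Psi> s a = 0"
proof -
  let ?n = "norm (F (exp (Complex s a)))" and ?d = "norm (D (of_real (e * exp (2 * s))))"
  have n: "?n > 0" "?d > 0" using F_axis_nonzero[OF assms] assms by (auto simp: regular_def)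
  have "ln ?n < ln \<rho> \<longleftrightarrow> ?n < \<rho>" "ln ?n = ln \<rho> \<longleftrightarrow> ?n = \<rho>" "ln ?n > ln \<rho> \<longleftrightarrow> ?n > \<rho>" using n \<rho> by auto
  then show "U s < 0 \<longleftrightarrow> e * \<Psi> s a < 0" "U s = 0 \<longleftrightarrow> \<Psi> s a = 0"
    unfolding \<Psi>_axis[OF assms] U_def using axis n by (auto simp: mult_less_0_iff zero_less_mult_iff)
qed

lemma U_nonpos: "\<phi> s = a \<Longrightarrow> U s \<le> 0"
proof -
  assume s: "\<phi> s = a"
  have "e * \<Psi> s a \<le> 0" using axis \<phi>(3,4)[of s] s by auto
  then show ?thesis using sgn_U[OF on_axis_regular[OF s]] axis by (auto simp: le_less)
qed

lemma U_neg_imp: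
  assumes "s \<in> regular" "U s < 0"
  shows "\<phi> s = a"
proof -
  have "e * \<Psi> s a < 0" using sgn_U(1) assms by blast
  then show ?thesis using axis \<phi>(1,2)[of s] less_\<phi>_iff[of 0 s] \<phi>_less_iff[of "pi / 2" s]
    by (elim disjE conjE) auto
qed

lemma active_iff_U: "\<phi> s = a \<Longrightarrow> active s \<longleftrightarrow> U s = 0"
  using sgn_U(2)[OF on_axis_regular] by (simp add: active_def)

lemma V_axis: assumes "\<phi> s = a" obtains n :: int where "V s = a + of_int n * pi"
proof (cases "a = 0")
  case True
  then show ?thesis using V_real_axis[of s] assms that by auto
next
  case False
  then have a: "a = pi / 2" using axis by auto
  then obtain n :: int where "V s = of_int (2 * j + 1) * (pi / 2) + of_int n * pi"
    using V_imaginary_axis[of s] assms by auto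
  then show ?thesis using a by (intro that[of "j + n"]) (simp add: algebra_simps)
qed

lemma axis_or_interior:
  assumes "V s = a + of_int n * pi"
  shows "\<phi> s = a \<or> (0 < \<phi> s \<and> \<phi> s < pi / 2)"
proof (rule ccontr)
  assume *: "\<not> ?thesis"
  then have ph: "\<phi> s = 0 \<and> a = pi / 2 \<or> \<phi> s = pi / 2 \<and> a = 0" using \<phi>(1,2)[of s] axis by auto
  then obtain k :: int where "V s = (pi / 2 - a) + of_int k * pi"
    using V_real_axis[of s] V_imaginary_axis[of s]
  proof (elim disjE conjE)
    assume "\<phi> s = 0" "a = pi / 2"
    then show thesis using V_real_axis[of s] that by auto
  next
    assume 1: "\<phi> s = pi / 2" "a = 0"
    then obtain n :: int where "V s = of_int (2 * j + 1) * (pi / 2) + of_int n * pi"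
      using V_imaginary_axis[of s] by auto
    then show thesis using 1 by (intro that[of "j + n"]) (simp add: algebra_simps)
  qed
  then have "of_int (2 * (k - n)) * (pi / 2) = of_int 1 * (pi / 2) \<or> of_int (2 * (k - n)) * (pi / 2) = of_int (- 1) * (pi / 2)"
    using assms axis by (auto simp: algebra_simps)
  then have "2 * (k - n) = 1 \<or> 2 * (k - n) = - 1"
    unfolding mult_cancel_right of_int_eq_iff by simp
  then show False by presburger
qed

lemma V_locally_constant:
  assumes "\<phi> s = a"
  shows "\<exists>\<delta>>0. \<forall>t. \<bar>t - s\<bar> < \<delta> \<and> \<phi> t = a \<longrightarrow> V t = V s"
proof -
  have "isCont V s" using V_continuous[of UNIV] by (simp add: continuous_on_eq_continuous_at)
  then obtain \<delta> where \<delta>: "\<delta> > 0" "\<And>t. \<bar>t - s\<bar> < \<delta> \<Longrightarrow> \<bar>V t - V s\<bar> < pi"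
    unfolding continuous_at_eps_delta dist_real_def using pi_gt_zero by blast
  have "V t = V s" if t: "\<bar>t - s\<bar> < \<delta>" "\<phi> t = a" for t
  proof -
    obtain n m :: int where "V t = a + of_int n * pi" "V s = a + of_int m * pi"
      using V_axis[OF t(2)] V_axis[OF assms] by metis
    then have nm: "V t - V s = of_int (n - m) * pi" by (simp add: algebra_simps)
    then have "\<bar>of_int (n - m)\<bar> * pi < 1 * pi" using \<delta>(2)[OF t(1)] by (simp add: abs_mult)
    then have "\<bar>of_int (n - m) :: real\<bar> < 1" by (simp add: mult_less_cancel_right)
    then have "n = m" by linarith
    with nm show ?thesis by simp
  qed
  with \<delta>(1) show ?thesis by blast
qed

lemma interior_left_right_end:
  assumes "0 < \<phi> s" "\<phi> s < pi / 2"
  shows "left_end s" "right_end s"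
  using V_strict_mono assms by (auto simp: left_end_def right_end_def)

lemma axis_on_level_segment:
  assumes "V s = a + of_int n * pi" "V t = V s" "s < t" "x \<in> {s..t}"
  shows "\<phi> x = a" "V x = V s"
proof -
  show V: "V x = V s" using V_mono[of s x] V_mono[of x t] assms by auto
  have "\<not> (0 < \<phi> x \<and> \<phi> x < pi / 2)"
    using V_strict_mono[of s x] V_strict_mono[of x t] assms V by (cases "s < x") auto
  then show "\<phi> x = a" using axis_or_interior[of x n] V assms by auto
qed

lemma not_right_end:
  assumes "V s = a + of_int n * pi" "\<phi> s = a" "active s" "\<not> right_end s"
  shows "U' s < 0"
proof (rule ccontr)
  assume "\<not> U' s < 0"
  then obtain \<delta> where \<delta>: "\<delta> > 0" "\<And>t. s < t \<Longrightarrow> t < s + \<delta> \<Longrightarrow> U s < U t"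
    using U_right[OF on_axis_regular[OF assms(2)]] by auto
  obtain t where t: "s < t" "\<not> V s < V t" using assms(4) unfolding right_end_def by blast
  then have t: "s < t" "V t = V s" using V_mono[of s t] by auto
  define x where "x = min t (s + \<delta> / 2)"
  have x: "s < x" "x < s + \<delta>" "x \<le> t" using t \<delta> by (auto simp: x_def)
  then have "\<phi> x = a" using axis_on_level_segment(1)[OF assms(1) t(2,1)] by auto
  then have "U x \<le> 0" by (rule U_nonpos)
  moreover have "U s = 0" using active_iff_U assms by blast
  ultimately show False using \<delta>(2)[OF x(1,2)] by simp
qed

lemma not_left_end:
  assumes "V s = a + of_int n * pi" "\<phi> s = a" "active s" "\<not> left_end s"
  shows "U' s > 0"
proof (rule ccontr)
  assume "\<not> U' s > 0"
  then obtain \<delta> where \<delta>: "\<delta> > 0" "\<And>t. s - \<delta> < t \<Longrightarrow> t < s \<Longrightarrow> U s < U t"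
    using U_left[OF on_axis_regular[OF assms(2)]] by auto
  obtain t where t: "t < s" "\<not> V t < V s" using assms(4) unfolding left_end_def by blast
  then have t: "t < s" "V s = V t" using V_mono[of t s] by auto
  define x where "x = max t (s - \<delta> / 2)"
  have x: "s - \<delta> < x" "x < s" "t \<le> x" using t \<delta> by (auto simp: x_def)
  then have "\<phi> x = a" using axis_on_level_segment(1)[of t n s x] t assms(1) by auto
  then have "U x \<le> 0" by (rule U_nonpos)
  moreover have "U s = 0" using active_iff_U assms by blast
  ultimately show False using \<delta>(2)[OF x(1,2)] by simp
qed

lemma active_imp_end:
  assumes "V s = a + of_int n * pi" "active s"
  shows "left_end s \<or> right_end s"
  using axis_or_interior[OF assms(1)] interior_left_right_end[of s] not_right_end[OF assms(1) _ assms(2)]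
    not_left_end[OF assms(1) _ assms(2)] by (meson not_less_iff_gr_or_eq)

lemma end_imp_active:
  assumes "V s = a + of_int n * pi" "left_end s \<or> right_end s"
  shows "active s"
proof (rule ccontr)
  assume na: "\<not> active s"
  then have s: "\<phi> s = a" using axis_or_interior[OF assms(1)] interior_imp_active by blast
  then have reg: "s \<in> regular" and "U s < 0"
    using on_axis_regular U_nonpos[OF s] active_iff_U[OF s] na by auto
  have "(U \<longlongrightarrow> U s) (nhds s)" using U_has_real_derivative[OF reg] DERIV_isCont isCont_def tendsto_at_iff_tendsto_nhds by blast
  then have "\<forall>\<^sub>F t in nhds s. t \<in> regular \<and> U t < 0"
    using order_tendstoD(2)[OF _ \<open>U s < 0\<close>] eventually_nhds_in_open[OF open_regular reg]
    by (intro eventually_conj) auto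
  then obtain \<delta> where \<delta>: "\<delta> > 0" "\<And>t. \<bar>t - s\<bar> < \<delta> \<Longrightarrow> \<phi> t = a"
    unfolding eventually_nhds_metric dist_real_def using U_neg_imp by blast
  obtain \<eta> where \<eta>: "\<eta> > 0" "\<And>t. \<bar>t - s\<bar> < \<eta> \<Longrightarrow> \<phi> t = a \<Longrightarrow> V t = V s"
    using V_locally_constant[OF s] by blast
  define h where "h = min \<delta> \<eta> / 2"
  have h: "h > 0" "h < \<delta>" "h < \<eta>" using \<delta> \<eta> by (auto simp: h_def)
  have "V (s - h) = V s" "V (s + h) = V s" using h by (auto intro!: \<eta> \<delta>)
  moreover have "V (s - h) < V s \<or> V s < V (s + h)"
    using assms(2) h(1) by (auto simp: left_end_def right_end_def)
  ultimately show False by simp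
qed

lemma U'_eq_0_iff:
  assumes "V s = a + of_int n * pi" "\<phi> s = a" "active s"
  shows "U' s = 0 \<longleftrightarrow> left_end s \<and> right_end s"
proof
  show "left_end s \<and> right_end s" if "U' s = 0"
    using not_left_end[OF assms] not_right_end[OF assms] that by auto
  show "U' s = 0" if ends: "left_end s \<and> right_end s"
  proof (rule ccontr)
    assume nz: "U' s \<noteq> 0"
    have reg: "s \<in> regular" by (rule on_axis_regular[OF assms(2)])
    have U0: "U s = 0" using active_iff_U assms by blast
    note dU = U_has_real_derivative[OF reg]
    obtain \<eta> where \<eta>: "\<eta> > 0" "\<And>t. \<bar>t - s\<bar> < \<eta> \<Longrightarrow> \<phi> t = a \<Longrightarrow> V t = V s"
      using V_locally_constant[OF assms(2)] by blast
    obtain \<epsilon> where \<epsilon>: "\<epsilon> > 0" "\<And>t. \<bar>t - s\<bar> < \<epsilon> \<Longrightarrow> t \<in> regular"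
      using open_regular reg unfolding open_dist dist_real_def by blast
    consider "U' s > 0" | "U' s < 0" using nz by linarith
    then show False
    proof cases
      case 1
      obtain \<delta> where \<delta>: "\<delta> > 0" "\<And>h. 0 < h \<Longrightarrow> h < \<delta> \<Longrightarrow> U (s - h) < U s"
        using DERIV_pos_inc_left[OF dU 1] by blast
      define h where "h = min \<delta> (min \<eta> \<epsilon>) / 2"
      have h: "h > 0" "h < \<delta>" "h < \<eta>" "h < \<epsilon>" using \<delta> \<eta> \<epsilon> by (auto simp: h_def min_def)
      have "\<phi> (s - h) = a" using h \<delta>(2)[of h] U0 by (intro U_neg_imp \<epsilon>) auto
      then have "V (s - h) = V s" using h by (intro \<eta>(2)) auto
      moreover have "V (s - h) < V s" using ends h(1) by (simp add: left_end_def)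
      ultimately show False by simp
    next
      case 2
      obtain \<delta> where \<delta>: "\<delta> > 0" "\<And>h. 0 < h \<Longrightarrow> h < \<delta> \<Longrightarrow> U (s + h) < U s"
        using DERIV_neg_dec_right[OF dU 2] by blast
      define h where "h = min \<delta> (min \<eta> \<epsilon>) / 2"
      have h: "h > 0" "h < \<delta>" "h < \<eta>" "h < \<epsilon>" using \<delta> \<eta> \<epsilon> by (auto simp: h_def min_def)
      have "\<phi> (s + h) = a" using h \<delta>(2)[of h] U0 by (intro U_neg_imp \<epsilon>) auto
      then have "V (s + h) = V s" using h by (intro \<eta>(2)) auto
      moreover have "V s < V (s + h)" using ends h(1) by (simp add: right_end_def)
      ultimately show False by simp
    qed
  qed
qed

end

section \<open>Enumerating the points\<close>

lemma idx_downward: "n \<in> idx \<omega> \<Longrightarrow> 1 \<le> i \<Longrightarrow> i \<le> n \<Longrightarrow> i \<in> idx \<omega>"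
  using order_trans[of "enat i" "enat n" \<omega>] by (simp add: idx_def)

lemma grouped_enumeration:
  fixes \<kappa> m :: "nat \<Rightarrow> nat"
  assumes mono: "\<And>i n. i \<in> idx \<omega> \<Longrightarrow> n \<in> idx \<omega> \<Longrightarrow> i \<le> n \<Longrightarrow> \<kappa> i \<le> \<kappa> n"
    and fin: "\<And>k. finite {n \<in> idx \<omega>. \<kappa> n = k}"
    and le: "\<And>k. card {n \<in> idx \<omega>. \<kappa> n = k} \<le> m k"
    and full: "\<And>n k. n \<in> idx \<omega> \<Longrightarrow> k < \<kappa> n \<Longrightarrow> card {n \<in> idx \<omega>. \<kappa> n = k} = m k"
    and n: "n \<in> idx \<omega>"
  shows "sum m {..<\<kappa> n} < n" "n \<le> sum m {..\<kappa> n}"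
proof -
  have "n \<ge> 1" using n by (simp add: idx_def)
  have idx: "i \<in> idx \<omega>" "\<kappa> i \<le> \<kappa> n" if "i \<in> {1..n}" for i
    using that idx_downward[OF n] mono[OF _ n] by simp_all
  have U: "card (\<Union>k\<in>K. {i \<in> idx \<omega>. \<kappa> i = k}) = (\<Sum>k\<in>K. card {i \<in> idx \<omega>. \<kappa> i = k})" if "finite K" for K
    using that fin by (intro card_UN_disjoint) auto
  have "(\<Union>k\<in>{..<\<kappa> n}. {i \<in> idx \<omega>. \<kappa> i = k}) \<subseteq> {1..<n}"
  proof
    fix i assume "i \<in> (\<Union>k\<in>{..<\<kappa> n}. {i \<in> idx \<omega>. \<kappa> i = k})"
    then have i: "i \<in> idx \<omega>" "\<kappa> i < \<kappa> n" by auto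
    then have "\<not> n \<le> i" using mono[OF n i(1)] by auto
    then show "i \<in> {1..<n}" using i by (auto simp: idx_def)
  qed
  then have "(\<Sum>k<\<kappa> n. card {i \<in> idx \<omega>. \<kappa> i = k}) \<le> n - 1"
    using card_mono[of "{1..<n}" "\<Union>k\<in>{..<\<kappa> n}. {i \<in> idx \<omega>. \<kappa> i = k}"] U[of "{..<\<kappa> n}"] by simp
  then show "sum m {..<\<kappa> n} < n" using full[OF n] \<open>n \<ge> 1\<close> by simp
  have "{1..n} \<subseteq> (\<Union>k\<in>{..\<kappa> n}. {i \<in> idx \<omega>. \<kappa> i = k})"
  proof
    fix i assume "i \<in> {1..n}"
    from idx[OF this] show "i \<in> (\<Union>k\<in>{..\<kappa> n}. {i \<in> idx \<omega>. \<kappa> i = k})" by simp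
  qed
  then have "n \<le> (\<Sum>k\<le>\<kappa> n. card {i \<in> idx \<omega>. \<kappa> i = k})"
    using card_mono[of "\<Union>k\<in>{..\<kappa> n}. {i \<in> idx \<omega>. \<kappa> i = k}" "{1..n}"] U[of "{..\<kappa> n}"] fin by simp
  also have "\<dots> \<le> sum m {..\<kappa> n}" by (intro sum_mono le)
  finally show "n \<le> sum m {..\<kappa> n}" .
qed

locale enumerated_alpha_points = laguerre_quotient j A c d for j A c d +
  fixes \<alpha> :: complex and \<omega> :: enat and z :: "nat \<Rightarrow> complex"
  assumes \<alpha>: "\<alpha> \<noteq> 0" and enum: "enumerates_alpha_points F \<alpha> \<omega> z"
begin

sublocale level_curve j A c d "norm \<alpha>"
  using \<alpha> by unfold_locales simp

definition x :: "nat \<Rightarrow> real" where "x n = ln (norm (z n))"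

definition at_modulus :: "real \<Rightarrow> complex set" where
  "at_modulus s = {p. F p = \<alpha> \<and> ln (norm p) = s}"

lemma F_z: "n \<in> idx \<omega> \<Longrightarrow> F (z n) = \<alpha>"
  using enum alpha_points_F[OF \<alpha>] by (auto simp: enumerates_alpha_points_def)

lemma F_eq_\<alpha>:
  assumes "F p = \<alpha>"
  obtains \<sigma> \<tau> where "p \<noteq> 0" "active (ln (norm p))" "\<sigma> \<in> {1, - 1}" "\<tau> \<in> {1, - 1}"
    "p = point \<sigma> \<tau> (ln (norm p))"
    "Re \<alpha> = \<sigma> * (norm \<alpha> * cos (V (ln (norm p))))" "Im \<alpha> = \<tau> * (norm \<alpha> * sin (V (ln (norm p))))"
proof -
  have "norm (F p) = norm \<alpha>" using assms by simp
  then obtain \<sigma> \<tau> where *: "active (ln (norm p))" "\<sigma> \<in> {1, - 1}" "\<tau> \<in> {1, - 1}" "p = point \<sigma> \<tau> (ln (norm p))"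
    by (rule norm_F_eq_imp)
  have "p \<noteq> 0" using assms \<alpha> by auto
  have "F (point \<sigma> \<tau> (ln (norm p))) = \<alpha>" by (simp only: *(4)[symmetric] assms)
  then have eq: "\<alpha> = Complex (\<sigma> * (norm \<alpha> * cos (V (ln (norm p))))) (\<tau> * (norm \<alpha> * sin (V (ln (norm p)))))"
    unfolding F_point[OF *(1-3)] by (rule sym)
  show thesis
    by (rule that[OF \<open>p \<noteq> 0\<close> *]) (use arg_cong[OF eq, of Re] arg_cong[OF eq, of Im] in \<open>simp_all only: complex.sel\<close>)
qed

lemma z_nonzero: "n \<in> idx \<omega> \<Longrightarrow> z n \<noteq> 0"
  using F_z \<alpha> by force

lemma norm_z: "n \<in> idx \<omega> \<Longrightarrow> norm (z n) = exp (x n)"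
  using z_nonzero by (simp add: x_def)

lemma norm_z_mono: "i \<in> idx \<omega> \<Longrightarrow> n \<in> idx \<omega> \<Longrightarrow> i \<le> n \<Longrightarrow> norm (z i) \<le> norm (z n)"
proof (induction n)
  case (Suc n)
  show ?case
  proof (cases "i = Suc n")
    case False
    then have n: "i \<le> n" using Suc.prems by simp
    then have "n \<in> idx \<omega>" "n \<ge> 1" using Suc.prems by (auto simp: idx_def intro: order_trans[of _ "enat (Suc n)"])
    then show ?thesis
      using Suc.IH[OF Suc.prems(1) _ n] Suc.prems(2) enum unfolding enumerates_alpha_points_def by force
  qed simp
qed (simp add: idx_def)

lemma x_mono: "i \<in> idx \<omega> \<Longrightarrow> n \<in> idx \<omega> \<Longrightarrow> i \<le> n \<Longrightarrow> x i \<le> x n"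
  using norm_z_mono[of i n] by (simp add: norm_z)

lemma z_at_modulus: "n \<in> idx \<omega> \<Longrightarrow> z n \<in> at_modulus (x n)"
  using F_z by (simp add: at_modulus_def x_def)

lemma point_at_modulus:
  assumes "active s" "\<sigma> \<in> {1, - 1}" "\<tau> \<in> {1, - 1}"
    "Re \<alpha> = \<sigma> * (norm \<alpha> * cos (V s))" "Im \<alpha> = \<tau> * (norm \<alpha> * sin (V s))"
  shows "point \<sigma> \<tau> s \<in> at_modulus s"
  using F_point[OF assms(1-3)] norm_point[OF assms(2,3)] assms(4,5)
  by (simp add: at_modulus_def complex_eq_iff)

lemma card_modulus:
  assumes "finite (at_modulus s)"
  shows "finite {n \<in> idx \<omega>. x n = s}" "card {n \<in> idx \<omega>. x n = s} = (\<Sum>p\<in>at_modulus s. alpha_mult F \<alpha> p)"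
proof -
  have eq: "{n \<in> idx \<omega>. x n = s} = (\<Union>p\<in>at_modulus s. {n \<in> idx \<omega>. z n = p})"
    using F_z by (auto simp: at_modulus_def x_def)
  have *: "finite {n \<in> idx \<omega>. z n = p}" "card {n \<in> idx \<omega>. z n = p} = alpha_mult F \<alpha> p" if "p \<in> at_modulus s" for p
    using enum that alpha_points_F[OF \<alpha>] by (auto simp: enumerates_alpha_points_def at_modulus_def)
  show "finite {n \<in> idx \<omega>. x n = s}" unfolding eq using assms * by auto
  show "card {n \<in> idx \<omega>. x n = s} = (\<Sum>p\<in>at_modulus s. alpha_mult F \<alpha> p)"
    unfolding eq using assms * by (subst card_UN_disjoint) auto
qed

lemma simple_imp_distinct:
  assumes "i \<in> idx \<omega>" "n \<in> idx \<omega>" "i \<noteq> n" "alpha_mult F \<alpha> (z n) = 1"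
  shows "z i \<noteq> z n"
proof
  assume eq: "z i = z n"
  have "card {m \<in> idx \<omega>. z m = z n} = 1"
    using enum assms F_z alpha_points_F[OF \<alpha>] by (auto simp: enumerates_alpha_points_def)
  then obtain m where "{m \<in> idx \<omega>. z m = z n} = {m}" by (auto simp: card_1_singleton_iff)
  then have "i = m" "n = m" using eq assms by blast+
  then show False using assms by simp
qed

lemma mult_off_axes:
  assumes "F p = \<alpha>" "Re p \<noteq> 0" "Im p \<noteq> 0"
  shows "alpha_mult F \<alpha> p = 1"
proof (rule alpha_mult_simple[OF assms(1) \<alpha> r_nonzero])
  show "Im (p\<^sup>2) \<noteq> 0" using assms by (simp add: Im_power2)
qed

lemma level_of_index:
  fixes v :: "nat \<Rightarrow> real" and m :: "nat \<Rightarrow> nat"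
  assumes v: "strict_mono v" and levels: "\<And>n. n \<in> idx \<omega> \<Longrightarrow> \<exists>k. V (x n) = v k"
    and fin: "\<And>k. finite {n \<in> idx \<omega>. V (x n) = v k}"
    and le: "\<And>k. card {n \<in> idx \<omega>. V (x n) = v k} \<le> m k"
    and full: "\<And>k s. v k < V s \<Longrightarrow> card {n \<in> idx \<omega>. V (x n) = v k} = m k"
    and n: "n \<in> idx \<omega>"
  obtains k where "V (x n) = v k" "sum m {..<k} < n" "n \<le> sum m {..k}"
proof -
  obtain \<kappa> where \<kappa>: "\<And>n. n \<in> idx \<omega> \<Longrightarrow> V (x n) = v (\<kappa> n)" using levels by metis
  have eq: "{n \<in> idx \<omega>. \<kappa> n = k} = {n \<in> idx \<omega>. V (x n) = v k}" for k
    using \<kappa> strict_mono_eq[OF v] by auto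
  have 1: "\<kappa> i \<le> \<kappa> n" if "i \<in> idx \<omega>" "n \<in> idx \<omega>" "i \<le> n" for i n
    using V_mono[OF x_mono[OF that]] \<kappa> that strict_mono_less_eq[OF v] by simp
  have 2: "card {n \<in> idx \<omega>. \<kappa> n = k} = m k" if "n \<in> idx \<omega>" "k < \<kappa> n" for n k
    unfolding eq using that \<kappa> strict_monoD[OF v that(2)] by (intro full[of k "x n"]) auto
  show thesis
  proof (rule that[OF \<kappa>[OF n]])
    show "sum m {..<\<kappa> n} < n"
      by (rule grouped_enumeration(1)[of \<omega> \<kappa> m n]) (use 1 2 n fin le in \<open>auto simp: eq\<close>)
    show "n \<le> sum m {..\<kappa> n}"
      by (rule grouped_enumeration(2)[of \<omega> \<kappa> m n]) (use 1 2 n fin le in \<open>auto simp: eq\<close>)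
  qed
qed

end

locale axis_alpha_points = enumerated_alpha_points j A c d \<alpha> \<omega> z + level_curve_axis j A c d "norm \<alpha>" a e
  for j A c d \<alpha> \<omega> z a e +
  assumes \<alpha>_axis: "a = 0 \<Longrightarrow> Im \<alpha> = 0" "a \<noteq> 0 \<Longrightarrow> Re \<alpha> = 0"
begin

lemma V_level:
  assumes "F p = \<alpha>"
  obtains n :: int where "V (ln (norm p)) = a + of_int n * pi"
proof -
  obtain \<sigma> \<tau> where *: "\<sigma> \<in> {1, - 1}" "\<tau> \<in> {1, - 1}"
    "Re \<alpha> = \<sigma> * (norm \<alpha> * cos (V (ln (norm p))))" "Im \<alpha> = \<tau> * (norm \<alpha> * sin (V (ln (norm p))))"
    using F_eq_\<alpha>[OF assms] by metis
  show thesis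
  proof (cases "a = 0")
    case True
    then have "sin (V (ln (norm p))) = 0" using * \<alpha>_axis \<alpha> by auto
    then show thesis using that True by (auto simp: sin_zero_iff_int2)
  next
    case False
    then have "cos (V (ln (norm p))) = 0" using * \<alpha>_axis \<alpha> by auto
    then show thesis using that False axis by (auto simp: cos_zero_iff_int2 add.commute)
  qed
qed

definition reflect :: "complex \<Rightarrow> complex" where "reflect p = of_real e * cnj p"

lemma reflect_sel [simp]: "Re (reflect p) = e * Re p" "Im (reflect p) = - e * Im p"
  by (simp_all add: reflect_def)

lemma e_nonzero [simp]: "e \<noteq> 0" using axis by auto

lemma reflect_point: "reflect (point \<sigma> \<tau> s) = point (e * \<sigma>) (- e * \<tau>) s"
  by (simp add: reflect_def point_def complex_eq_iff)

lemma at_modulus_eq: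
  assumes V: "V s = a + of_int n * pi" and act: "active s"
  obtains \<sigma> \<tau> where "\<sigma> \<in> {1, - 1}" "\<tau> \<in> {1, - 1}" "at_modulus s = {point \<sigma> \<tau> s, reflect (point \<sigma> \<tau> s)}"
    "Re \<alpha> = \<sigma> * (norm \<alpha> * cos (V s))" "Im \<alpha> = \<tau> * (norm \<alpha> * sin (V s))"
proof (cases "a = 0")
  case True
  then have e: "e = 1" using axis by auto
  have sc: "sin (V s) = 0" "\<bar>cos (V s)\<bar> = 1"
    using True V sin_zero_abs_cos_one[of "V s"] by (auto simp: sin_zero_iff_int2)
  define \<sigma> where "\<sigma> = sgn (Re \<alpha>) * cos (V s)"
  have Im: "Im \<alpha> = 0" using \<alpha>_axis(1)[OF True] .
  then have Re: "norm \<alpha> = \<bar>Re \<alpha>\<bar>" "Re \<alpha> \<noteq> 0" using \<alpha> by (auto simp: cmod_def complex_eq_iff)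
  have cc: "cos (V s) * cos (V s) = 1" "cos (V s) \<in> {1, - 1}" using sc(2) by (auto simp: abs_if split: if_splits)
  then have \<sigma>: "\<sigma> \<in> {1, - 1}" using Re(2) by (auto simp: \<sigma>_def sgn_if)
  have "sgn (Re \<alpha>) * norm \<alpha> = Re \<alpha>" unfolding Re(1) by (rule sgn_mult_abs)
  moreover have "\<sigma> * (norm \<alpha> * cos (V s)) = sgn (Re \<alpha>) * norm \<alpha> * (cos (V s) * cos (V s))"
    unfolding \<sigma>_def by (simp only: mult_ac)
  ultimately have R: "Re \<alpha> = \<sigma> * (norm \<alpha> * cos (V s))" using cc(1) by simp
  have "point \<sigma> \<tau> s \<in> at_modulus s" if "\<tau> \<in> {1, - 1}" for \<tau>
    by (rule point_at_modulus) (use act \<sigma> that R Im sc in auto)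
  moreover have "p \<in> {point \<sigma> 1 s, point \<sigma> (- 1) s}" if "p \<in> at_modulus s" for p
  proof -
    have p: "F p = \<alpha>" "ln (norm p) = s" using that by (auto simp: at_modulus_def)
    obtain \<sigma>' \<tau>' where *: "\<sigma>' \<in> {1, - 1}" "\<tau>' \<in> {1, - 1}" "p = point \<sigma>' \<tau>' s"
      "Re \<alpha> = \<sigma>' * (norm \<alpha> * cos (V s))"
      using F_eq_\<alpha>[OF p(1)] unfolding p(2) by metis
    have "\<sigma>' = \<sigma>" using *(4) R sc(2) \<alpha> by auto
    with * show ?thesis by auto
  qed
  moreover have "reflect (point \<sigma> 1 s) = point \<sigma> (- 1) s"
    by (subst reflect_point) (simp add: e)
  ultimately have "at_modulus s = {point \<sigma> 1 s, reflect (point \<sigma> 1 s)}" by auto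
  then show thesis using that[of \<sigma> 1] \<sigma> R Im sc by simp
next
  case False
  then have e: "e = - 1" "a = pi / 2" using axis by auto
  have c0: "cos (V s) = 0" unfolding V e(2) by (auto simp: cos_zero_iff_int2)
  then have sc: "cos (V s) = 0" "\<bar>sin (V s)\<bar> = 1"
    using sin_cos_squared_add[of "V s"] by (auto simp: power2_eq_1_iff)
  define \<tau> where "\<tau> = sgn (Im \<alpha>) * sin (V s)"
  have Re: "Re \<alpha> = 0" using \<alpha>_axis(2)[OF False] .
  then have Im: "norm \<alpha> = \<bar>Im \<alpha>\<bar>" "Im \<alpha> \<noteq> 0" using \<alpha> by (auto simp: cmod_def complex_eq_iff)
  have cc: "sin (V s) * sin (V s) = 1" "sin (V s) \<in> {1, - 1}" using sc(2) by (auto simp: abs_if split: if_splits)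
  then have \<tau>: "\<tau> \<in> {1, - 1}" using Im(2) by (auto simp: \<tau>_def sgn_if)
  have "sgn (Im \<alpha>) * norm \<alpha> = Im \<alpha>" unfolding Im(1) by (rule sgn_mult_abs)
  moreover have "\<tau> * (norm \<alpha> * sin (V s)) = sgn (Im \<alpha>) * norm \<alpha> * (sin (V s) * sin (V s))"
    unfolding \<tau>_def by (simp only: mult_ac)
  ultimately have R: "Im \<alpha> = \<tau> * (norm \<alpha> * sin (V s))" using cc(1) by simp
  have "point \<sigma> \<tau> s \<in> at_modulus s" if "\<sigma> \<in> {1, - 1}" for \<sigma>
    by (rule point_at_modulus) (use act \<tau> that R Re sc in auto)
  moreover have "p \<in> {point 1 \<tau> s, point (- 1) \<tau> s}" if "p \<in> at_modulus s" for p
  proof -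
    have p: "F p = \<alpha>" "ln (norm p) = s" using that by (auto simp: at_modulus_def)
    obtain \<sigma>' \<tau>' where *: "\<sigma>' \<in> {1, - 1}" "\<tau>' \<in> {1, - 1}" "p = point \<sigma>' \<tau>' s"
      "Im \<alpha> = \<tau>' * (norm \<alpha> * sin (V s))"
      using F_eq_\<alpha>[OF p(1)] unfolding p(2) by metis
    have "\<tau>' = \<tau>" using *(4) R sc(2) \<alpha> by auto
    with * show ?thesis by auto
  qed
  moreover have "reflect (point 1 \<tau> s) = point (- 1) \<tau> s"
    by (subst reflect_point) (simp add: e(1))
  ultimately have "at_modulus s = {point 1 \<tau> s, reflect (point 1 \<tau> s)}" by auto
  then show thesis using that[of 1 \<tau>] \<tau> R Re sc by simp
qed

lemma point_on_axis:
  assumes "\<phi> s = a"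
  shows "reflect (point \<sigma> \<tau> s) = point \<sigma> \<tau> s"
proof -
  have "point (e * \<sigma>) (- e * \<tau>) s = point \<sigma> \<tau> s"
    using axis assms unfolding point_def by (elim disjE conjE) simp_all
  then show ?thesis by (simp add: reflect_point)
qed

lemma point_interior:
  assumes "0 < \<phi> s" "\<phi> s < pi / 2" "\<sigma> \<in> {1, - 1}" "\<tau> \<in> {1, - 1}"
  shows "Re (point \<sigma> \<tau> s) \<noteq> 0" "Im (point \<sigma> \<tau> s) \<noteq> 0"
  using assms cos_gt_zero[of "\<phi> s"] sin_gt_zero[of "\<phi> s"] by (auto simp: point_def)

lemma mult_on_axis:
  assumes V: "V s = a + of_int n * pi" and act: "active s" and s: "\<phi> s = a"
    and p: "p \<in> at_modulus s"
  shows "alpha_mult F \<alpha> p = (if left_end s \<and> right_end s then 2 else 1)"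
proof -
  have Fp: "F p = \<alpha>" "ln (norm p) = s" using p by (auto simp: at_modulus_def)
  obtain \<sigma> \<tau> where *: "\<sigma> \<in> {1, - 1}" "\<tau> \<in> {1, - 1}" "p = point \<sigma> \<tau> s"
    using F_eq_\<alpha>[OF Fp(1)] unfolding Fp(2) by metis
  have "(point \<sigma> \<tau> s)\<^sup>2 = of_real (e * exp (2 * s))"
    using axis *(1,2) s unfolding point_def
    by (elim disjE conjE insertE emptyE) (simp_all add: complex_eq_iff power2_eq_square mult_exp_exp)
  then have p2: "p\<^sup>2 = exp (2 * Complex s a)" "p\<^sup>2 = of_real (e * exp (2 * s))"
    using *(3) exp_axis[of s] by auto
  have reg: "E (p\<^sup>2) \<noteq> 0" "D (p\<^sup>2) \<noteq> 0" "Im (p\<^sup>2) = 0"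
    using on_axis_regular[OF s] unfolding p2(2) by (auto simp: regular_def)
  have r: "r p = r (exp (Complex s a))" using p2(1) by (simp add: r_def exp_double)
  have "Im (r p) = 0" using Im_q_real[OF reg(3,1,2)] by (simp add: r_def)
  then have "r p = 0 \<longleftrightarrow> U' s = 0"
    unfolding U'_def r[symmetric] by (simp add: complex_eq_iff)
  then have r0: "r p = 0 \<longleftrightarrow> left_end s \<and> right_end s" using U'_eq_0_iff[OF V s act] by simp
  show ?thesis
  proof (cases "r p = 0")
    case True
    have "deriv q (p\<^sup>2) \<noteq> 0" using Re_deriv_q_pos[OF reg(3,1,2)] by auto
    then show ?thesis using alpha_mult_double[OF Fp(1) \<alpha> True] r0 True by simp
  next
    case False
    then show ?thesis using alpha_mult_simple[OF Fp(1) \<alpha> False] r0 by auto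
  qed
qed

lemma sum_mult_at_modulus:
  assumes V: "V s = a + of_int n * pi" and act: "active s"
  shows "finite (at_modulus s)"
    "(\<Sum>p\<in>at_modulus s. alpha_mult F \<alpha> p) = of_bool (left_end s) + of_bool (right_end s)"
proof -
  obtain \<sigma> \<tau> where *: "\<sigma> \<in> {1, - 1}" "\<tau> \<in> {1, - 1}" "at_modulus s = {point \<sigma> \<tau> s, reflect (point \<sigma> \<tau> s)}"
    using at_modulus_eq[OF V act] by metis
  show "finite (at_modulus s)" using *(3) by simp
  show "(\<Sum>p\<in>at_modulus s. alpha_mult F \<alpha> p) = of_bool (left_end s) + of_bool (right_end s)"
  proof (cases "\<phi> s = a")
    case True
    then have eq: "at_modulus s = {point \<sigma> \<tau> s}" using * point_on_axis by simp
    then show ?thesis using mult_on_axis[OF V act True, of "point \<sigma> \<tau> s"] active_imp_end[OF V act] by auto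
  next
    case False
    then have int: "0 < \<phi> s" "\<phi> s < pi / 2" using axis_or_interior[OF V] by auto
    have nz: "Re p \<noteq> 0 \<and> Im p \<noteq> 0" if "p \<in> at_modulus s" for p
      using that point_interior[OF int *(1,2)] unfolding *(3) by auto
    have m: "alpha_mult F \<alpha> p = 1" if "p \<in> at_modulus s" for p
      using that nz by (intro mult_off_axes) (auto simp: at_modulus_def)
    have "e \<noteq> 1 \<or> - e \<noteq> 1" by linarith
    then have "point \<sigma> \<tau> s \<noteq> reflect (point \<sigma> \<tau> s)"
      using point_interior[OF int *(1,2)] unfolding complex_eq_iff reflect_sel by auto
    then show ?thesis using m interior_left_right_end[OF int] unfolding *(3) by simp
  qed
qed

lemma card_ends:
  "finite {s. V s = v \<and> left_end s}" "finite {s. V s = v \<and> right_end s}"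
  "card {s. V s = v \<and> left_end s} \<le> 1" "card {s. V s = v \<and> right_end s} \<le> 1"
proof -
  have "\<exists>l. {s. V s = v \<and> left_end s} \<subseteq> {l}" "\<exists>l. {s. V s = v \<and> right_end s} \<subseteq> {l}"
    using left_end_unique right_end_unique by blast+
  then obtain l r where lr: "{s. V s = v \<and> left_end s} \<subseteq> {l}" "{s. V s = v \<and> right_end s} \<subseteq> {r}" by blast
  show "finite {s. V s = v \<and> left_end s}" "finite {s. V s = v \<and> right_end s}"
    using lr by (auto intro: finite_subset)
  show "card {s. V s = v \<and> left_end s} \<le> 1" "card {s. V s = v \<and> right_end s} \<le> 1"
    using card_mono[OF _ lr(1)] card_mono[OF _ lr(2)] by simp_all
qed

lemma card_level:
  assumes v: "v = a + of_int n * pi"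
  shows "finite {n \<in> idx \<omega>. V (x n) = v}"
    "card {n \<in> idx \<omega>. V (x n) = v} = card {s. V s = v \<and> left_end s} + card {s. V s = v \<and> right_end s}"
proof -
  let ?L = "{s. V s = v \<and> left_end s}" and ?R = "{s. V s = v \<and> right_end s}"
  have fin: "finite ?L" "finite ?R" by (rule card_ends)+
  have act: "active s" if "s \<in> ?L \<union> ?R" for s using that end_imp_active[of s n] v by auto
  have N: "finite {n \<in> idx \<omega>. x n = s}" "card {n \<in> idx \<omega>. x n = s} = of_bool (left_end s) + of_bool (right_end s)"
    if "s \<in> ?L \<union> ?R" for s
  proof -
    have Vs: "V s = a + of_int n * pi" using that v by auto
    note * = sum_mult_at_modulus[OF Vs act[OF that]]
    show "finite {n \<in> idx \<omega>. x n = s}" "card {n \<in> idx \<omega>. x n = s} = of_bool (left_end s) + of_bool (right_end s)"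
      using card_modulus[OF *(1)] *(2) by simp_all
  qed
  have eq: "{n \<in> idx \<omega>. V (x n) = v} = (\<Union>s\<in>?L \<union> ?R. {n \<in> idx \<omega>. x n = s})"
  proof -
    have "left_end (x i) \<or> right_end (x i)" if "i \<in> idx \<omega>" "V (x i) = v" for i
    proof -
      have "active (x i)" using F_eq_\<alpha>[OF F_z[OF that(1)]] unfolding x_def by metis
      then show ?thesis using active_imp_end that v by blast
    qed
    then show ?thesis by auto
  qed
  show "finite {n \<in> idx \<omega>. V (x n) = v}" unfolding eq using N(1) fin by auto
  have "card {n \<in> idx \<omega>. V (x n) = v} = (\<Sum>s\<in>?L \<union> ?R. card {n \<in> idx \<omega>. x n = s})"
    unfolding eq using N(1) fin by (intro card_UN_disjoint) auto
  also have "\<dots> = (\<Sum>s\<in>?L \<union> ?R. of_bool (left_end s) + of_bool (right_end s))"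
    using N(2) by (intro sum.cong) auto
  also have "\<dots> = (\<Sum>s\<in>?L \<union> ?R. of_bool (s \<in> ?L)) + (\<Sum>s\<in>?L \<union> ?R. of_bool (s \<in> ?R))"
    unfolding sum.distrib by (intro arg_cong2[of _ _ _ _ "(+)"] sum.cong) auto
  also have "\<dots> = card ?L + card ?R"
    using fin by (simp add: of_bool_def sum.If_cases Int_absorb1 Collect_conj_eq)
  finally show "card {n \<in> idx \<omega>. V (x n) = v} = card ?L + card ?R" .
qed

end

lemma cos_add_int_pi: "cos (y + of_int n * pi) = (if even n then cos y else - cos y)"
  and sin_add_int_pi: "sin (y + of_int n * pi) = (if even n then sin y else - sin y)"
  using cos_npi_int[of n] sin_npi_int[of n] by (simp_all add: cos_add sin_add mult.commute)

lemma minus_one_powi: "(- 1 :: real) powi n = (if even n then 1 else - 1)"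
  by (simp add: power_int_minus_left)

context axis_alpha_points
begin

lemma alpha_signs:
  assumes "n \<in> idx \<omega>"
  obtains \<sigma> \<tau> where "\<sigma> \<in> {1, - 1}" "\<tau> \<in> {1, - 1}" "z n = point \<sigma> \<tau> (x n)"
    "Re \<alpha> = \<sigma> * (norm \<alpha> * cos (V (x n)))" "Im \<alpha> = \<tau> * (norm \<alpha> * sin (V (x n)))"
  using F_eq_\<alpha>[OF F_z[OF assms]] unfolding x_def by metis

lemma active_x: "n \<in> idx \<omega> \<Longrightarrow> active (x n)"
  using F_eq_\<alpha>[OF F_z] unfolding x_def by metis

lemma V_x: assumes "n \<in> idx \<omega>" obtains k :: int where "V (x n) = a + of_int k * pi"
  using V_level[OF F_z[OF assms]] unfolding x_def by blast

lemma point_off_other_axis: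
  assumes "F p = \<alpha>"
  shows "a = 0 \<Longrightarrow> Re p \<noteq> 0" "a \<noteq> 0 \<Longrightarrow> Im p \<noteq> 0"
proof -
  obtain \<sigma> \<tau> where *: "\<sigma> \<in> {1, - 1}" "\<tau> \<in> {1, - 1}" "p = point \<sigma> \<tau> (ln (norm p))"
    using F_eq_\<alpha>[OF assms] by metis
  obtain n :: int where "V (ln (norm p)) = a + of_int n * pi" using V_level[OF assms] .
  then have ph: "\<phi> (ln (norm p)) = a \<or> 0 < \<phi> (ln (norm p)) \<and> \<phi> (ln (norm p)) < pi / 2"
    by (rule axis_or_interior)
  have R: "Re p = \<sigma> * (exp (ln (norm p)) * cos (\<phi> (ln (norm p))))" "Im p = \<tau> * (exp (ln (norm p)) * sin (\<phi> (ln (norm p))))"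
    using arg_cong[OF *(3), of Re] arg_cong[OF *(3), of Im] unfolding point_def complex.sel by auto
  define t where "t = \<phi> (ln (norm p))"
  show "Re p \<noteq> 0" if "a = 0"
  proof -
    have "cos t > 0" using ph that cos_gt_zero[of t] unfolding t_def by auto
    then show ?thesis unfolding R(1) t_def[symmetric] using *(1) by auto
  qed
  show "Im p \<noteq> 0" if "a \<noteq> 0"
  proof -
    have "a = pi / 2" using axis that by blast
    then have "0 < t" "t < pi" using ph unfolding t_def[symmetric] by auto
    then have "sin t > 0" by (rule sin_gt_zero)
    then show ?thesis unfolding R(2) t_def[symmetric] using *(2) by auto
  qed
qed

lemma mult_cases:
  assumes "F p = \<alpha>"
  shows "alpha_mult F \<alpha> p \<in> {1, 2}" "reflect p \<noteq> p \<Longrightarrow> alpha_mult F \<alpha> p = 1"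
proof -
  obtain n :: int where V: "V (ln (norm p)) = a + of_int n * pi" using V_level[OF assms] .
  obtain \<sigma> \<tau> where *: "active (ln (norm p))" "p = point \<sigma> \<tau> (ln (norm p))" "\<sigma> \<in> {1, - 1}" "\<tau> \<in> {1, - 1}"
    using F_eq_\<alpha>[OF assms] by metis
  have interior: "alpha_mult F \<alpha> p = 1" if "\<phi> (ln (norm p)) \<noteq> a"
  proof -
    have "0 < \<phi> (ln (norm p))" "\<phi> (ln (norm p)) < pi / 2" using axis_or_interior[OF V] that by blast+
    from point_interior[OF this *(3,4)] show ?thesis unfolding *(2)[symmetric] by (intro mult_off_axes assms)
  qed
  have "p \<in> at_modulus (ln (norm p))" using assms by (simp add: at_modulus_def)
  then show "alpha_mult F \<alpha> p \<in> {1, 2}"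
    using mult_on_axis[OF V *(1)] interior by (cases "\<phi> (ln (norm p)) = a") auto
  show "alpha_mult F \<alpha> p = 1" if "reflect p \<noteq> p"
  proof (rule interior)
    show "\<phi> (ln (norm p)) \<noteq> a"
    proof
      assume "\<phi> (ln (norm p)) = a"
      from point_on_axis[OF this, of \<sigma> \<tau>] show False using that unfolding *(2)[symmetric] by blast
    qed
  qed
qed

lemma reflect_reflect [simp]: "reflect (reflect p) = p"
  by (simp add: complex_eq_iff)

lemma same_modulus:
  assumes i: "i \<in> idx \<omega>" and n: "n \<in> idx \<omega>" and "i \<noteq> n" "norm (z i) = norm (z n)"
  shows "z i = reflect (z n)"
proof -
  obtain k :: int where V: "V (x n) = a + of_int k * pi" using V_x[OF n] .
  have "x i = x n" using assms(4) by (simp add: x_def)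
  then have zs: "z i \<in> at_modulus (x n)" "z n \<in> at_modulus (x n)" using z_at_modulus i n by metis+
  obtain \<sigma> \<tau> where at: "at_modulus (x n) = {point \<sigma> \<tau> (x n), reflect (point \<sigma> \<tau> (x n))}"
    using at_modulus_eq[OF V active_x[OF n]] by metis
  show ?thesis
  proof (cases "reflect (z n) = z n")
    case True
    then show ?thesis using zs unfolding at by auto
  next
    case False
    then have "alpha_mult F \<alpha> (z n) = 1" by (rule mult_cases(2)[OF F_z[OF n]])
    then have "z i \<noteq> z n" using simple_imp_distinct i n \<open>i \<noteq> n\<close> by blast
    then show ?thesis using zs unfolding at by auto
  qed
qed

lemma same_level:
  assumes i: "i \<in> idx \<omega>" and n: "n \<in> idx \<omega>" and V: "V (x i) = V (x n)" and lt: "norm (z i) < norm (z n)"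
  shows "\<phi> (x i) = a" "\<phi> (x n) = a" "Arg (z i) = Arg (z n)"
    "a = 0 \<Longrightarrow> Arg (z n) \<in> {0, pi}" "a \<noteq> 0 \<Longrightarrow> Arg (z n) \<in> {- pi / 2, pi / 2}"
proof -
  obtain k :: int where Vk: "V (x i) = a + of_int k * pi" using V_x[OF i] .
  have "x i < x n" using lt i n by (simp add: norm_z)
  note seg = axis_on_level_segment(1)[OF Vk V[symmetric] this]
  show ph: "\<phi> (x i) = a" "\<phi> (x n) = a" using \<open>x i < x n\<close> by (auto intro: seg)
  obtain \<sigma> \<tau> where 1: "\<sigma> \<in> {1, - 1}" "\<tau> \<in> {1, - 1}" "z n = point \<sigma> \<tau> (x n)"
    "Re \<alpha> = \<sigma> * (norm \<alpha> * cos (V (x n)))" "Im \<alpha> = \<tau> * (norm \<alpha> * sin (V (x n)))"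
    using alpha_signs[OF n] .
  obtain \<sigma>' \<tau>' where 2: "\<sigma>' \<in> {1, - 1}" "\<tau>' \<in> {1, - 1}" "z i = point \<sigma>' \<tau>' (x i)"
    "Re \<alpha> = \<sigma>' * (norm \<alpha> * cos (V (x n)))" "Im \<alpha> = \<tau>' * (norm \<alpha> * sin (V (x n)))"
    using alpha_signs[OF i] unfolding V .
  have "Arg (z i) = Arg (z n) \<and> (a = 0 \<longrightarrow> Arg (z n) \<in> {0, pi}) \<and> (a \<noteq> 0 \<longrightarrow> Arg (z n) \<in> {- pi / 2, pi / 2})"
  proof (cases "a = 0")
    case True
    then have "Re \<alpha> \<noteq> 0" using \<alpha>_axis(1) \<alpha> by (auto simp: complex_eq_iff)
    then have "\<sigma> = \<sigma>'" using 1(4) 2(4) by auto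
    moreover have "z n = of_real (\<sigma> * exp (x n))" "z i = of_real (\<sigma>' * exp (x i))"
      unfolding 1(3) 2(3) point_def ph unfolding True by (simp_all add: complex_eq_iff)
    ultimately show ?thesis using 1(1) True by auto
  next
    case False
    then have a: "a = pi / 2" using axis by blast
    have "Im \<alpha> \<noteq> 0" using \<alpha>_axis(2)[OF False] \<alpha> by (auto simp: complex_eq_iff)
    then have "\<tau> = \<tau>'" using 1(5) 2(5) by auto
    moreover have "z n = of_real (exp (x n)) * (of_real \<tau> * \<i>)" "z i = of_real (exp (x i)) * (of_real \<tau>' * \<i>)"
      unfolding 1(3) 2(3) point_def ph unfolding a by (simp_all add: complex_eq_iff)
    ultimately show ?thesis using 1(2) False by auto
  qed
  then show "Arg (z i) = Arg (z n)"
    "a = 0 \<Longrightarrow> Arg (z n) \<in> {0, pi}" "a \<noteq> 0 \<Longrightarrow> Arg (z n) \<in> {- pi / 2, pi / 2}" by blast+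
qed

lemma cos_nonneg_\<phi>: "cos (\<phi> s) \<ge> 0" "sin (\<phi> s) \<ge> 0"
  using \<phi>(1,2)[of s] by (auto intro!: cos_ge_zero sin_ge_zero)

lemma Re_sign:
  assumes n: "n \<in> idx \<omega>" and "a = 0"
  shows "Re \<alpha> * cos (V (x n)) * Re (z n) > 0"
proof -
  obtain \<sigma> \<tau> where 1: "\<sigma> \<in> {1, - 1}" "z n = point \<sigma> \<tau> (x n)" "Re \<alpha> = \<sigma> * (norm \<alpha> * cos (V (x n)))"
    using alpha_signs[OF n] by metis
  have "Re \<alpha> * cos (V (x n)) * Re (z n) = norm \<alpha> * (cos (V (x n)))\<^sup>2 * (exp (x n) * cos (\<phi> (x n))) * (\<sigma> * \<sigma>)"
    unfolding 1(3) by (simp add: 1(2) point_def power2_eq_square)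
  also have "\<sigma> * \<sigma> = 1" using 1(1) by auto
  finally have eq: "Re \<alpha> * cos (V (x n)) * Re (z n) = norm \<alpha> * (cos (V (x n)))\<^sup>2 * (exp (x n) * cos (\<phi> (x n)))" by simp
  have "Re \<alpha> \<noteq> 0" using \<alpha>_axis(1)[OF assms(2)] \<alpha> by (auto simp: complex_eq_iff)
  then have "cos (V (x n)) \<noteq> 0" using 1(3) by auto
  then have "Re \<alpha> * cos (V (x n)) * Re (z n) \<noteq> 0"
    using point_off_other_axis(1)[OF F_z[OF n] assms(2)] \<open>Re \<alpha> \<noteq> 0\<close> by simp
  moreover have "Re \<alpha> * cos (V (x n)) * Re (z n) \<ge> 0" unfolding eq using cos_nonneg_\<phi> by simp
  ultimately show ?thesis by linarith
qed

lemma Im_sign: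
  assumes n: "n \<in> idx \<omega>" and "a \<noteq> 0"
  shows "Im \<alpha> * sin (V (x n)) * Im (z n) > 0"
proof -
  obtain \<sigma> \<tau> where 1: "\<tau> \<in> {1, - 1}" "z n = point \<sigma> \<tau> (x n)" "Im \<alpha> = \<tau> * (norm \<alpha> * sin (V (x n)))"
    using alpha_signs[OF n] by metis
  have "Im \<alpha> * sin (V (x n)) * Im (z n) = norm \<alpha> * (sin (V (x n)))\<^sup>2 * (exp (x n) * sin (\<phi> (x n))) * (\<tau> * \<tau>)"
    unfolding 1(3) by (simp add: 1(2) point_def power2_eq_square)
  also have "\<tau> * \<tau> = 1" using 1(1) by auto
  finally have eq: "Im \<alpha> * sin (V (x n)) * Im (z n) = norm \<alpha> * (sin (V (x n)))\<^sup>2 * (exp (x n) * sin (\<phi> (x n)))" by simp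
  have "Im \<alpha> \<noteq> 0" using \<alpha>_axis(2)[OF assms(2)] \<alpha> by (auto simp: complex_eq_iff)
  then have "sin (V (x n)) \<noteq> 0" using 1(3) by auto
  then have "Im \<alpha> * sin (V (x n)) * Im (z n) \<noteq> 0"
    using point_off_other_axis(2)[OF F_z[OF n] assms(2)] \<open>Im \<alpha> \<noteq> 0\<close> by simp
  moreover have "Im \<alpha> * sin (V (x n)) * Im (z n) \<ge> 0" unfolding eq using cos_nonneg_\<phi> by simp
  ultimately show ?thesis by linarith
qed

definition lev :: "nat \<Rightarrow> real" where
  "lev k = a + of_int ((if a = 0 then j + 1 else j) + int k) * pi"

lemma strict_mono_lev: "strict_mono lev"
  by (rule strict_monoI) (simp add: lev_def)

lemma lev_eq:
  "a = 0 \<Longrightarrow> lev k = of_int (2 * j + 1) * (pi / 2) + (of_nat k + 1 / 2) * pi"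
  "a \<noteq> 0 \<Longrightarrow> lev k = of_int (2 * j + 1) * (pi / 2) + of_nat k * pi"
proof -
  show "lev k = of_int (2 * j + 1) * (pi / 2) + (of_nat k + 1 / 2) * pi" if "a = 0"
    unfolding lev_def using that by (simp add: algebra_simps)
  show "lev k = of_int (2 * j + 1) * (pi / 2) + of_nat k * pi" if "a \<noteq> 0"
  proof -
    have "a = pi / 2" using that axis by blast
    then show ?thesis using that unfolding lev_def by (simp add: algebra_simps)
  qed
qed

lemma initial_le_lev: "of_int (2 * j + 1) * (pi / 2) \<le> lev k"
  "a = 0 \<or> k > 0 \<Longrightarrow> of_int (2 * j + 1) * (pi / 2) < lev k"
proof -
  have "of_int (2 * j + 1) * (pi / 2) \<le> lev k \<and> (a = 0 \<or> k > 0 \<longrightarrow> of_int (2 * j + 1) * (pi / 2) < lev k)"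
  proof (cases "a = 0")
    case True
    have "(of_nat k + 1 / 2) * pi > 0" by simp
    then show ?thesis using lev_eq(1)[OF True, of k] by linarith
  next
    case False
    have "of_nat k * pi \<ge> 0" "k > 0 \<longrightarrow> of_nat k * pi > 0" by simp_all
    then show ?thesis using lev_eq(2)[OF False, of k] False by linarith
  qed
  then show "of_int (2 * j + 1) * (pi / 2) \<le> lev k"
    "a = 0 \<or> k > 0 \<Longrightarrow> of_int (2 * j + 1) * (pi / 2) < lev k" by blast+
qed

lemma V_x_lev: assumes n: "n \<in> idx \<omega>" shows "\<exists>k. V (x n) = lev k"
proof -
  define j0 where "j0 = (if a = 0 then j + 1 else j)"
  obtain k :: int where k: "V (x n) = a + of_int k * pi" using V_x[OF n] .
  have "of_int j0 * pi - pi < of_int k * pi"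
  proof -
    have J: "of_int (2 * j + 1) * (pi / 2) = of_int j * pi + pi / 2" "of_int (j + 1) * pi = of_int j * pi + pi"
      by (simp_all add: algebra_simps)
    have "of_int j * pi + pi / 2 \<le> a + of_int k * pi" using V_ge[of "x n"] unfolding k J .
    moreover have "of_int j0 * pi = of_int j * pi + pi \<and> a = 0 \<or> of_int j0 * pi = of_int j * pi \<and> a = pi / 2"
      using axis J(2) by (cases "a = 0") (simp_all add: j0_def)
    ultimately show ?thesis using pi_gt_zero by (elim disjE conjE) linarith+
  qed
  then have "of_int (j0 - 1) * pi < of_int k * pi" by (simp add: algebra_simps)
  then have "j0 - 1 < k" by (simp only: mult_less_cancel_right_pos[OF pi_gt_zero] of_int_less_iff)
  then have "V (x n) = lev (nat (k - j0))" unfolding k lev_def j0_def[symmetric] by simp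
  then show ?thesis by blast
qed

lemma card_lev:
  "finite {n \<in> idx \<omega>. V (x n) = lev k}"
  "card {n \<in> idx \<omega>. V (x n) = lev k} = card {s. V s = lev k \<and> left_end s} + card {s. V s = lev k \<and> right_end s}"
  using card_level[OF lev_def] by simp_all

lemma card_ends_eq:
  assumes "lev k < V s"
  shows "card {s. V s = lev k \<and> right_end s} = 1"
    "a = 0 \<or> k > 0 \<Longrightarrow> card {s. V s = lev k \<and> left_end s} = 1"
proof -
  obtain t where t: "V t = of_int (2 * j + 1) * (pi / 2)" using V_initial by blast
  have "V t \<le> lev k" unfolding t by (rule initial_le_lev)
  from right_end_exists[OF this assms] have "{s. V s = lev k \<and> right_end s} \<noteq> {}" by blast
  then have "card {s. V s = lev k \<and> right_end s} > 0" using card_ends by (simp add: card_gt_0_iff)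
  then show "card {s. V s = lev k \<and> right_end s} = 1" using card_ends(4)[of "lev k"] by linarith
  assume "a = 0 \<or> k > 0"
  then have "V t < lev k" unfolding t by (rule initial_le_lev)
  from left_end_exists[OF this, of s] have "{s. V s = lev k \<and> left_end s} \<noteq> {}" using assms by force
  then have "card {s. V s = lev k \<and> left_end s} > 0" using card_ends by (simp add: card_gt_0_iff)
  then show "card {s. V s = lev k \<and> left_end s} = 1" using card_ends(3)[of "lev k"] by linarith
qed

lemma no_left_end_on_initial_level: "a \<noteq> 0 \<Longrightarrow> card {s. V s = lev 0 \<and> left_end s} = 0"
proof -
  assume a: "a \<noteq> 0"
  have False if "V s = lev 0" "left_end s" for s
  proof -
    have "V (s - 1) < V s" using that(2) by (simp add: left_end_def)
    then show False using V_ge[of "s - 1"] lev_eq(2)[OF a, of 0] that(1) by simp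
  qed
  then have "{s. V s = lev 0 \<and> left_end s} = {}" by blast
  then show ?thesis by (simp only: card.empty)
qed

lemma level_of_index_real:
  assumes a: "a = 0" and n: "n \<in> idx \<omega>"
  shows "V (x n) = lev ((n - 1) div 2)"
proof -
  obtain k where k: "V (x n) = lev k" "sum (\<lambda>_. 2) {..<k} < n" "n \<le> sum (\<lambda>_. 2) {..k}"
  proof (rule level_of_index[OF strict_mono_lev V_x_lev card_lev(1) _ _ n])
    fix k
    show "card {n \<in> idx \<omega>. V (x n) = lev k} \<le> 2"
      using card_ends(3,4)[of "lev k"] unfolding card_lev(2) by linarith
    show "card {n \<in> idx \<omega>. V (x n) = lev k} = 2" if "lev k < V s" for s
      using card_ends_eq[OF that] a unfolding card_lev(2) by simp
  qed
  then have "k = (n - 1) div 2" by simp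
  with k(1) show ?thesis by simp
qed

lemma level_of_index_imaginary:
  assumes a: "a \<noteq> 0" and n: "n \<in> idx \<omega>"
  shows "V (x n) = lev (n div 2)"
proof -
  let ?m = "\<lambda>k::nat. if k = 0 then 1 else 2 :: nat"
  have sum: "sum ?m {..<k} = 2 * k - 1" for k
    by (induction k) auto
  obtain k where k: "V (x n) = lev k" "sum ?m {..<k} < n" "n \<le> sum ?m {..k}"
  proof (rule level_of_index[OF strict_mono_lev V_x_lev card_lev(1) _ _ n])
    fix k
    show "card {n \<in> idx \<omega>. V (x n) = lev k} \<le> ?m k"
      using card_ends(3,4)[of "lev k"] no_left_end_on_initial_level[OF a] unfolding card_lev(2)
      by (cases "k = 0") (simp_all del: card_eq_0_iff)
    show "card {n \<in> idx \<omega>. V (x n) = lev k} = ?m k" if "lev k < V s" for s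
      using card_ends_eq[OF that] no_left_end_on_initial_level[OF a] unfolding card_lev(2)
      by (cases "k = 0") (simp_all del: card_eq_0_iff)
  qed
  have "k = n div 2"
    using k(2,3) sum[of k] sum[of "Suc k"] by (simp add: lessThan_Suc_atMost)
  with k(1) show ?thesis by simp
qed

lemma norm_less_of_level: "i \<in> idx \<omega> \<Longrightarrow> n \<in> idx \<omega> \<Longrightarrow> V (x i) < V (x n) \<Longrightarrow> norm (z i) < norm (z n)"
  using V_mono[of "x n" "x i"] by (simp add: norm_z) (meson not_le)

lemma lev_Suc_trig: "cos (lev (Suc k)) = - cos (lev k)" "sin (lev (Suc k)) = - sin (lev k)"
proof -
  have "lev (Suc k) = lev k + pi" by (simp add: lev_def algebra_simps)
  then show "cos (lev (Suc k)) = - cos (lev k)" "sin (lev (Suc k)) = - sin (lev k)" by simp_all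
qed

end

context enumerated_alpha_points
begin

lemma real_case:
  assumes "Im \<alpha> = 0"
  shows "(1 \<in> idx \<omega> \<longrightarrow> 0 < cmod (z 1))
      \<and> (\<forall>n\<ge>1. 2 * n \<in> idx \<omega> \<longrightarrow> cmod (z (2 * n - 1)) \<le> cmod (z (2 * n)))
      \<and> (\<forall>n\<ge>1. 2 * n + 1 \<in> idx \<omega> \<longrightarrow> cmod (z (2 * n)) < cmod (z (2 * n + 1)))
      \<and> (\<forall>p\<in>alpha_points F \<alpha>. Re p \<noteq> 0)
      \<and> (\<forall>p\<in>alpha_points F \<alpha>. Im p = 0 \<longrightarrow> alpha_mult F \<alpha> p \<in> {1, 2})
      \<and> (\<forall>p\<in>alpha_points F \<alpha>. Im p \<noteq> 0 \<longrightarrow> alpha_mult F \<alpha> p = 1)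
      \<and> (\<forall>n\<ge>1. 2 * n \<in> idx \<omega> \<longrightarrow> cmod (z (2 * n - 1)) = cmod (z (2 * n)) \<longrightarrow>
            z (2 * n - 1) = cnj (z (2 * n)))
      \<and> (\<forall>n\<ge>1. 2 * n \<in> idx \<omega> \<longrightarrow> cmod (z (2 * n - 1)) < cmod (z (2 * n)) \<longrightarrow>
            Arg (z (2 * n - 1)) = Arg (z (2 * n)) \<and> Arg (z (2 * n)) \<in> {0, pi})
      \<and> (\<forall>n\<ge>1. 2 * n + 1 \<in> idx \<omega> \<longrightarrow> Re (z (2 * n)) * Re (z (2 * n + 1)) < 0)
      \<and> (1 \<in> idx \<omega> \<longrightarrow> (-1) powi j * Re \<alpha> * Re (z 1) < 0)
      \<and> (2 \<in> idx \<omega> \<longrightarrow> cmod (z 1) < cmod (z 2) \<longrightarrow> j = -1)"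
proof -
  interpret axis_alpha_points j A c d \<alpha> \<omega> z 0 1
    by unfold_locales (use assms in auto)
  note ap = alpha_points_F[OF \<alpha>]
  have V: "V (x n) = lev ((n - 1) div 2)" if "n \<in> idx \<omega>" for n
    using level_of_index_real[OF refl that] .
  have reflect_eq: "reflect p = cnj p" for p by (simp add: reflect_def)
  have odd: "2 * n - 1 \<in> idx \<omega>" if "n \<ge> 1" "2 * n \<in> idx \<omega>" for n
    using that by (intro idx_downward[OF that(2)]) auto
  have even: "2 * n \<in> idx \<omega>" if "n \<ge> 1" "2 * n + 1 \<in> idx \<omega>" for n
    using that by (intro idx_downward[OF that(2)]) auto
  have Vodd: "V (x (2 * n - 1)) = V (x (2 * n))" if "n \<ge> 1" "2 * n \<in> idx \<omega>" for n
  proof -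
    have "(2 * n - 1 - 1) div 2 = (2 * n - 1) div 2" using that(1) by (cases n) simp_all
    then show ?thesis using V[OF that(2)] V[OF odd[OF that]] by simp
  qed
  have Veven: "V (x (2 * n)) = lev (n - 1)" "V (x (2 * n + 1)) = lev n" if "n \<ge> 1" "2 * n + 1 \<in> idx \<omega>" for n
  proof -
    have "(2 * n - 1) div 2 = n - 1" "(2 * n + 1 - 1) div 2 = n" using that(1) by (cases n; simp)+
    then show "V (x (2 * n)) = lev (n - 1)" "V (x (2 * n + 1)) = lev n"
      using V[OF that(2)] V[OF even[OF that]] by simp_all
  qed
  have Re_neg: "Re (z (2 * n)) * Re (z (2 * n + 1)) < 0" if n: "n \<ge> 1" "2 * n + 1 \<in> idx \<omega>" for n
  proof -
    have "lev n = lev (Suc (n - 1))" using n by simp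
    then have "cos (V (x (2 * n + 1))) = - cos (V (x (2 * n)))" unfolding Veven[OF n] by (simp only: lev_Suc_trig)
    then have "Re \<alpha> * cos (V (x (2 * n))) * Re (z (2 * n)) > 0" "Re \<alpha> * cos (V (x (2 * n))) * Re (z (2 * n + 1)) < 0"
      using Re_sign[OF even[OF n] refl] Re_sign[OF n(2) refl] by simp_all
    then show ?thesis by (metis mult_less_0_iff zero_less_mult_iff order_less_asym)
  qed
  have first: "(-1) powi j * Re \<alpha> * Re (z 1) < 0" if "1 \<in> idx \<omega>"
  proof -
    have "V (x 1) = 0 + of_int (j + 1) * pi" using V[OF that] by (simp add: lev_def)
    then have "cos (V (x 1)) = - ((-1) powi j)" by (simp only: cos_add_int_pi minus_one_powi) simp
    then show ?thesis using Re_sign[OF that refl] by (simp add: algebra_simps)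
  qed
  have j1: "j = - 1" if "2 \<in> idx \<omega>" "cmod (z 1) < cmod (z 2)"
  proof -
    have 1: "1 \<in> idx \<omega>" using idx_downward[OF that(1), of 1] by simp
    have "V (x 1) = V (x 2)" using Vodd[of 1] that(1) by simp
    then have "\<phi> (x 1) = 0" using same_level(1) 1 that by blast
    then obtain n :: int where n: "n \<ge> 0" "V (x 1) = of_int n * pi" using V_real_axis by blast
    have "V (x 1) = of_int (j + 1) * pi" using V[OF 1] by (simp add: lev_def)
    then have "of_int (j + 1) * pi = of_int n * pi" using n by simp
    then have "j + 1 = n" by (simp only: mult_cancel_right of_int_eq_iff pi_neq_zero simp_thms)
    then show ?thesis using n j by simp
  qed
  show ?thesis

  proof (intro conjI allI ballI impI)
    fix n :: nat assume n: "n \<ge> 1" "2 * n \<in> idx \<omega>"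
    show "cmod (z (2 * n - 1)) \<le> cmod (z (2 * n))" by (rule norm_z_mono[OF odd[OF n] n(2)]) simp
    have ne: "2 * n - 1 \<noteq> 2 * n" using n by simp
    show "z (2 * n - 1) = cnj (z (2 * n))" if "cmod (z (2 * n - 1)) = cmod (z (2 * n))"
      using same_modulus[OF odd[OF n] n(2) ne that] reflect_eq by simp
    show "Arg (z (2 * n - 1)) = Arg (z (2 * n))" "Arg (z (2 * n)) \<in> {0, pi}" if "cmod (z (2 * n - 1)) < cmod (z (2 * n))"
      using same_level(3,4)[OF odd[OF n] n(2) Vodd[OF n] that] by simp_all
  next
    fix n :: nat assume n: "n \<ge> 1" "2 * n + 1 \<in> idx \<omega>"
    have "V (x (2 * n)) < V (x (2 * n + 1))" unfolding Veven[OF n] using n by (intro strict_monoD[OF strict_mono_lev]) simp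
    then show "cmod (z (2 * n)) < cmod (z (2 * n + 1))" by (rule norm_less_of_level[OF even[OF n] n(2)])
    show "Re (z (2 * n)) * Re (z (2 * n + 1)) < 0" by (rule Re_neg[OF n])
  next
    fix p assume "p \<in> alpha_points F \<alpha>"
    then have p: "F p = \<alpha>" using ap by simp
    show "Re p \<noteq> 0" by (rule point_off_other_axis(1)[OF p refl])
    show "alpha_mult F \<alpha> p \<in> {1, 2}" by (rule mult_cases(1)[OF p])
    show "alpha_mult F \<alpha> p = 1" if "Im p \<noteq> 0"
      using that by (intro mult_cases(2)[OF p]) (simp add: reflect_eq complex_eq_iff)
  next
    show "0 < cmod (z 1)" if "1 \<in> idx \<omega>" using z_nonzero[OF that] by simp
  qed (rule first j1; assumption)+
qed

lemma imaginary_case: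
  assumes "Re \<alpha> = 0"
  shows "(1 \<in> idx \<omega> \<longrightarrow> 0 < cmod (z 1))
      \<and> (\<forall>n\<ge>1. 2 * n \<in> idx \<omega> \<longrightarrow> cmod (z (2 * n - 1)) < cmod (z (2 * n)))
      \<and> (\<forall>n\<ge>1. 2 * n + 1 \<in> idx \<omega> \<longrightarrow> cmod (z (2 * n)) \<le> cmod (z (2 * n + 1)))
      \<and> (\<forall>p\<in>alpha_points F \<alpha>. Im p \<noteq> 0)
      \<and> (\<forall>p\<in>alpha_points F \<alpha>. Re p = 0 \<longrightarrow> alpha_mult F \<alpha> p \<in> {1, 2})
      \<and> (\<forall>p\<in>alpha_points F \<alpha>. Re p \<noteq> 0 \<longrightarrow> alpha_mult F \<alpha> p = 1)
      \<and> (\<forall>n\<ge>1. 2 * n + 1 \<in> idx \<omega> \<longrightarrow> cmod (z (2 * n)) = cmod (z (2 * n + 1)) \<longrightarrow>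
            z (2 * n) = - cnj (z (2 * n + 1)))
      \<and> (\<forall>n\<ge>1. 2 * n + 1 \<in> idx \<omega> \<longrightarrow> cmod (z (2 * n)) < cmod (z (2 * n + 1)) \<longrightarrow>
            Arg (z (2 * n)) = Arg (z (2 * n + 1)) \<and> Arg (z (2 * n + 1)) \<in> {- pi / 2, pi / 2})
      \<and> (\<forall>n\<ge>1. 2 * n \<in> idx \<omega> \<longrightarrow> Im (z (2 * n - 1)) * Im (z (2 * n)) < 0)
      \<and> (1 \<in> idx \<omega> \<longrightarrow> (-1) powi j * Im \<alpha> * Im (z 1) > 0)
      \<and> (1 \<in> idx \<omega> \<longrightarrow> Re (z 1) = 0)"
proof -
  interpret axis_alpha_points j A c d \<alpha> \<omega> z "pi / 2" "- 1"
    by unfold_locales (use assms in auto)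
  note ap = alpha_points_F[OF \<alpha>]
  have ne0: "pi / 2 \<noteq> 0" by simp
  have V: "V (x n) = lev (n div 2)" if "n \<in> idx \<omega>" for n
    using level_of_index_imaginary[OF ne0 that] .
  have reflect_eq: "reflect p = - cnj p" for p by (simp add: reflect_def)
  have odd: "2 * n - 1 \<in> idx \<omega>" if "n \<ge> 1" "2 * n \<in> idx \<omega>" for n
    using that by (intro idx_downward[OF that(2)]) auto
  have even: "2 * n \<in> idx \<omega>" if "n \<ge> 1" "2 * n + 1 \<in> idx \<omega>" for n
    using that by (intro idx_downward[OF that(2)]) auto
  have Veven: "V (x (2 * n)) = V (x (2 * n + 1))" if "n \<ge> 1" "2 * n + 1 \<in> idx \<omega>" for n
    using V[OF that(2)] V[OF even[OF that]] by simp
  have Vodd: "V (x (2 * n - 1)) = lev (n - 1)" "V (x (2 * n)) = lev n" if "n \<ge> 1" "2 * n \<in> idx \<omega>" for n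
  proof -
    have "(2 * n - 1) div 2 = n - 1" "(2 * n) div 2 = n" using that(1) by (cases n; simp)+
    then show "V (x (2 * n - 1)) = lev (n - 1)" "V (x (2 * n)) = lev n"
      using V[OF that(2)] V[OF odd[OF that]] by simp_all
  qed
  have Im_neg: "Im (z (2 * n - 1)) * Im (z (2 * n)) < 0" if n: "n \<ge> 1" "2 * n \<in> idx \<omega>" for n
  proof -
    have "lev n = lev (Suc (n - 1))" using n by simp
    then have "sin (V (x (2 * n))) = - sin (V (x (2 * n - 1)))" unfolding Vodd[OF n] by (simp only: lev_Suc_trig)
    then have "Im \<alpha> * sin (V (x (2 * n - 1))) * Im (z (2 * n - 1)) > 0" "Im \<alpha> * sin (V (x (2 * n - 1))) * Im (z (2 * n)) < 0"
      using Im_sign[OF odd[OF n] ne0] Im_sign[OF n(2) ne0] by simp_all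
    then show ?thesis by (metis mult_less_0_iff zero_less_mult_iff order_less_asym)
  qed
  have first: "(-1) powi j * Im \<alpha> * Im (z 1) > 0" if "1 \<in> idx \<omega>"
  proof -
    have "V (x 1) = pi / 2 + of_int j * pi" using V[OF that] by (simp add: lev_def)
    then have "sin (V (x 1)) = (-1) powi j" by (simp only: sin_add_int_pi minus_one_powi sin_pi_half)
    then show ?thesis using Im_sign[OF that ne0] by (simp add: mult_ac)
  qed
  have Re0: "Re (z 1) = 0" if 1: "1 \<in> idx \<omega>"
  proof -
    have V1: "V (x 1) = of_int (2 * j + 1) * (pi / 2)" using V[OF 1] lev_eq(2)[OF ne0, of 0] by simp
    have "\<not> (0 < \<phi> (x 1) \<and> \<phi> (x 1) < pi / 2)"
      using V_strict_mono[of "x 1 - 1" "x 1"] V_ge[of "x 1 - 1"] V1 by auto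
    moreover obtain k :: int where "V (x 1) = pi / 2 + of_int k * pi" using V_x[OF 1] .
    ultimately have ph: "\<phi> (x 1) = pi / 2" using axis_or_interior by blast
    obtain \<sigma> \<tau> where "z 1 = point \<sigma> \<tau> (x 1)" using alpha_signs[OF 1] by metis
    then show ?thesis unfolding point_def ph by simp
  qed
  show ?thesis
  proof (intro conjI allI ballI impI)
    fix n :: nat assume n: "n \<ge> 1" "2 * n + 1 \<in> idx \<omega>"
    show "cmod (z (2 * n)) \<le> cmod (z (2 * n + 1))" by (rule norm_z_mono[OF even[OF n] n(2)]) simp
    have ne: "2 * n \<noteq> 2 * n + 1" by simp
    show "z (2 * n) = - cnj (z (2 * n + 1))" if "cmod (z (2 * n)) = cmod (z (2 * n + 1))"
      using same_modulus[OF even[OF n] n(2) ne that] reflect_eq by simp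
    show "Arg (z (2 * n)) = Arg (z (2 * n + 1))" "Arg (z (2 * n + 1)) \<in> {- pi / 2, pi / 2}" if "cmod (z (2 * n)) < cmod (z (2 * n + 1))"
      using same_level(3)[OF even[OF n] n(2) Veven[OF n] that] same_level(5)[OF even[OF n] n(2) Veven[OF n] that ne0] by auto
  next
    fix n :: nat assume n: "n \<ge> 1" "2 * n \<in> idx \<omega>"
    have "V (x (2 * n - 1)) < V (x (2 * n))" unfolding Vodd[OF n] using n by (intro strict_monoD[OF strict_mono_lev]) simp
    then show "cmod (z (2 * n - 1)) < cmod (z (2 * n))" by (rule norm_less_of_level[OF odd[OF n] n(2)])
    show "Im (z (2 * n - 1)) * Im (z (2 * n)) < 0" by (rule Im_neg[OF n])
  next
    fix p assume "p \<in> alpha_points F \<alpha>"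
    then have p: "F p = \<alpha>" using ap by simp
    show "Im p \<noteq> 0" by (rule point_off_other_axis(2)[OF p ne0])
    show "alpha_mult F \<alpha> p \<in> {1, 2}" by (rule mult_cases(1)[OF p])
    show "alpha_mult F \<alpha> p = 1" if "Re p \<noteq> 0"
      using that by (intro mult_cases(2)[OF p]) (simp add: reflect_eq complex_eq_iff)
  next
    show "0 < cmod (z 1)" if "1 \<in> idx \<omega>" using z_nonzero[OF that] by simp
  qed (rule first Re0; assumption)+
qed

end

lemma quadrant_iff: "z \<in> quadrant l \<longleftrightarrow> Re (z * \<i> powi (- l)) > 0 \<and> Im (z * \<i> powi (- l)) > 0"
proof -
  let ?w = "z * \<i> powi (- l)"
  have "0 < Arg ?w \<and> Arg ?w < pi / 2 \<longleftrightarrow> Re ?w > 0 \<and> Im ?w > 0"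
  proof
    assume A: "0 < Arg ?w \<and> Arg ?w < pi / 2"
    have "?w \<noteq> 0" using A by (auto simp: Arg_zero)
    have "Arg ?w < pi" using A pi_gt_zero by linarith
    then have "Im ?w > 0" using A Arg_lt_pi[of ?w] by blast
    moreover have "Re ?w > 0" using A Arg_Re_pos[of ?w] \<open>?w \<noteq> 0\<close> by auto
    ultimately show "Re ?w > 0 \<and> Im ?w > 0" by blast
  next
    assume P: "Re ?w > 0 \<and> Im ?w > 0"
    then show "0 < Arg ?w \<and> Arg ?w < pi / 2"
      using Arg_lt_pi[of ?w] Arg_Re_pos[of ?w] by auto
  qed
  moreover have "Re ?w > 0 \<Longrightarrow> z \<noteq> 0" by auto
  ultimately show ?thesis by (auto simp: quadrant_def)
qed

lemma quadrant_step:
  assumes z: "z \<in> quadrant l" and S: "S \<noteq> 0"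
    and pos: "Re z * Im z * S > 0 \<Longrightarrow> Re z * Re w < 0 \<and> Im z * Im w > 0"
    and neg: "Re z * Im z * S < 0 \<Longrightarrow> Re z * Re w > 0 \<and> Im z * Im w < 0"
  shows "w \<in> quadrant (l + \<lfloor>sgn S\<rfloor>)"
proof -
  define u where "u = \<i> powi (- l)"
  have u: "u \<in> {1, - 1, \<i>, - \<i>}"
  proof -
    have "u * u = (\<i> * \<i>) powi (- l)" by (simp only: u_def power_int_mult_distrib)
    also have "\<dots> = 1 \<or> \<dots> = - 1" by (simp add: power_int_minus_left)
    finally have "(u - 1) * (u + 1) = 0 \<or> (u - \<i>) * (u + \<i>) = 0"
      by (auto simp: algebra_simps)
    then show ?thesis by (auto simp: eq_neg_iff_add_eq_0)
  qed
  have z': "Re (z * u) > 0" "Im (z * u) > 0" using z by (simp_all add: quadrant_iff u_def)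
  have plus: "\<i> powi (- (l + 1)) = u * (- \<i>)" and minus: "\<i> powi (- (l - 1)) = u * \<i>"
    by (simp_all add: u_def power_int_add power_int_diff power_int_minus divide_inverse mult.commute)
  consider "S > 0" | "S < 0" using S by linarith
  then show ?thesis
  proof cases
    case 1
    have "Re (w * (u * (- \<i>))) > 0 \<and> Im (w * (u * (- \<i>))) > 0"
      using u z' pos neg 1 by (auto simp: mult_less_0_iff zero_less_mult_iff)
    then have "w \<in> quadrant (l + 1)" unfolding quadrant_iff plus .
    then show ?thesis using 1 by simp
  next
    case 2
    have "Re (w * (u * \<i>)) > 0 \<and> Im (w * (u * \<i>)) > 0"
      using u z' pos neg 2 by (auto simp: mult_less_0_iff zero_less_mult_iff)
    then have "w \<in> quadrant (l - 1)" unfolding quadrant_iff minus .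
    moreover have "sgn S = of_int (- 1)" using 2 by simp
    then have "\<lfloor>sgn S\<rfloor> = - 1" by (simp only: floor_of_int)
    ultimately show ?thesis by simp
  qed
qed

locale off_axis_alpha_points = enumerated_alpha_points +
  assumes off: "Re \<alpha> \<noteq> 0" "Im \<alpha> \<noteq> 0"
begin

definition \<theta> :: real where "\<theta> = Arg (Complex \<bar>Re \<alpha>\<bar> \<bar>Im \<alpha>\<bar>)"

lemma \<theta>: "0 < \<theta>" "\<theta> < pi / 2"
  using Arg_lt_pi[of "Complex \<bar>Re \<alpha>\<bar> \<bar>Im \<alpha>\<bar>"] Arg_Re_pos[of "Complex \<bar>Re \<alpha>\<bar> \<bar>Im \<alpha>\<bar>"] off
  by (auto simp: \<theta>_def)

lemma trig_\<theta>_pos: "cos \<theta> > 0" "sin \<theta> > 0"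
proof -
  show "cos \<theta> > 0" using \<theta> by (intro cos_gt_zero_pi) linarith+
  show "sin \<theta> > 0" using \<theta> pi_gt_zero by (intro sin_gt_zero) linarith+
qed

lemma abs_\<alpha>: "\<bar>Re \<alpha>\<bar> = norm \<alpha> * cos \<theta>" "\<bar>Im \<alpha>\<bar> = norm \<alpha> * sin \<theta>"
proof -
  have "Complex \<bar>Re \<alpha>\<bar> \<bar>Im \<alpha>\<bar> = rcis (norm (Complex \<bar>Re \<alpha>\<bar> \<bar>Im \<alpha>\<bar>)) \<theta>"
    unfolding \<theta>_def by (rule rcis_cmod_Arg[symmetric])
  moreover have "norm (Complex \<bar>Re \<alpha>\<bar> \<bar>Im \<alpha>\<bar>) = norm \<alpha>" by (simp add: cmod_def)
  ultimately show "\<bar>Re \<alpha>\<bar> = norm \<alpha> * cos \<theta>" "\<bar>Im \<alpha>\<bar> = norm \<alpha> * sin \<theta>"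
    by (simp_all add: complex_eq_iff)
qed

text \<open>The elements of \<open>\<plusminus>\<theta> + \<int> pi\<close> in increasing order; \<open>lev n\<close> lies between \<open>n pi / 2\<close> and \<open>(n + 1) pi / 2\<close>.\<close>

definition lev :: "int \<Rightarrow> real" where
  "lev n = (if even n then of_int n * (pi / 2) + \<theta> else of_int (n + 1) * (pi / 2) - \<theta>)"

lemma lev_bounds: "of_int n * (pi / 2) < lev n" "lev n < of_int (n + 1) * (pi / 2)"
proof -
  have "of_int (n + 1) * (pi / 2) = of_int n * (pi / 2) + pi / 2" by (simp add: algebra_simps)
  moreover have "lev n = of_int n * (pi / 2) + \<theta> \<or> lev n = of_int (n + 1) * (pi / 2) - \<theta>"
    unfolding lev_def by meson
  ultimately show "of_int n * (pi / 2) < lev n" "lev n < of_int (n + 1) * (pi / 2)"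
    using \<theta> by linarith+
qed

lemma lev_even: "lev (2 * m) = \<theta> + of_int m * pi" and lev_odd: "lev (2 * m + 1) = - \<theta> + of_int (m + 1) * pi"
  by (simp_all add: lev_def algebra_simps)

lemma lev_less: "m < n \<Longrightarrow> lev m < lev n"
proof -
  assume "m < n"
  then have "of_int (m + 1) * (pi / 2) \<le> of_int n * (pi / 2)" by (intro mult_right_mono) auto
  then show ?thesis using lev_bounds(2)[of m] lev_bounds(1)[of n] by linarith
qed

lemma lev_abs_trig: "\<bar>cos (lev n)\<bar> = cos \<theta>" "\<bar>sin (lev n)\<bar> = sin \<theta>"
proof -
  obtain m where "n = 2 * m \<or> n = 2 * m + 1" using evenE oddE by metis
  then show "\<bar>cos (lev n)\<bar> = cos \<theta>" "\<bar>sin (lev n)\<bar> = sin \<theta>"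
    unfolding lev_even lev_odd using trig_\<theta>_pos
    by (auto simp only: lev_even lev_odd cos_add_int_pi sin_add_int_pi cos_minus sin_minus abs_minus abs_of_pos split: if_splits)
qed

lemma lev_step:
  "even n \<Longrightarrow> cos (lev n) * sin (lev n) > 0 \<and> cos (lev n) * cos (lev (n + 1)) < 0 \<and> sin (lev n) * sin (lev (n + 1)) > 0"
  "odd n \<Longrightarrow> cos (lev n) * sin (lev n) < 0 \<and> cos (lev n) * cos (lev (n + 1)) > 0 \<and> sin (lev n) * sin (lev (n + 1)) < 0"
proof -
  show "cos (lev n) * sin (lev n) > 0 \<and> cos (lev n) * cos (lev (n + 1)) < 0 \<and> sin (lev n) * sin (lev (n + 1)) > 0" if "even n"
  proof -
    obtain m where m: "n = 2 * m" using \<open>even n\<close> by (elim evenE)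
    show ?thesis unfolding m lev_even lev_odd cos_add_int_pi sin_add_int_pi
      using trig_\<theta>_pos by (auto simp: mult_less_0_iff zero_less_mult_iff)
  qed
  show "cos (lev n) * sin (lev n) < 0 \<and> cos (lev n) * cos (lev (n + 1)) > 0 \<and> sin (lev n) * sin (lev (n + 1)) < 0" if "odd n"
  proof -
    obtain m where m: "n = 2 * m + 1" using \<open>odd n\<close> by (elim oddE)
    have m1: "2 * m + 1 + 1 = 2 * (m + 1)" by simp
    show ?thesis unfolding m m1 lev_even lev_odd cos_add_int_pi sin_add_int_pi
      using trig_\<theta>_pos by (auto simp: mult_less_0_iff zero_less_mult_iff)
  qed
qed

lemma abs_trig_imp_lev:
  assumes "\<bar>cos v\<bar> = cos \<theta>" "\<bar>sin v\<bar> = sin \<theta>"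
  shows "\<exists>n. v = lev n"
proof -
  define n where "n = \<lfloor>v / (pi / 2)\<rfloor>"
  define \<beta> where "\<beta> = v - of_int n * (pi / 2)"
  have "of_int n * (pi / 2) \<le> v" "v < (of_int n + 1) * (pi / 2)"
    using floor_divide_lower[of "pi / 2" v] floor_divide_upper[of "pi / 2" v] by (simp_all add: n_def)
  then have \<beta>: "0 \<le> \<beta>" "\<beta> < pi / 2" unfolding \<beta>_def distrib_right by simp_all
  have cb: "cos \<beta> > 0" using \<beta> by (intro cos_gt_zero_pi) linarith+
  have sb: "sin \<beta> \<ge> 0" using \<beta> pi_gt_zero by (intro sin_ge_zero) linarith+
  show ?thesis
  proof (cases "even n")
    case True
    then obtain m where m: "n = 2 * m" by (elim evenE)
    have v: "v = \<beta> + of_int m * pi" by (simp add: \<beta>_def m)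
    have "\<bar>cos v\<bar> = cos \<beta>" unfolding v cos_add_int_pi using cb by simp
    then have "cos \<beta> = cos \<theta>" using assms by simp
    then have "\<beta> = \<theta>" by (rule cos_inj_pi[rotated 4]) (use \<beta> \<theta> pi_gt_zero in linarith)+
    then have "v = lev (2 * m)" unfolding lev_even v by simp
    then show ?thesis by blast
  next
    case False
    then obtain m where m: "n = 2 * m + 1" by (elim oddE)
    have v: "v = (\<beta> - pi / 2) + of_int (m + 1) * pi" by (simp add: \<beta>_def m algebra_simps)
    have "cos (\<beta> - pi / 2) = sin \<beta>" by (simp add: cos_diff)
    then have "\<bar>cos v\<bar> = sin \<beta>" unfolding v cos_add_int_pi using sb by simp
    then have "cos (pi / 2 - \<beta>) = cos \<theta>" using assms by (simp add: cos_diff)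
    then have "pi / 2 - \<beta> = \<theta>" by (rule cos_inj_pi[rotated 4]) (use \<beta> \<theta> pi_gt_zero in linarith)+
    then have "\<beta> - pi / 2 = - \<theta>" by simp
    then have "v = lev (2 * m + 1)" unfolding lev_odd v by simp
    then show ?thesis by blast
  qed
qed

lemma V_level_off:
  assumes "F p = \<alpha>"
  obtains n where "n \<ge> 2 * j + 1" "V (ln (norm p)) = lev n"
proof -
  define v where "v = V (ln (norm p))"
  obtain \<sigma> \<tau> where *: "\<sigma> \<in> {1, - 1}" "\<tau> \<in> {1, - 1}" "Re \<alpha> = \<sigma> * (norm \<alpha> * cos v)" "Im \<alpha> = \<tau> * (norm \<alpha> * sin v)"
    using F_eq_\<alpha>[OF assms] unfolding v_def by metis
  have "\<bar>Re \<alpha>\<bar> = norm \<alpha> * \<bar>cos v\<bar>" "\<bar>Im \<alpha>\<bar> = norm \<alpha> * \<bar>sin v\<bar>"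
    using arg_cong[OF *(3), of abs] arg_cong[OF *(4), of abs] *(1,2) by (auto simp: abs_mult)
  then have "\<bar>cos v\<bar> = cos \<theta>" "\<bar>sin v\<bar> = sin \<theta>" unfolding abs_\<alpha> using \<alpha> by simp_all
  then obtain n where n: "v = lev n" using abs_trig_imp_lev by blast
  have "of_int (2 * j + 1) * (pi / 2) < of_int (n + 1) * (pi / 2)"
    using V_ge[of "ln (norm p)"] lev_bounds(2)[of n] n unfolding v_def by linarith
  then have "2 * j + 1 < n + 1"
    using pi_half_gt_zero by (simp only: mult_less_cancel_right_pos of_int_less_iff)
  then show thesis using that[of n] n unfolding v_def by simp
qed

lemma interior_at_lev:
  assumes "V s = lev n"
  shows "0 < \<phi> s" "\<phi> s < pi / 2"
proof -
  have "0 < \<phi> s \<and> \<phi> s < pi / 2"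
  proof (rule interiorI)
    fix k :: int
    show "V s \<noteq> of_int k * (pi / 2)"
    proof
      assume "V s = of_int k * (pi / 2)"
      then have "of_int n * (pi / 2) < of_int k * (pi / 2)" "of_int k * (pi / 2) < of_int (n + 1) * (pi / 2)"
        using lev_bounds[of n] assms by linarith+
      then have "n < k" "k < n + 1"
        using pi_half_gt_zero by (simp_all only: mult_less_cancel_right_pos of_int_less_iff)
      then show False by simp
    qed
  qed
  then show "0 < \<phi> s" "\<phi> s < pi / 2" by blast+
qed

lemma signs:
  assumes "F p = \<alpha>" and V: "V (ln (norm p)) = lev n"
  shows "Re \<alpha> * cos (lev n) * Re p > 0" "Im \<alpha> * sin (lev n) * Im p > 0"
proof -
  define s where "s = ln (norm p)"
  have ph: "0 < \<phi> s" "\<phi> s < pi / 2" using interior_at_lev[OF V] unfolding s_def .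
  obtain \<sigma> \<tau> where *: "\<sigma> \<in> {1, - 1}" "\<tau> \<in> {1, - 1}" "p = point \<sigma> \<tau> s"
    "Re \<alpha> = \<sigma> * (norm \<alpha> * cos (lev n))" "Im \<alpha> = \<tau> * (norm \<alpha> * sin (lev n))"
    using F_eq_\<alpha>[OF assms(1)] unfolding s_def V[symmetric] by metis
  have "cos (\<phi> s) > 0" using ph by (intro cos_gt_zero)
  moreover have "sin (\<phi> s) > 0" using ph pi_gt_zero by (intro sin_gt_zero) linarith+
  moreover have "cos (lev n) \<noteq> 0" "sin (lev n) \<noteq> 0" using lev_abs_trig[of n] trig_\<theta>_pos by auto
  ultimately have pos: "norm \<alpha> * (cos (lev n))\<^sup>2 * (exp s * cos (\<phi> s)) > 0" "norm \<alpha> * (sin (lev n))\<^sup>2 * (exp s * sin (\<phi> s)) > 0"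
    using \<alpha> by simp_all
  have "Re \<alpha> * cos (lev n) * Re p = norm \<alpha> * (cos (lev n))\<^sup>2 * (exp s * cos (\<phi> s)) * (\<sigma> * \<sigma>)"
    "Im \<alpha> * sin (lev n) * Im p = norm \<alpha> * (sin (lev n))\<^sup>2 * (exp s * sin (\<phi> s)) * (\<tau> * \<tau>)"
    unfolding *(4,5) by (simp_all add: *(3) point_def power2_eq_square)
  moreover have "\<sigma> * \<sigma> = 1" "\<tau> * \<tau> = 1" using *(1,2) by auto
  ultimately show "Re \<alpha> * cos (lev n) * Re p > 0" "Im \<alpha> * sin (lev n) * Im p > 0" using pos by simp_all
qed

lemma off_axes:
  assumes "F p = \<alpha>"
  shows "Re p \<noteq> 0" "Im p \<noteq> 0"
  using V_level_off[OF assms] signs[OF assms] by (metis mult_zero_right less_irrefl)+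

lemma card_lev_eq_1:
  assumes V: "V s = lev n"
  shows "finite {i \<in> idx \<omega>. V (x i) = lev n}" "card {i \<in> idx \<omega>. V (x i) = lev n} = 1"
proof -
  note int = interior_at_lev[OF V]
  have eq: "{i \<in> idx \<omega>. V (x i) = lev n} = {i \<in> idx \<omega>. x i = s}"
  proof -
    have "x i = s" if "V (x i) = lev n" for i
      using that V V_strict_mono[of s "x i"] V_strict_mono[of "x i" s] int by (cases "x i" s rule: linorder_cases) auto
    then show ?thesis using V by auto
  qed
  define \<sigma> \<tau> where "\<sigma> = sgn (Re \<alpha>) * sgn (cos (lev n))" and "\<tau> = sgn (Im \<alpha>) * sgn (sin (lev n))"
  have nz: "cos (lev n) \<noteq> 0" "sin (lev n) \<noteq> 0" using lev_abs_trig[of n] trig_\<theta>_pos by auto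
  have st: "\<sigma> \<in> {1, - 1}" "\<tau> \<in> {1, - 1}" using off nz by (auto simp: \<sigma>_def \<tau>_def sgn_if)
  have "\<sigma> * (norm \<alpha> * cos (lev n)) = sgn (Re \<alpha>) * (norm \<alpha> * (sgn (cos (lev n)) * cos (lev n)))"
    "\<tau> * (norm \<alpha> * sin (lev n)) = sgn (Im \<alpha>) * (norm \<alpha> * (sgn (sin (lev n)) * sin (lev n)))"
    unfolding \<sigma>_def \<tau>_def by (simp_all only: mult_ac)
  moreover have "sgn (cos (lev n)) * cos (lev n) = cos \<theta>" "sgn (sin (lev n)) * sin (lev n) = sin \<theta>"
    using lev_abs_trig[of n] by (simp_all add: abs_sgn mult.commute)
  ultimately have R: "Re \<alpha> = \<sigma> * (norm \<alpha> * cos (V s))" "Im \<alpha> = \<tau> * (norm \<alpha> * sin (V s))"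
    unfolding V by (simp_all add: abs_\<alpha>[symmetric] sgn_mult_abs)
  have in_at: "point \<sigma> \<tau> s \<in> at_modulus s"
    by (rule point_at_modulus[OF interior_imp_active[OF int] st R])
  have "p = point \<sigma> \<tau> s" if "p \<in> at_modulus s" for p
  proof -
    have p: "F p = \<alpha>" "ln (norm p) = s" using that by (auto simp: at_modulus_def)
    obtain \<sigma>' \<tau>' where *: "\<sigma>' \<in> {1, - 1}" "\<tau>' \<in> {1, - 1}" "p = point \<sigma>' \<tau>' s"
      "Re \<alpha> = \<sigma>' * (norm \<alpha> * cos (V s))" "Im \<alpha> = \<tau>' * (norm \<alpha> * sin (V s))"
      using F_eq_\<alpha>[OF p(1)] unfolding p(2) by metis
    have "\<sigma>' * (norm \<alpha> * cos (V s)) = \<sigma> * (norm \<alpha> * cos (V s))" "\<tau>' * (norm \<alpha> * sin (V s)) = \<tau> * (norm \<alpha> * sin (V s))"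
      using *(4,5) R by argo+
    then have "\<sigma>' = \<sigma>" "\<tau>' = \<tau>" using \<alpha> nz V by auto
    with *(3) show ?thesis by simp
  qed
  then have at: "at_modulus s = {point \<sigma> \<tau> s}" using in_at by blast
  have Fp: "F (point \<sigma> \<tau> s) = \<alpha>" using in_at by (simp add: at_modulus_def)
  have "alpha_mult F \<alpha> (point \<sigma> \<tau> s) = 1" by (rule mult_off_axes[OF Fp off_axes[OF Fp]])
  then show "finite {i \<in> idx \<omega>. V (x i) = lev n}" "card {i \<in> idx \<omega>. V (x i) = lev n} = 1"
    unfolding eq using card_modulus[of s] at by simp_all
qed

lemma level_of_index_off:
  assumes n: "n \<in> idx \<omega>"
  shows "V (x n) = lev (2 * j + int n)"
proof -
  let ?v = "\<lambda>k. lev (2 * j + 1 + int k)"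
  have v: "strict_mono ?v" by (rule strict_monoI) (simp add: lev_less)
  have levels: "\<exists>k. V (x i) = ?v k" if i: "i \<in> idx \<omega>" for i
  proof -
    obtain m where "m \<ge> 2 * j + 1" "V (x i) = lev m" using V_level_off[OF F_z[OF i]] unfolding x_def .
    then show ?thesis by (intro exI[of _ "nat (m - (2 * j + 1))"]) simp
  qed
  have card: "finite {i \<in> idx \<omega>. V (x i) = ?v k} \<and> card {i \<in> idx \<omega>. V (x i) = ?v k} \<le> 1" for k
  proof (cases "\<exists>s. V s = ?v k")
    case True
    then show ?thesis using card_lev_eq_1 by force
  next
    case False
    then have "{i \<in> idx \<omega>. V (x i) = ?v k} = {}" by blast
    then show ?thesis by (simp only: finite.emptyI card.empty) simp
  qed
  have full: "card {i \<in> idx \<omega>. V (x i) = ?v k} = 1" if "?v k < V s" for k s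
  proof -
    obtain t where "V t = of_int (2 * j + 1) * (pi / 2)" using V_initial by blast
    moreover have "of_int (2 * j + 1) * (pi / 2) \<le> of_int (2 * j + 1 + int k) * (pi / 2)"
      by (intro mult_right_mono) auto
    ultimately have "V t \<le> ?v k" using lev_bounds(1)[of "2 * j + 1 + int k"] by linarith
    then show ?thesis using V_attains[of t "?v k" s] that card_lev_eq_1(2) by auto
  qed
  obtain k where k: "V (x n) = ?v k" "sum (\<lambda>_. 1) {..<k} < n" "n \<le> sum (\<lambda>_. 1) {..k}"
  proof (rule level_of_index[OF v levels _ _ _ n])
    fix k
    show "finite {n \<in> idx \<omega>. V (x n) = ?v k}" "card {n \<in> idx \<omega>. V (x n) = ?v k} \<le> 1"
      using card[of k] by blast+
    show "card {n \<in> idx \<omega>. V (x n) = ?v k} = 1" if "?v k < V s" for s by (rule full[OF that])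
  qed
  then have "n = Suc k" by simp
  with k(1) show ?thesis by (simp add: add_ac)
qed

lemma off_axis_case:
  shows "(\<forall>p\<in>alpha_points F \<alpha>. alpha_mult F \<alpha> p = 1)
      \<and> (1 \<in> idx \<omega> \<longrightarrow> 0 < cmod (z 1))
      \<and> (\<forall>n\<ge>1. Suc n \<in> idx \<omega> \<longrightarrow> cmod (z n) < cmod (z (Suc n)))
      \<and> (\<forall>n\<in>idx \<omega>. Im ((z n)\<^sup>2) \<noteq> 0)
      \<and> (\<forall>l::int. \<forall>n\<ge>1. Suc n \<in> idx \<omega> \<longrightarrow> z n \<in> quadrant l \<longrightarrow>
            z (Suc n) \<in> quadrant (l + \<lfloor>sgn (Im (\<alpha>\<^sup>2))\<rfloor>))
      \<and> (1 \<in> idx \<omega> \<longrightarrow> (-1) powi j * Im \<alpha> * Im (z 1) > 0)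
      \<and> (1 \<in> idx \<omega> \<longrightarrow> Im (\<alpha>\<^sup>2) * Re (z 1) * Im (z 1) < 0)"
proof -
  have sg: "Re \<alpha> * cos (lev (2 * j + int n)) * Re (z n) > 0" "Im \<alpha> * sin (lev (2 * j + int n)) * Im (z n) > 0"
    if "n \<in> idx \<omega>" for n
    using signs[OF F_z[OF that]] level_of_index_off[OF that] unfolding x_def by blast+
  have prev: "n \<in> idx \<omega>" if "n \<ge> 1" "Suc n \<in> idx \<omega>" for n
    using idx_downward[OF that(2,1)] by simp
  have Im_\<alpha>2: "Im (\<alpha>\<^sup>2) = 2 * Re \<alpha> * Im \<alpha>" by (simp add: Im_power2)
  have odd1: "odd (2 * j + int 1)" by simp
  show ?thesis
  proof (intro conjI allI ballI impI)
    fix p assume "p \<in> alpha_points F \<alpha>"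
    then have p: "F p = \<alpha>" using alpha_points_F[OF \<alpha>] by simp
    show "alpha_mult F \<alpha> p = 1" by (rule mult_off_axes[OF p off_axes[OF p]])
  next
    show "0 < cmod (z 1)" if "1 \<in> idx \<omega>" using z_nonzero[OF that] by simp
  next
    fix n assume n: "n \<ge> 1" "Suc n \<in> idx \<omega>"
    note n' = prev[OF n]
    have "V (x n) < V (x (Suc n))" unfolding level_of_index_off[OF n(2)] level_of_index_off[OF n'] by (rule lev_less) simp
    then have "x n < x (Suc n)" using V_mono[of "x (Suc n)" "x n"] by (meson not_le)
    then show "cmod (z n) < cmod (z (Suc n))" by (simp add: norm_z[OF n(2)] norm_z[OF n'])
  next
    fix n assume "n \<in> idx \<omega>"
    then show "Im ((z n)\<^sup>2) \<noteq> 0" using off_axes[OF F_z] by (simp add: Im_power2)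
  next
    fix l :: int and n assume n: "n \<ge> 1" "Suc n \<in> idx \<omega>" and q: "z n \<in> quadrant l"
    note n' = prev[OF n]
    define v w where "v = lev (2 * j + int n)" and "w = lev (2 * j + int n + 1)"
    have 1: "Re \<alpha> * cos v * Re (z n) > 0" "Im \<alpha> * sin v * Im (z n) > 0" using sg[OF n'] unfolding v_def .
    have 2: "Re \<alpha> * cos w * Re (z (Suc n)) > 0" "Im \<alpha> * sin w * Im (z (Suc n)) > 0"
      using sg[OF n(2)] unfolding w_def by (simp_all add: add_ac)
    have RR: "(cos v * cos w) * (Re (z n) * Re (z (Suc n))) > 0" and II: "(sin v * sin w) * (Im (z n) * Im (z (Suc n))) > 0"
      and RI: "(cos v * sin v) * (Re (z n) * Im (z n) * Im (\<alpha>\<^sup>2)) > 0"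
    proof -
      have "(Re \<alpha>)\<^sup>2 * ((cos v * cos w) * (Re (z n) * Re (z (Suc n)))) > 0"
        using mult_pos_pos[OF 1(1) 2(1)] by (simp add: power2_eq_square mult_ac)
      then show "(cos v * cos w) * (Re (z n) * Re (z (Suc n))) > 0" using off by (simp add: zero_less_mult_iff)
      have "(Im \<alpha>)\<^sup>2 * ((sin v * sin w) * (Im (z n) * Im (z (Suc n)))) > 0"
        using mult_pos_pos[OF 1(2) 2(2)] by (simp add: power2_eq_square mult_ac)
      then show "(sin v * sin w) * (Im (z n) * Im (z (Suc n))) > 0" using off by (simp add: zero_less_mult_iff)
      show "(cos v * sin v) * (Re (z n) * Im (z n) * Im (\<alpha>\<^sup>2)) > 0"
        using mult_pos_pos[OF 1(1) 1(2)] unfolding Im_\<alpha>2 by (simp add: mult_ac)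
    qed
    show "z (Suc n) \<in> quadrant (l + \<lfloor>sgn (Im (\<alpha>\<^sup>2))\<rfloor>)"
    proof (rule quadrant_step[OF q])
      show "Im (\<alpha>\<^sup>2) \<noteq> 0" unfolding Im_\<alpha>2 using off by simp
      show "Re (z n) * Re (z (Suc n)) < 0 \<and> Im (z n) * Im (z (Suc n)) > 0" if "Re (z n) * Im (z n) * Im (\<alpha>\<^sup>2) > 0"
      proof -
        have "cos v * sin v > 0" using RI that by (metis zero_less_mult_pos2)
        then have "even (2 * j + int n)" using lev_step(2)[of "2 * j + int n"] unfolding v_def[symmetric] by linarith
        from lev_step(1)[OF this] have "cos v * cos w < 0" "sin v * sin w > 0" unfolding v_def w_def by blast+
        then show ?thesis using RR II by (metis zero_less_mult_iff order_less_asym)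
      qed
      show "Re (z n) * Re (z (Suc n)) > 0 \<and> Im (z n) * Im (z (Suc n)) < 0" if "Re (z n) * Im (z n) * Im (\<alpha>\<^sup>2) < 0"
      proof -
        have "cos v * sin v < 0" using RI that by (metis zero_less_mult_iff order_less_asym)
        then have "odd (2 * j + int n)" using lev_step(1)[of "2 * j + int n"] unfolding v_def[symmetric] by linarith
        from lev_step(2)[OF this] have "cos v * cos w > 0" "sin v * sin w < 0" unfolding v_def w_def by blast+
        then show ?thesis using RR II by (metis zero_less_mult_iff order_less_asym)
      qed
    qed
  next
    assume 1: "1 \<in> idx \<omega>"
    have v: "lev (2 * j + int 1) = - \<theta> + of_int (j + 1) * pi" using lev_odd[of j] by simp
    have "sin (lev (2 * j + int 1)) = (-1) powi j * sin \<theta>" unfolding v sin_add_int_pi minus_one_powi by simp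
    then have "sin \<theta> * ((-1) powi j * Im \<alpha> * Im (z 1)) > 0" using sg(2)[OF 1] by (simp add: mult_ac)
    then show "(-1) powi j * Im \<alpha> * Im (z 1) > 0" using trig_\<theta>_pos(2) by (simp add: zero_less_mult_iff)
    have "(cos (lev (2 * j + int 1)) * sin (lev (2 * j + int 1))) * (Im (\<alpha>\<^sup>2) * Re (z 1) * Im (z 1)) > 0"
      using mult_pos_pos[OF sg(1)[OF 1] sg(2)[OF 1]] unfolding Im_\<alpha>2 by (simp add: mult_ac)
    then show "Im (\<alpha>\<^sup>2) * Re (z 1) * Im (z 1) < 0"
      using lev_step(2)[OF odd1] by (metis zero_less_mult_iff order_less_asym)
  qed
qed

end

definition recip_coeff :: "enat \<Rightarrow> (nat \<Rightarrow> real) \<Rightarrow> nat \<Rightarrow> real" where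
  "recip_coeff \<omega> a k = (if Suc k \<in> idx \<omega> then 1 / a (Suc k) else 0)"

lemma recip_coeff_nonneg: "\<forall>\<nu>\<in>idx \<omega>. a \<nu> > 0 \<Longrightarrow> recip_coeff \<omega> a k \<ge> 0"
  by (simp add: recip_coeff_def less_imp_le)

lemma recip_coeff_0_pos: "0 < \<omega> \<Longrightarrow> \<forall>\<nu>\<in>idx \<omega>. a \<nu> > 0 \<Longrightarrow> recip_coeff \<omega> a 0 > 0"
  by (simp add: recip_coeff_def idx_def Suc_ile_eq zero_enat_def)

lemma ext_factor_recip:
  "ext_factor \<omega> (\<lambda>\<nu>. 1 + w / of_real (a \<nu>)) = (\<lambda>k. 1 + of_real (recip_coeff \<omega> a k) * w)"
  "ext_factor \<omega> (\<lambda>\<nu>. 1 - w / of_real (a \<nu>)) = (\<lambda>k. 1 + of_real (recip_coeff \<omega> a k) * (- w))"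
  by (auto simp: ext_factor_def recip_coeff_def)

lemma ext_prod_recip:
  "ext_prod \<omega> (\<lambda>\<nu>. 1 + w / of_real (a \<nu>)) = canon_prod (recip_coeff \<omega> a) w"
  "ext_prod \<omega> (\<lambda>\<nu>. 1 - w / of_real (a \<nu>)) = canon_prod (recip_coeff \<omega> a) (- w)"
  unfolding ext_prod_def canon_prod_def ext_factor_recip by simp_all

lemma abs_conv_imp_summable_recip:
  assumes "\<forall>\<nu>\<in>idx \<omega>. a \<nu> > 0"
    and "abs_conv_ext_prod \<omega> (\<lambda>\<nu>. 1 + 1 / of_real (a \<nu>)) \<or> abs_conv_ext_prod \<omega> (\<lambda>\<nu>. 1 - 1 / of_real (a \<nu>))"
  shows "summable (recip_coeff \<omega> a)"
  using assms(2) recip_coeff_nonneg[OF assms(1)]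
  unfolding abs_conv_ext_prod_def ext_factor_recip abs_convergent_prod_conv_summable by simp

theorem theorem27:
  fixes j :: int and A :: real and \<omega>1 \<omega>2 \<omega> :: enat and a b :: "nat \<Rightarrow> real"
    and F :: "complex \<Rightarrow> complex" and \<alpha> :: complex and z :: "nat \<Rightarrow> complex"
  assumes "j < 0"
    and "0 < \<omega>1" and "0 < \<omega>2"
    and "A \<ge> 0"
    and "\<forall>\<nu>\<in>idx \<omega>1. a \<nu> > 0"
    and "\<forall>\<mu>\<in>idx \<omega>2. b \<mu> > 0"
    and "\<forall>w. abs_conv_ext_prod \<omega>1 (\<lambda>\<nu>. 1 + w\<^sup>2 / of_real (a \<nu>))"
    and "\<forall>w. abs_conv_ext_prod \<omega>2 (\<lambda>\<mu>. 1 - w\<^sup>2 / of_real (b \<mu>))"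
    and "\<forall>w. F w = w powi (2 * j + 1) * exp (of_real A * w\<^sup>2)
             * ext_prod \<omega>1 (\<lambda>\<nu>. 1 + w\<^sup>2 / of_real (a \<nu>))
             / ext_prod \<omega>2 (\<lambda>\<mu>. 1 - w\<^sup>2 / of_real (b \<mu>))"
    and "\<exists>w. F analytic_on {w} \<and> F w \<noteq> w powi (2 * j + 1)"
    and "\<alpha> \<noteq> 0"
    and "enumerates_alpha_points F \<alpha> \<omega> z"
  shows
    "(Im (\<alpha>\<^sup>2) \<noteq> 0 \<longrightarrow>
        (\<forall>p\<in>alpha_points F \<alpha>. alpha_mult F \<alpha> p = 1)
      \<and> (1 \<in> idx \<omega> \<longrightarrow> 0 < cmod (z 1))
      \<and> (\<forall>n\<ge>1. Suc n \<in> idx \<omega> \<longrightarrow> cmod (z n) < cmod (z (Suc n)))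
      \<and> (\<forall>n\<in>idx \<omega>. Im ((z n)\<^sup>2) \<noteq> 0)
      \<and> (\<forall>l::int. \<forall>n\<ge>1. Suc n \<in> idx \<omega> \<longrightarrow> z n \<in> quadrant l \<longrightarrow>
            z (Suc n) \<in> quadrant (l + \<lfloor>sgn (Im (\<alpha>\<^sup>2))\<rfloor>))
      \<and> (1 \<in> idx \<omega> \<longrightarrow> (-1) powi j * Im \<alpha> * Im (z 1) > 0)
      \<and> (1 \<in> idx \<omega> \<longrightarrow> Im (\<alpha>\<^sup>2) * Re (z 1) * Im (z 1) < 0))
   \<and> (Im \<alpha> = 0 \<longrightarrow>
        (1 \<in> idx \<omega> \<longrightarrow> 0 < cmod (z 1))
      \<and> (\<forall>n\<ge>1. 2 * n \<in> idx \<omega> \<longrightarrow> cmod (z (2 * n - 1)) \<le> cmod (z (2 * n)))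
      \<and> (\<forall>n\<ge>1. 2 * n + 1 \<in> idx \<omega> \<longrightarrow> cmod (z (2 * n)) < cmod (z (2 * n + 1)))
      \<and> (\<forall>p\<in>alpha_points F \<alpha>. Re p \<noteq> 0)
      \<and> (\<forall>p\<in>alpha_points F \<alpha>. Im p = 0 \<longrightarrow> alpha_mult F \<alpha> p \<in> {1, 2})
      \<and> (\<forall>p\<in>alpha_points F \<alpha>. Im p \<noteq> 0 \<longrightarrow> alpha_mult F \<alpha> p = 1)
      \<and> (\<forall>n\<ge>1. 2 * n \<in> idx \<omega> \<longrightarrow> cmod (z (2 * n - 1)) = cmod (z (2 * n)) \<longrightarrow>
            z (2 * n - 1) = cnj (z (2 * n)))
      \<and> (\<forall>n\<ge>1. 2 * n \<in> idx \<omega> \<longrightarrow> cmod (z (2 * n - 1)) < cmod (z (2 * n)) \<longrightarrow>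
            Arg (z (2 * n - 1)) = Arg (z (2 * n)) \<and> Arg (z (2 * n)) \<in> {0, pi})
      \<and> (\<forall>n\<ge>1. 2 * n + 1 \<in> idx \<omega> \<longrightarrow> Re (z (2 * n)) * Re (z (2 * n + 1)) < 0)
      \<and> (1 \<in> idx \<omega> \<longrightarrow> (-1) powi j * Re \<alpha> * Re (z 1) < 0)
      \<and> (2 \<in> idx \<omega> \<longrightarrow> cmod (z 1) < cmod (z 2) \<longrightarrow> j = -1))
   \<and> (Re \<alpha> = 0 \<longrightarrow>
        (1 \<in> idx \<omega> \<longrightarrow> 0 < cmod (z 1))
      \<and> (\<forall>n\<ge>1. 2 * n \<in> idx \<omega> \<longrightarrow> cmod (z (2 * n - 1)) < cmod (z (2 * n)))
      \<and> (\<forall>n\<ge>1. 2 * n + 1 \<in> idx \<omega> \<longrightarrow> cmod (z (2 * n)) \<le> cmod (z (2 * n + 1)))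
      \<and> (\<forall>p\<in>alpha_points F \<alpha>. Im p \<noteq> 0)
      \<and> (\<forall>p\<in>alpha_points F \<alpha>. Re p = 0 \<longrightarrow> alpha_mult F \<alpha> p \<in> {1, 2})
      \<and> (\<forall>p\<in>alpha_points F \<alpha>. Re p \<noteq> 0 \<longrightarrow> alpha_mult F \<alpha> p = 1)
      \<and> (\<forall>n\<ge>1. 2 * n + 1 \<in> idx \<omega> \<longrightarrow> cmod (z (2 * n)) = cmod (z (2 * n + 1)) \<longrightarrow>
            z (2 * n) = - cnj (z (2 * n + 1)))
      \<and> (\<forall>n\<ge>1. 2 * n + 1 \<in> idx \<omega> \<longrightarrow> cmod (z (2 * n)) < cmod (z (2 * n + 1)) \<longrightarrow>
            Arg (z (2 * n)) = Arg (z (2 * n + 1)) \<and> Arg (z (2 * n + 1)) \<in> {- pi / 2, pi / 2})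
      \<and> (\<forall>n\<ge>1. 2 * n \<in> idx \<omega> \<longrightarrow> Im (z (2 * n - 1)) * Im (z (2 * n)) < 0)
      \<and> (1 \<in> idx \<omega> \<longrightarrow> (-1) powi j * Im \<alpha> * Im (z 1) > 0)
      \<and> (1 \<in> idx \<omega> \<longrightarrow> Re (z 1) = 0))"
proof -
  let ?c = "recip_coeff \<omega>1 a" and ?d = "recip_coeff \<omega>2 b"
  note pos = assms(5,6)
  have "summable ?c" "summable ?d"
    using abs_conv_imp_summable_recip[OF pos(1)] abs_conv_imp_summable_recip[OF pos(2)]
      assms(7)[THEN spec, of 1] assms(8)[THEN spec, of 1] by simp_all
  then interpret laguerre_quotient j A ?c ?d
    using assms(1-4) recip_coeff_nonneg[OF pos(1)] recip_coeff_nonneg[OF pos(2)] recip_coeff_0_pos[OF _ pos(1)]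
    by unfold_locales simp_all
  have F_eq: "F = laguerre_quotient.F j A ?c ?d"
  proof
    fix w show "F w = laguerre_quotient.F j A ?c ?d w"
      using assms(9) by (simp add: F_def E_def D_def ext_prod_recip)
  qed
  with assms(11,12) interpret enumerated_alpha_points j A ?c ?d \<alpha> \<omega> z
    by unfold_locales simp_all
  have off: "off_axis_alpha_points j A ?c ?d \<alpha> \<omega> z" if "Im (\<alpha>\<^sup>2) \<noteq> 0"
    using that by unfold_locales (auto simp: Im_power2)
  show ?thesis
    unfolding F_eq
    by (rule conjI[OF impI conjI[OF impI impI]], rule off_axis_alpha_points.off_axis_case[OF off], assumption,
        erule real_case, erule imaginary_case)
qed

end
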